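(* For every $\gamma\in(0,(\alpha-1)/\alpha)$, it holds that $$\lim_{C\to\infty}\liminf_{n\to\infty}\mathbf{P}\left(\sup_{0\le s\ne t\le1}\frac{B_n}{n}\cdot\frac{|H_n(nt)-H_n(ns)|}{|t-s|^\gamma}\le C\right)=1.$$
   Context: $\mu$ is a probability measure on $\mathbf{Z}_+=\{0,1,\dots\}$ with $\mu(0)>0$, $\sum_{k} k\mu(k)=1$, aperiodic (its support generates the group $\mathbf{Z}$), and in the domain of attraction of an $\alpha$-stable law with $\alpha\in(1,2]$: there is an increasing sequence $(B_n)_{n\ge1}$ (fixed throughout) such that, for $(\xi_i)$ i.i.d. with law $\mu$, $B_n^{-1}(\xi_1+\dots+\xi_n-n)$ converges in distribution to $X^{(\alpha)}$, where $\mathbf{E}[e^{-\lambda X^{(\alpha)}}]=e^{\lambda^\alpha}$ for all $\lambda\ge0$. For $n$ large enough, $T_n$ is a Bienaymé–Galton–Watson plane tree with offspring distribution $\mu$ conditioned to have $n+1$ vertices. Its vertices in lexicographical (depth-first) order are $u_0<u_1<\dots<u_n$, with $u_0$ the root, and $|u|$ is the generation (distance to the root) of $u$. The height process is $H_n(j)=|u_j|$ for integers $0\le j\le n$, extended to a continuous function on $[0,n]$ by linear interpolation. *)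

theory Defs
  imports
    "HOL-Probability.Probability"
    "HOL-Computational_Algebra.Group_Closure"
    "HOL-Library.List_Lexorder"
begin

text \<open>
  The law of \<open>X\<close> with \<open>E[exp (- l X)] = exp (l powr \<alpha>)\<close> for all \<open>l \<ge> 0\<close>; the Laplace transform
  determines the law.
\<close>
definition stable_law :: "real \<Rightarrow> real measure \<Rightarrow> bool" where
  "stable_law \<alpha> \<nu> \<longleftrightarrow> real_distribution \<nu> \<and>
     (\<forall>l\<ge>0. has_bochner_integral \<nu> (\<lambda>x. exp (- l * x)) (exp (l powr \<alpha>)))"

definition rescaled_sum_law :: "nat pmf \<Rightarrow> (nat \<Rightarrow> real) \<Rightarrow> nat \<Rightarrow> real measure" where
  "rescaled_sum_law \<mu> B n =
     distr (\<Pi>\<^sub>M i\<in>UNIV. measure_pmf \<mu>) borel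
       (\<lambda>\<xi> :: nat \<Rightarrow> nat. ((\<Sum>i=1..n. real (\<xi> i)) - real n) / B n)"

text \<open>
  Vertices are Ulam--Harris words: \<open>[]\<close> is the root, and the children of \<open>u\<close>, from left to
  right, are \<open>u @ [0], \<dots>, u @ [k u - 1]\<close>. Hence the generation of \<open>u\<close> is \<open>length u\<close>, and depth-first
  order is the order on \<open>nat list\<close> from \<open>List_Lexorder\<close>, in which a word follows its proper prefixes.
\<close>
inductive_set plane_tree :: "(nat list \<Rightarrow> nat) \<Rightarrow> nat list set" for k where
  root: "[] \<in> plane_tree k"
| child: "u \<in> plane_tree k \<Longrightarrow> i < k u \<Longrightarrow> u @ [i] \<in> plane_tree k"

text \<open>
  Under this measure \<open>plane_tree k\<close> is a Bienayme--Galton--Watson tree: the offspring numbers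
  \<open>k u\<close> are i.i.d. with law \<open>\<mu>\<close>.
\<close>
definition offspring_measure :: "nat pmf \<Rightarrow> (nat list \<Rightarrow> nat) measure" where
  "offspring_measure \<mu> = (\<Pi>\<^sub>M u\<in>UNIV. measure_pmf \<mu>)"

text \<open>
  Conditional probability given that the tree has \<open>n + 1\<close> vertices. \<open>card\<close> is \<open>0\<close> on infinite
  sets, so the conditioning event forces finiteness. The value is \<open>0\<close> by convention
  when the conditioning event is null.
\<close>
definition conditioned_BGW_prob :: "nat pmf \<Rightarrow> nat \<Rightarrow> (nat list set \<Rightarrow> bool) \<Rightarrow> real" where
  "conditioned_BGW_prob \<mu> n Q =
     \<P>(k in offspring_measure \<mu>. Q (plane_tree k) \<bar> card (plane_tree k) = n + 1)"

definition dfs_vertex :: "nat list set \<Rightarrow> nat \<Rightarrow> nat list" where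
  "dfs_vertex T j = sorted_list_of_set T ! j"

text \<open>
  Linear interpolation on \<open>[0, n]\<close> for a tree with \<open>n + 1\<close> vertices. At \<open>x = n\<close> the out-of-range
  term has coefficient \<open>frac x = 0\<close>.
\<close>
definition height_process :: "nat list set \<Rightarrow> real \<Rightarrow> real" where
  "height_process T x =
     (let h = (\<lambda>j. real (length (dfs_vertex T j))); j = nat \<lfloor>x\<rfloor>
      in h j + frac x * (h (Suc j) - h j))"

end

theory Submission
  imports Defs
begin

text \<open>
  Read a tree through the word of its offspring numbers in depth-first order. The height of the \<open>j\<close>th
  vertex is the number of records (weak future minima) of the Lukasiewicz walk before time \<open>j\<close>, so that the height
  rises between times \<open>i\<close> and \<open>j\<close> by at most the number of records inside the window, a
  subadditive quantity which depends only on the window. By the cycle lemma, windows of the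
  excursion may be replaced by windows of the bridge. In a free window of length \<open>l\<close>, records
  renew the walk, and the number of records exceeds \<open>r\<close> with probability at most \<open>(1 - u) ^ r\<close>,
  where \<open>u\<close> is the probability of having none, which by the cycle lemma is the mean negative
  part of the walk at time \<open>l\<close> divided by \<open>l\<close>, of order \<open>B l / l\<close> at least. A local limit theorem whose limit
  density is positive at \<open>0\<close> shows that conditioning on the bridge costs only a constant factor,
  and dyadic chaining bounds all rises, with any exponent below \<open>1 - 1 / \<alpha>\<close>.
  Finally, a drop by \<open>D\<close> over a time \<open>d\<close> is a rise by \<open>D\<close> in the mirror tree over a time at most
  \<open>D + d\<close>. The case \<open>D > d\<close> only contributes a term which is negligible if the exponent used for the
  rises is close enough to \<open>1 - 1 / \<alpha>\<close>.
\<close>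

subsection \<open>Forests and their preorder words\<close>

text \<open>\<open>B\<close> is only known to be increasing, with a weak limit; regular variation is
  not given. Its substitute is the limit of \<open>B n / B (2 * n)\<close>, forced by the scaling of
  the stable law along subsequences; iterated doubling then yields the power bounds. Records bound
  rises only: the height climbs by at most one per vertex but may fall by any amount, which is why
  the tree is also read in its mirror image, a bijection that preserves the law. The exponent comes
  from the record rate: a window of length \<open>l\<close> has of order at most
  \<open>l / B l\<close> records, to be compared with
  \<open>(N / B N) * (l / N) powr \<gamma>\<close>. Since \<open>B\<close> grows like a power
  \<open>1 / \<alpha>\<close> up to small errors in the exponent, a margin remains for \<gamma>
  below \<open>1 - 1 / \<alpha>\<close>, and with an exponential tail it beats the number
  \<open>N / l\<close> of windows. Conditioning costs a constant because windows of at most half the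
  length leave enough letters outside for all point probabilities to be of order at most
  \<open>1 / B N\<close>, whereas the bridge has at least this order of probability.\<close>

text \<open>A binary encoding: in \<open>Tree c r\<close>, the first tree has \<open>c\<close> as the forest of subtrees of its root, and
  \<open>r\<close> consists of the remaining trees. A single tree is \<open>Tree f Void\<close>.\<close>

datatype forest = Void | Tree forest forest

primrec width :: "forest \<Rightarrow> nat" where
  "width Void = 0"
| "width (Tree c r) = Suc (width r)"

primrec code :: "forest \<Rightarrow> nat list" where
  "code Void = []"
| "code (Tree c r) = width c # code c @ code r"

primrec heights :: "forest \<Rightarrow> nat list" where
  "heights Void = []"
| "heights (Tree c r) = 0 # map Suc (heights c) @ heights r"

primrec join :: "forest \<Rightarrow> forest \<Rightarrow> forest" where
  "join Void g = g"
| "join (Tree c r) g = Tree c (join r g)"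

primrec mirror :: "forest \<Rightarrow> forest" where
  "mirror Void = Void"
| "mirror (Tree c r) = join (mirror r) (Tree (mirror c) Void)"

text \<open>Let \<open>W\<close> be the walk with increments \<open>x - 1\<close> along \<open>xs\<close>. Reading \<open>xs\<close> from the right, \<open>deficit 0 xs\<close> is
  the value of \<open>- min W\<close> (a reflected walk), and \<open>records 0 xs\<close> counts the times \<open>k < length xs\<close> with
  \<open>W k \<le> min W\<close> over the later times.\<close>

fun deficit :: "nat \<Rightarrow> nat list \<Rightarrow> nat" where
  "deficit e [] = e"
| "deficit e (x # xs) = deficit e xs + 1 - x"

fun records :: "nat \<Rightarrow> nat list \<Rightarrow> nat" where
  "records e [] = 0"
| "records e (x # xs) = records e xs + (if deficit e xs < x then 1 else 0)"

lemma length_code [simp]: "length (code f) = size f"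
  by (induction f) auto

lemma length_heights [simp]: "length (heights f) = size f"
  by (induction f) auto

lemma join_Void [simp]: "join f Void = f"
  by (induction f) auto

lemma join_assoc: "join (join f g) h = join f (join g h)"
  by (induction f) auto

lemma width_join [simp]: "width (join f g) = width f + width g"
  by (induction f) auto

lemma size_join [simp]: "size (join f g) = size f + size g"
  by (induction f) auto

lemma code_join [simp]: "code (join f g) = code f @ code g"
  by (induction f) auto

lemma heights_join [simp]: "heights (join f g) = heights f @ heights g"
  by (induction f) auto

lemma mirror_join: "mirror (join f g) = join (mirror g) (mirror f)"
  by (induction f) (auto simp: join_assoc)

lemma mirror_mirror [simp]: "mirror (mirror f) = f"
  by (induction f) (auto simp: mirror_join)

lemma width_mirror [simp]: "width (mirror f) = width f"
  by (induction f) auto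

lemma size_mirror [simp]: "size (mirror f) = size f"
  by (induction f) auto

lemma mset_code_mirror: "mset (code (mirror f)) = mset (code f)"
  by (induction f) auto

text \<open>This is the parsing step: a vertex with \<open>m\<close> children absorbs the first
  \<open>m\<close> trees to its right.\<close>

lemma join_split: "m \<le> width g \<Longrightarrow> \<exists>c r. g = join c r \<and> width c = m"
proof (induction g arbitrary: m)
  case Void
  then show ?case by (intro exI[of _ Void]) auto
next
  case (Tree c r)
  show ?case
  proof (cases m)
    case 0
    then show ?thesis by (metis join.simps(1) width.simps(1))
  next
    case (Suc k)
    with Tree.prems have "k \<le> width r" by simp
    with Tree.IH(2) obtain c' r' where "r = join c' r'" "width c' = k" by blast
    then have "Tree c r = join (Tree c c') r' \<and> width (Tree c c') = m" using Suc by simp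
    then show ?thesis by blast
  qed
qed

lemma join_eq_iff: "width c = width c' \<Longrightarrow> join c r = join c' r' \<longleftrightarrow> c = c' \<and> r = r'"
proof (induction c arbitrary: c')
  case Void
  then show ?case by (cases c') auto
next
  case (Tree a b)
  then show ?case by (cases c') auto
qed

text \<open>The induction runs over the code: deleting the first root leaves the forest
  \<open>join c r\<close>, which is not a subterm, and the head of the code tells where to cut
  it.\<close>

lemma code_inject: "code f = code g \<Longrightarrow> width f = width g \<Longrightarrow> f = g"
proof (induction "code f" arbitrary: f g)
  case Nil
  then show ?case by (cases f; cases g) auto
next
  case (Cons x xs)
  obtain c r where f: "f = Tree c r" using Cons.hyps(2) by (cases f) auto
  obtain c' r' where g: "g = Tree c' r'" using Cons.hyps(2) Cons.prems by (cases g) auto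
  have w: "width c = width c'" "width r = width r'" using Cons.prems f g by auto
  have "join c r = join c' r'"
    by (rule Cons.hyps(1)) (use Cons f g w in auto)
  then show ?case using w f g by (simp add: join_eq_iff)
qed

section \<open>Deficit and records along preorder words\<close>

lemma deficit_append: "deficit e (xs @ ys) = deficit (deficit e ys) xs"
  by (induction xs) auto

lemma records_append: "records e (xs @ ys) = records e ys + records (deficit e ys) xs"
  by (induction xs) (auto simp: deficit_append)

lemma deficit_mono: "e \<le> e' \<Longrightarrow> deficit e xs \<le> deficit e' xs"
  by (induction xs) auto

lemma records_antimono: "e \<le> e' \<Longrightarrow> records e' xs \<le> records e xs"
proof (induction xs)
  case (Cons x xs)
  then show ?case using deficit_mono[of e e' xs] by (auto intro: le_SucI)
qed auto

text \<open>A suffix can only leave a larger deficit behind, and a larger deficit turns fewer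
  letters into records. This subadditivity is what chaining requires.\<close>

lemma records_append_le: "records 0 (xs @ ys) \<le> records 0 xs + records 0 ys"
  using records_antimono[of 0 "deficit 0 ys" xs] by (simp add: records_append)

text \<open>Read from the right, a complete forest never finds children missing, so the subtraction
  is not truncated and its trees are added to those already counted in \<open>e\<close>.\<close>

lemma deficit_code [simp]: "deficit e (code f) = e + width f"
  by (induction f arbitrary: e) (auto simp: deficit_append)

lemma records_code [simp]: "records e (code f) = 0"
  by (induction f arbitrary: e) (auto simp: deficit_append records_append)

text \<open>A strict prefix leaves some tree of the forest unfinished. Applied below a vertex, it
  says that this vertex still lacks a child and is therefore a record of the prefix.\<close>

lemma deficit_take_code: "j < size f \<Longrightarrow> deficit 0 (take j (code f)) < width f"
proof (induction f arbitrary: j)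
  case (Tree c r)
  show ?case
  proof (cases j)
    case (Suc k)
    show ?thesis
    proof (cases "k < size c")
      case True
      then show ?thesis using Tree.IH(1)[of k] Suc by simp
    next
      case False
      then show ?thesis using Tree.IH(2)[of "k - size c"] Tree.prems Suc
        by (simp add: deficit_append)
    qed
  qed simp
qed simp

text \<open>The records of a prefix are the vertices whose subtrees are not exhausted yet, that is,
  the ancestors of the next vertex; each of them resets the deficit to 0.\<close>

lemma heights_eq_records: "j < size f \<Longrightarrow> heights f ! j = records 0 (take j (code f))"
proof (induction f arbitrary: j)
  case (Tree c r)
  show ?case
  proof (cases j)
    case (Suc k)
    show ?thesis
    proof (cases "k < size c")
      case True
      then show ?thesis using Tree.IH(1)[of k] Suc deficit_take_code[of k c]
        by (simp add: nth_append)
    next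
      case False
      then show ?thesis using Tree.IH(2)[of "k - size c"] Tree.prems Suc
        by (simp add: nth_append deficit_append records_append)
    qed
  qed simp
qed simp

text \<open>Without records, each letter finds enough complete trees to its right to become their
  parent.\<close>

lemma ex_code:
  "records 0 xs = 0 \<Longrightarrow> \<exists>f. code f = xs \<and> width f = deficit 0 xs"
proof (induction xs)
  case Nil
  then show ?case by (intro exI[of _ Void]) auto
next
  case (Cons x xs)
  then have *: "records 0 xs = 0" "x \<le> deficit 0 xs" by (auto split: if_splits)
  with Cons obtain g where g: "code g = xs" "width g = deficit 0 xs" by auto
  with * obtain c r where "g = join c r" "width c = x" using join_split[of x g] by auto
  then show ?case using g by (intro exI[of _ "Tree c r"]) auto
qed

lemma deficit_records_0: "records 0 xs = 0 \<Longrightarrow> deficit 0 xs + sum_list xs = length xs"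
  by (induction xs) (auto split: if_splits)

section \<open>Mirror images and drops of the height\<close>

text \<open>The witness \<open>b\<close> is the mirror position of the vertex, and \<open>a\<close>
  that of its ancestor \<open>D\<close> generations up. Vertices that precede the given one in both
  orders are its ancestors, whence the first bound. Between \<open>a\<close> and \<open>b\<close>
  lie, besides the line of descent, only vertices to the right of the given one, whence the
  second.\<close>

lemma mirror_vertex:
  assumes "i < size f"
  shows "\<exists>b < size f. heights (mirror f) ! b = heights f ! i \<and>
    b + i + 1 \<le> heights f ! i + size f \<and>
    (\<forall>D \<le> heights f ! i. \<exists>a \<le> b. heights (mirror f) ! a + D = heights f ! i \<and>
        b + i + 1 \<le> a + D + size f)"
  using assms
proof (induction f arbitrary: i)
  case (Tree c r)
  show ?case
  proof (cases i)
    case 0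
    \<comment> \<open>In the mirror image the trees of \<open>r\<close> come before the first tree,
      so its root moves to position \<open>size r\<close> and its descendants start at
      \<open>size r + 1\<close>.\<close>
    have "heights (mirror (Tree c r)) ! size r = 0" by (simp add: nth_append)
    then show ?thesis using 0
      by (intro exI[of _ "size r"]) (simp, blast)
  next
    case (Suc k)
    show ?thesis
    proof (cases "k < size c")
      case True
      from Tree.IH(1)[OF True] obtain b where b: "b < size c"
        "heights (mirror c) ! b = heights c ! k" "b + k + 1 \<le> heights c ! k + size c"
        and D: "\<And>D. D \<le> heights c ! k \<Longrightarrow> \<exists>a \<le> b. heights (mirror c) ! a + D = heights c ! k \<and>
        b + k + 1 \<le> a + D + size c" by blast
      have hi: "heights (Tree c r) ! i = Suc (heights c ! k)" using Suc True by (simp add: nth_append)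
      have hm: "heights (mirror (Tree c r)) ! (size r + 1 + a) = Suc (heights (mirror c) ! a)"
        if "a < size c" for a using that by (simp add: nth_append)
      have "\<exists>a \<le> size r + 1 + b. heights (mirror (Tree c r)) ! a + D = Suc (heights c ! k) \<and>
        size r + 1 + b + i + 1 \<le> a + D + size (Tree c r)" if DD: "D \<le> Suc (heights c ! k)" for D
      proof (cases "D = Suc (heights c ! k)")
        case True
        have "heights (mirror (Tree c r)) ! size r = 0" by (simp add: nth_append)
        then show ?thesis using b Suc True by (intro exI[of _ "size r"]) simp
      next
        case False
        then obtain a where "a \<le> b" "heights (mirror c) ! a + D = heights c ! k"
          "b + k + 1 \<le> a + D + size c" using D[of D] DD by auto
        then show ?thesis using b Suc hm[of a] by (intro exI[of _ "size r + 1 + a"]) simp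
      qed
      then show ?thesis unfolding hi using b Suc hm[of b]
        by (intro exI[of _ "size r + 1 + b"]) simp
    next
      case False
      then have k: "k - size c < size r" using Tree.prems Suc by auto
      from Tree.IH(2)[OF k] obtain b where b: "b < size r"
        "heights (mirror r) ! b = heights r ! (k - size c)"
        "b + (k - size c) + 1 \<le> heights r ! (k - size c) + size r"
        and D: "\<And>D. D \<le> heights r ! (k - size c) \<Longrightarrow>
          \<exists>a \<le> b. heights (mirror r) ! a + D = heights r ! (k - size c) \<and>
        b + (k - size c) + 1 \<le> a + D + size r" by blast
      have hi: "heights (Tree c r) ! i = heights r ! (k - size c)"
        using Suc False by (simp add: nth_append)
      have hm: "heights (mirror (Tree c r)) ! a = heights (mirror r) ! a"
        if "a < size r" for a using that by (simp add: nth_append)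
      have "\<exists>a \<le> b. heights (mirror (Tree c r)) ! a + D = heights r ! (k - size c) \<and>
        b + i + 1 \<le> a + D + size (Tree c r)" if DD: "D \<le> heights r ! (k - size c)" for D
      proof -
        obtain a where "a \<le> b" "heights (mirror r) ! a + D = heights r ! (k - size c)"
          "b + (k - size c) + 1 \<le> a + D + size r" using D[of D] DD by auto
        then show ?thesis using b Suc False hm[of a] by (intro exI[of _ "a"]) simp
      qed
      then show ?thesis unfolding hi using b Suc hm[of b] False
        by (intro exI[of _ "b"]) simp
    qed
  qed
qed simp

text \<open>Take for \<open>b\<close> the mirror position of vertex \<open>i\<close>, and for
  \<open>a\<close> that of the ancestor of \<open>i\<close> at the height of \<open>j\<close>. The
  part of this ancestor's subtree to the right of \<open>i\<close> is visited between
  \<open>i\<close> and \<open>j\<close>, so going from \<open>a\<close> to \<open>b\<close> costs at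
  most \<open>j - i\<close> vertices beyond the line of descent of length \<open>D\<close>.\<close>

lemma mirror_drop:
  assumes "i < j" "j < size f" "heights f ! i = heights f ! j + D"
  shows "\<exists>a b. a \<le> b \<and> b < size f \<and> heights (mirror f) ! b = heights (mirror f) ! a + D \<and>
    b + i \<le> a + D + j"
  using assms
proof (induction f arbitrary: i j)
  case (Tree c r)
  have hc: "heights (mirror (Tree c r)) ! (size r + 1 + a) = Suc (heights (mirror c) ! a)"
    if "a < size c" for a using that by (simp add: nth_append)
  have hr: "heights (mirror (Tree c r)) ! a = heights (mirror r) ! a"
    if "a < size r" for a using that by (simp add: nth_append)
  show ?case
  proof (cases i)
    \<comment> \<open>Vertex 0 is a root, of height 0, which forces \<open>D = 0\<close>.\<close>
    case 0
    then show ?thesis using Tree.prems by (intro exI[of _ 0]) auto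
  next
    case (Suc k)
    obtain l where j: "j = Suc l" using Tree.prems by (cases j) auto
    consider "l < size c" | "k < size c" "l \<ge> size c" | "k \<ge> size c" by linarith
    then show ?thesis
    proof cases
      case 1
      then have "k < l" "l < size c" "heights c ! k = heights c ! l + D"
        using Tree.prems Suc j by (auto simp: nth_append)
      from Tree.IH(1)[OF this] obtain a b where "a \<le> b" "b < size c"
        "heights (mirror c) ! b = heights (mirror c) ! a + D" "b + k \<le> a + D + l" by blast
      then show ?thesis using hc[of a] hc[of b] Suc j
        by (intro exI[of _ "size r + 1 + a"] exI[of _ "size r + 1 + b"]) simp
    next
      \<comment> \<open>Here \<open>i\<close> lies below the first root and \<open>j\<close> in a
        later tree, so everything below this root to the right of \<open>i\<close> is visited before
        \<open>j\<close>. \<open>mirror_vertex\<close> supplies the ancestor inside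
        \<open>c\<close>, unless it is the root itself.\<close>
      case 2
      have hi: "heights (Tree c r) ! i = Suc (heights c ! k)" using Suc 2 by (simp add: nth_append)
      from mirror_vertex[OF 2(1)] obtain b where b: "b < size c"
        "heights (mirror c) ! b = heights c ! k" "b + k + 1 \<le> heights c ! k + size c"
        and D: "\<And>D. D \<le> heights c ! k \<Longrightarrow> \<exists>a \<le> b. heights (mirror c) ! a + D = heights c ! k \<and>
        b + k + 1 \<le> a + D + size c" by blast
      have DD: "D \<le> Suc (heights c ! k)" using Tree.prems hi by simp
      show ?thesis
      proof (cases "D = Suc (heights c ! k)")
        case True
        have "heights (mirror (Tree c r)) ! (size r + 1 + b) = heights (mirror (Tree c r)) ! (size r) + D"
          using hc[of b] b True by (simp add: nth_append)
        then show ?thesis using b Suc j 2 True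
          by (intro exI[of _ "size r"] exI[of _ "size r + 1 + b"]) simp
      next
        case False
        then obtain a where "a \<le> b" "heights (mirror c) ! a + D = heights c ! k"
          "b + k + 1 \<le> a + D + size c" using D[of D] DD by auto
        then show ?thesis using b Suc j 2 hc[of a] hc[of b]
          by (intro exI[of _ "size r + 1 + a"] exI[of _ "size r + 1 + b"]) simp
      qed
    next
      case 3
      then have "k - size c < l - size c" "l - size c < size r"
        "heights r ! (k - size c) = heights r ! (l - size c) + D"
        using Tree.prems Suc j by (auto simp: nth_append)
      from Tree.IH(2)[OF this] obtain a b where "a \<le> b" "b < size r"
        "heights (mirror r) ! b = heights (mirror r) ! a + D"
        "b + (k - size c) \<le> a + D + (l - size c)" by blast
      then show ?thesis using hr[of a] hr[of b] Suc j 3 Tree.prems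
        by (intro exI[of _ "a"] exI[of _ "b"]) simp
    qed
  qed
qed simp

lemma records_window:
  assumes "i \<le> j" "j < size f"
  shows "heights f ! j \<le> heights f ! i + records 0 (take (j - i) (drop i (code f)))"
proof -
  have "take j (code f) = take i (code f) @ take (j - i) (drop i (code f))"
    using assms by (metis le_add_diff_inverse take_add)
  then show ?thesis
    using assms records_append_le[of "take i (code f)" "take (j - i) (drop i (code f))"]
    by (simp add: heights_eq_records)
qed

section \<open>The cycle lemma\<close>

text \<open>Reading the reversed word from the right is reading \<open>xs\<close> from the left.
  Until a record occurs the subtraction is not truncated, so the deficit is the walk with increments
  \<open>1 - x\<close> started at \<open>e\<close>.\<close>

lemma records_rev_forward:
  "records e (rev xs) = 0 \<longleftrightarrow>
     (\<forall>m<length xs. (\<Sum>i<m. 1 - int (xs ! i)) + int e \<ge> int (xs ! m))"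
proof (induction xs arbitrary: e)
  case Nil
  then show ?case by simp
next
  case (Cons x xs)
  have "(\<forall>m<length (x # xs). (\<Sum>i<m. 1 - int ((x # xs) ! i)) + int e \<ge> int ((x # xs) ! m)) \<longleftrightarrow>
    x \<le> e \<and> (\<forall>m<length xs. (1 - int x) + (\<Sum>i<m. 1 - int (xs ! i)) + int e \<ge> int (xs ! m))"
    by (simp add: All_less_Suc2 sum.lessThan_Suc_shift del: sum.lessThan_Suc)
  also have "\<dots> \<longleftrightarrow> x \<le> e \<and>
      (\<forall>m<length xs. (\<Sum>i<m. 1 - int (xs ! i)) + int (e + 1 - x) \<ge> int (xs ! m))"
    by (intro conj_cong refl) (auto simp: of_nat_diff algebra_simps)
  also have "\<dots> \<longleftrightarrow> records e (rev (x # xs)) = 0"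
    using Cons.IH[of "e + 1 - x"] by (auto simp: records_append)
  finally show ?case ..
qed

text \<open>For positive drift the minimum over one period ahead is that of the whole future. It
  changes only when \<open>w a\<close> lies strictly below all later values, and then by 1, because
  upward steps are at most 1; over a period these changes add up to \<open>D\<close>.\<close>

lemma future_minimum_count:
  fixes w :: "nat \<Rightarrow> int"
  assumes per: "\<And>j. w (j + N) = w j + D" and "D > 0" and up: "\<And>j. w (Suc j) \<le> w j + 1"
  shows "int (card {a \<in> {..<N}. \<forall>m<N. w a < w (a + Suc m)}) = D"
proof -
  have "N > 0" using per[of 0] \<open>D > 0\<close> by (cases N) auto
  define f where "f a = Min (w ` {a..a + N})" for a
  have f_le: "f a \<le> w b" if "a \<le> b" "b \<le> a + N" for a b
    unfolding f_def using that by (intro Min_le) auto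
  have f_ex: "\<exists>b\<in>{a..a + N}. f a = w b" for a
  proof -
    have "f a \<in> w ` {a..a + N}" unfolding f_def by (intro Min_in) auto
    then show ?thesis by auto
  qed
  have step: "f a = min (w a) (f (Suc a))" for a
  proof (rule antisym)
    have "f a \<le> f (Suc a)"
    proof -
      obtain b where b: "b \<in> {Suc a..Suc a + N}" "f (Suc a) = w b" using f_ex by blast
      show ?thesis
      \<comment> \<open>The only index that enters with the shift repeats \<open>Suc a\<close> one
        period later, raised by \<open>D\<close>, so it is never the minimiser.\<close>
      proof (cases "b = Suc a + N")
        case True
        then have "f (Suc a) > w (Suc a)" using b per[of "Suc a"] \<open>D > 0\<close> by simp
        then show ?thesis using f_le[of a "Suc a"] \<open>N > 0\<close> by simp
      next
        case False
        then show ?thesis using b f_le[of a b] by simp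
      qed
    qed
    then show "f a \<le> min (w a) (f (Suc a))" using f_le[of a a] by simp
    obtain b where b: "b \<in> {a..a + N}" "f a = w b" using f_ex by blast
    show "min (w a) (f (Suc a)) \<le> f a"
      using b f_le[of "Suc a" b] by (cases "b = a") auto
  qed
  have good: "(\<forall>m<N. w a < w (a + Suc m)) \<longleftrightarrow> w a < f (Suc a)" for a
  proof
    assume *: "\<forall>m<N. w a < w (a + Suc m)"
    obtain b where b: "b \<in> {Suc a..Suc a + N}" "f (Suc a) = w b" using f_ex by blast
    show "w a < f (Suc a)"
    proof (cases "b = Suc a + N")
      case True
      then show ?thesis using b * \<open>N > 0\<close> per[of "Suc a"] \<open>D > 0\<close> by force
    next
      case False
      then have "b = a + Suc (b - Suc a)" "b - Suc a < N" using b by auto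
      then show ?thesis using * b by metis
    qed
  next
    assume "w a < f (Suc a)"
    then show "\<forall>m<N. w a < w (a + Suc m)"
      using f_le[of "Suc a"] by (smt (verit) add_Suc_right add_Suc le_add1 nat_add_left_cancel_le less_imp_le)
  qed
  have diff: "f (Suc a) - f a = (if \<forall>m<N. w a < w (a + Suc m) then 1 else 0)" for a
  proof -
    have "f (Suc a) \<le> w a + 1" using f_le[of "Suc a" "Suc a"] up[of a] by simp
    then show ?thesis unfolding good using step[of a] by auto
  qed
  have "(\<Sum>a<N. f (Suc a) - f a) = f N - f 0"
    by (rule sum_lessThan_telescope)
  moreover have "f N = f 0 + D"
  proof -
    have "w ` {N..N + N} = (\<lambda>x. x + D) ` w ` {0..N}"
    proof -
      have "{N..N + N} = (\<lambda>j. j + N) ` {0..N}" by (simp add: image_add_atLeastAtMost')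
      then show ?thesis by (simp add: image_image per del: image_add_atLeastAtMost')
    qed
    moreover have "Min ((\<lambda>x. x + D) ` w ` {0..N}) = Min (w ` {0..N}) + D"
      by (rule mono_Min_commute[symmetric]) (auto simp: mono_def)
    ultimately show ?thesis unfolding f_def by simp
  qed
  moreover have "(\<Sum>a<N. f (Suc a) - f a) = int (card {a \<in> {..<N}. \<forall>m<N. w a < w (a + Suc m)})"
    unfolding diff by (simp add: sum.If_cases Int_def)
  ultimately show ?thesis by simp
qed

lemma sum_list_rotate: "sum_list (rotate a xs) = sum_list (xs :: nat list)"
  by (metis add.commute append_take_drop_id rotate_drop_take sum_list_append)

text \<open>Rotating along a period, the future minimum of the walk with increments \<open>1 - x\<close> rises by the
  total drift, and by exactly one at each rotation without records.\<close>

lemma cycle_lemma_rev: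
  "card {a \<in> {..<length xs}. records 0 (rev (rotate a xs)) = 0} = length xs - sum_list xs"
proof (cases "sum_list xs < length xs")
  case False
  \<comment> \<open>A word without records is the code of a forest whose width is the drift. For
    drift at most 0 the forest would be empty, so no rotation qualifies, in accordance with the
    truncated subtraction.\<close>
  have "records 0 (rev (rotate a xs)) \<noteq> 0" if "a < length xs" for a
  proof
    assume *: "records 0 (rev (rotate a xs)) = 0"
    then obtain f where f: "code f = rev (rotate a xs)" "width f = deficit 0 (rev (rotate a xs))"
      using ex_code by blast
    have "sum_list (rev (rotate a xs)) = sum_list xs"
      by (simp add: sum_list_rotate sum_list_rev)
    with deficit_records_0[OF *] False have "deficit 0 (rev (rotate a xs)) = 0" by simp
    with f have "code f = []" by (cases f) auto
    with f that show False by simp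
  qed
  then show ?thesis using False by auto
next
  case True
  define N where "N = length xs"
  have N: "N > 0" using True unfolding N_def by (cases xs) auto
  \<comment> \<open>Periodic extension of the increments: all rotations become windows of one walk
    \<open>w\<close>.\<close>
  define v where "v i = 1 - int (xs ! (i mod N))" for i
  define w where "w j = (\<Sum>i<j. v i)" for j
  have shift: "(\<Sum>i<m. v (a + i)) = w (a + m) - w a" for a m
    unfolding w_def by (induction m) auto
  have wN: "w N = int N - int (sum_list xs)"
  proof -
    have "w N = (\<Sum>i<N. 1 - int (xs ! i))" unfolding w_def v_def by (intro sum.cong) auto
    also have "\<dots> = int N - int (\<Sum>i<N. xs ! i)" by (simp add: sum_subtractf)
    finally show ?thesis by (simp add: sum_list_sum_nth N_def atLeast0LessThan)
  qed
  have per: "w (j + N) = w j + (int N - int (sum_list xs))" for j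
  proof -
    have "(\<Sum>i<j. v (N + i)) = w j" unfolding w_def v_def by simp
    then show ?thesis using shift[where a = N and m = j] wN by (simp add: add.commute)
  qed
  have "records 0 (rev (rotate a xs)) = 0 \<longleftrightarrow> (\<forall>m<N. w a < w (a + Suc m))" if a: "a < N" for a
  proof -
    have nth: "rotate a xs ! i = xs ! ((a + i) mod N)" if "i < N" for i
      using that unfolding N_def by (simp add: nth_rotate)
    have "(\<Sum>i<m. 1 - int (rotate a xs ! i)) + int 0 \<ge> int (rotate a xs ! m) \<longleftrightarrow>
       w a < w (a + Suc m)" if "m < N" for m
    proof -
      have "(\<Sum>i<m. 1 - int (rotate a xs ! i)) = (\<Sum>i<m. v (a + i))"
        unfolding v_def using that by (intro sum.cong) (auto simp: nth)
      moreover have "w (a + Suc m) = w (a + m) + 1 - int (rotate a xs ! m)"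
        unfolding w_def using that by (simp add: nth v_def)
      ultimately show ?thesis using shift[of a m] by auto
    qed
    then show ?thesis unfolding records_rev_forward by (simp add: N_def)
  qed
  then have "{a \<in> {..<length xs}. records 0 (rev (rotate a xs)) = 0} =
      {a \<in> {..<N}. \<forall>m<N. w a < w (a + Suc m)}" by (auto simp: N_def)
  moreover have "int (card {a \<in> {..<N}. \<forall>m<N. w a < w (a + Suc m)}) = int N - int (sum_list xs)"
    by (rule future_minimum_count[where w = w, OF per]) (use True in \<open>auto simp: N_def w_def v_def\<close>)
  ultimately show ?thesis using True N_def by simp
qed

subsection \<open>Trees of Ulam--Harris words\<close>

primrec labelled :: "nat list \<Rightarrow> nat \<Rightarrow> forest \<Rightarrow> (nat list \<times> nat) list" where
  "labelled p i Void = []"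
| "labelled p i (Tree c r) = (p @ [i], width c) # labelled (p @ [i]) 0 c @ labelled p (Suc i) r"

text \<open>The forest hangs below an added root, so a forest of size \<open>n\<close> stands for a
  tree with \<open>n + 1\<close> vertices.\<close>

definition tree_labels :: "forest \<Rightarrow> (nat list \<times> nat) list" where
  "tree_labels f = ([], width f) # labelled [] 0 f"

definition tree_words :: "forest \<Rightarrow> nat list set" where
  "tree_words f = fst ` set (tree_labels f)"

lemma map_snd_labelled: "map snd (labelled p i f) = code f"
  by (induction f arbitrary: p i) auto

lemma map_length_labelled:
  "map (\<lambda>x. length (fst x)) (labelled p i f) = map (\<lambda>h. Suc (length p) + h) (heights f)"
  by (induction f arbitrary: p i) auto

lemma labelled_words: "x \<in> set (labelled p i f) \<Longrightarrow> \<exists>j\<ge>i. \<exists>v. j < i + width f \<and> fst x = p @ j # v"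
proof (induction f arbitrary: p i)
  case (Tree c r)
  from Tree.prems consider "x = (p @ [i], width c)" | "x \<in> set (labelled (p @ [i]) 0 c)"
    | "x \<in> set (labelled p (Suc i) r)" by auto
  then show ?case
  proof cases
    case 1
    then show ?thesis by (intro exI[of _ i]) auto
  next
    case 2
    then show ?thesis using Tree.IH(1)[OF 2] by (intro exI[of _ i]) auto
  next
    case 3
    then obtain j v where "j \<ge> Suc i" "j < Suc i + width r" "fst x = p @ j # v"
      using Tree.IH(2)[OF 3] by blast
    then show ?thesis by (intro exI[of _ j]) auto
  qed
qed simp

lemma append_less_append_iff: "(p @ x < p @ y) \<longleftrightarrow> (x < (y :: nat list))"
  by (induction p) auto

text \<open>Preorder is lexicographic order: a prefix precedes its extensions, and words through
  child \<open>i\<close> precede those through later children. Hence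
  \<open>sorted_list_of_set\<close> recovers the traversal.\<close>

lemma sorted_labelled: "sorted_wrt (<) (map fst (labelled p i f))"
proof (induction f arbitrary: p i)
  case (Tree c r)
  have 1: "p @ [i] < w" if "w \<in> fst ` set (labelled (p @ [i]) 0 c)" for w
  proof -
    from that obtain j v where "w = (p @ [i]) @ j # v" using labelled_words by blast
    then show ?thesis by (simp add: append_less_append_iff)
  qed
  have 2: "w < w'" if "w = p @ [i] \<or> w \<in> fst ` set (labelled (p @ [i]) 0 c)"
    "w' \<in> fst ` set (labelled p (Suc i) r)" for w w'
  proof -
    have "\<exists>v. w = p @ i # v" using that(1) labelled_words[of _ "p @ [i]" 0 c] by fastforce
    moreover have "\<exists>j v. j > i \<and> w' = p @ j # v"
      using that(2) labelled_words[of _ p "Suc i" r] by (fastforce simp: Suc_le_eq)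
    ultimately show ?thesis by (auto simp: append_less_append_iff)
  qed
  have "p @ [i] < w'" if "w' \<in> fst ` set (labelled p (Suc i) r)" for w'
    using 2[of "p @ [i]" w'] that by simp
  moreover have "w < w'" if "w \<in> fst ` set (labelled (p @ [i]) 0 c)"
    "w' \<in> fst ` set (labelled p (Suc i) r)" for w w'
    using 2[of w w'] that by simp
  ultimately show ?case using Tree.IH 1 by (simp add: sorted_wrt_append ball_Un)
qed simp

lemma sorted_tree_labels: "sorted_wrt (<) (map fst (tree_labels f))"
proof -
  have "[] < w" if "w \<in> fst ` set (labelled [] 0 f)" for w
  proof -
    from that obtain j v where "w = [] @ j # v" using labelled_words by blast
    then show ?thesis by simp
  qed
  then show ?thesis unfolding tree_labels_def using sorted_labelled by auto
qed

lemma sorted_list_tree_words: "sorted_list_of_set (tree_words f) = map fst (tree_labels f)"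
proof -
  have "sorted_list_of_set (set (map fst (tree_labels f))) = map fst (tree_labels f)"
    using sorted_tree_labels[of f]
    by (intro sorted_list_of_set.idem_if_sorted_distinct) (auto simp: strict_sorted_iff)
  then show ?thesis by (simp add: tree_words_def)
qed

lemma finite_tree_words [simp]: "finite (tree_words f)"
  by (simp add: tree_words_def)

lemma length_tree_labels [simp]: "length (tree_labels f) = Suc (size f)"
  using arg_cong[OF map_snd_labelled[of "[]" 0 f], of length] by (simp add: tree_labels_def)

lemma card_tree_words [simp]: "card (tree_words f) = Suc (size f)"
proof -
  have "card (tree_words f) = length (sorted_list_of_set (tree_words f))" by simp
  then show ?thesis unfolding sorted_list_tree_words by simp
qed

lemma length_dfs_vertex:
  assumes "j \<le> size f"
  shows "length (dfs_vertex (tree_words f) j) = heights (Tree f Void) ! j"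
proof -
  have "map (\<lambda>x. length (fst x)) (tree_labels f) = heights (Tree f Void)"
    by (simp add: tree_labels_def map_length_labelled cong: map_cong)
  then have "map (\<lambda>x. length (fst x)) (tree_labels f) ! j = heights (Tree f Void) ! j" by simp
  then show ?thesis using assms by (simp add: dfs_vertex_def sorted_list_tree_words)
qed

section \<open>Offspring functions that realise a given tree\<close>

text \<open>Finitely many coordinates are prescribed, so the event has a product probability. Leaves
  are included with offspring number 0, and therefore the plane tree of \<open>k\<close> has no
  further vertices.\<close>

definition matches :: "(nat list \<Rightarrow> nat) \<Rightarrow> forest \<Rightarrow> bool" where
  "matches k f \<longleftrightarrow> (\<forall>x \<in> set (tree_labels f). k (fst x) = snd x)"

lemma labelled_first_generation: "j < width f \<Longrightarrow> p @ [i + j] \<in> fst ` set (labelled p i f)"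
proof (induction f arbitrary: p i j)
  case (Tree c r)
  then show ?case using Tree.IH(2)[of "j - 1" p "Suc i"] by (cases j) auto
qed simp

lemma labelled_children:
  "(w, d) \<in> set (labelled p i f) \<Longrightarrow> j < d \<Longrightarrow> w @ [j] \<in> fst ` set (labelled p i f)"
proof (induction f arbitrary: p i)
  case (Tree c r)
  then show ?case using labelled_first_generation[of j c "p @ [i]" 0] by (auto simp: image_Un)
qed simp

lemma labelled_in_plane_tree:
  assumes "\<forall>x \<in> set (labelled p i f). k (fst x) = snd x" "\<And>j. j < i + width f \<Longrightarrow> p @ [j] \<in> plane_tree k"
  shows "fst ` set (labelled p i f) \<subseteq> plane_tree k"
  using assms
proof (induction f arbitrary: p i)
  case (Tree c r)
  have pi: "p @ [i] \<in> plane_tree k" using Tree.prems by simp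
  have "k (p @ [i]) = width c" using Tree.prems by simp
  then have "fst ` set (labelled (p @ [i]) 0 c) \<subseteq> plane_tree k"
    using Tree.prems pi by (intro Tree.IH(1)) (auto intro: plane_tree.child[of "p @ [i]", simplified])
  moreover have "fst ` set (labelled p (Suc i) r) \<subseteq> plane_tree k"
    using Tree.prems by (intro Tree.IH(2)) auto
  ultimately show ?case using pi by auto
qed simp

lemma plane_tree_matches:
  assumes "matches k f"
  shows "plane_tree k = tree_words f"
proof
  have k0: "k [] = width f" using assms by (simp add: matches_def tree_labels_def)
  have "fst ` set (labelled [] 0 f) \<subseteq> plane_tree k"
    using assms by (intro labelled_in_plane_tree)
      (auto simp: matches_def tree_labels_def k0 intro: plane_tree.child[of "[]", simplified] plane_tree.root)
  then show "tree_words f \<subseteq> plane_tree k"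
    by (auto simp: tree_words_def tree_labels_def plane_tree.root)
  show "plane_tree k \<subseteq> tree_words f"
  proof
    fix u assume "u \<in> plane_tree k"
    then show "u \<in> tree_words f"
    proof induction
      case root
      then show ?case by (simp add: tree_words_def tree_labels_def)
    next
      case (child u i)
      from child.IH obtain d where d: "(u, d) \<in> set (tree_labels f)" by (auto simp: tree_words_def)
      then have "i < d" using child.hyps assms by (force simp: matches_def)
      with d show ?case
        using labelled_first_generation[of i f "[]" 0] labelled_children[of u d "[]" 0 f i]
        by (auto simp: tree_words_def tree_labels_def)
    qed
  qed
qed

text \<open>The plane tree of \<open>k\<close> and the values of \<open>k\<close> along it spell out
  the code. This makes the events of different forests disjoint.\<close>

lemma matches_unique:
  assumes "matches k f" "matches k g"
  shows "f = g"
proof (rule code_inject)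
  have *: "map k (sorted_list_of_set (plane_tree k)) = width h # code h" if "matches k h" for h
  proof -
    have "map k (map fst (tree_labels h)) = map snd (tree_labels h)"
      using that by (auto simp: matches_def)
    also have "map snd (tree_labels h) = width h # code h"
      by (simp add: tree_labels_def map_snd_labelled)
    finally show ?thesis
      by (simp only: plane_tree_matches[OF that] sorted_list_tree_words)
  qed
  show "code f = code g" "width f = width g"
    using *[OF assms(1)] *[OF assms(2)] by auto
qed

text \<open>The height bound \<open>h\<close> ensures termination, since \<open>k\<close> may
  describe an infinite tree. The second equation is a dummy: in \<open>labelled_grow\<close> it is
  reached only under contradictory hypotheses.\<close>

fun grow :: "(nat list \<Rightarrow> nat) \<Rightarrow> nat \<Rightarrow> nat list \<Rightarrow> nat \<Rightarrow> nat \<Rightarrow> forest" where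
  "grow k h p i 0 = Void"
| "grow k 0 p i (Suc m) = Tree Void (grow k 0 p (Suc i) m)"
| "grow k (Suc h) p i (Suc m) =
     Tree (grow k h (p @ [i]) 0 (k (p @ [i]))) (grow k (Suc h) p (Suc i) m)"

lemma width_grow [simp]: "width (grow k h p i m) = m"
  by (induction k h p i m rule: grow.induct) auto

lemma labelled_grow:
  assumes "\<And>u. u \<in> plane_tree k \<Longrightarrow> length u \<le> length p + h"
    and "\<And>j. j < i + m \<Longrightarrow> p @ [j] \<in> plane_tree k"
  shows "\<forall>x \<in> set (labelled p i (grow k h p i m)). k (fst x) = snd x"
  using assms
proof (induction k h p i m rule: grow.induct)
  case (2 k p i m)
  then show ?case using 2(2)[of "p @ [i]"] 2(3)[of i] by simp
next
  case (3 k h p i m)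
  have "p @ [i] \<in> plane_tree k" using 3(4)[of i] by simp
  then have "\<forall>x \<in> set (labelled (p @ [i]) 0 (grow k h (p @ [i]) 0 (k (p @ [i])))). k (fst x) = snd x"
    using 3(3) by (intro 3(1)) (auto intro: plane_tree.child[of "p @ [i]", simplified])
  moreover have "\<forall>x \<in> set (labelled p (Suc i) (grow k (Suc h) p (Suc i) m)). k (fst x) = snd x"
    using 3(3,4) by (intro 3(2)) auto
  ultimately show ?case by auto
qed simp

lemma ex_matches:
  assumes "finite (plane_tree k)"
  shows "\<exists>f. matches k f"
proof -
  obtain h where h: "\<And>u. u \<in> plane_tree k \<Longrightarrow> length u \<le> h"
    using finite_imageI[OF assms, of length] finite_nat_set_iff_bounded_le by auto
  have "\<forall>x \<in> set (labelled [] 0 (grow k h [] 0 (k []))). k (fst x) = snd x"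
    using h plane_tree.child[of "[]" k] plane_tree.root by (intro labelled_grow) auto
  then have "matches k (grow k h [] 0 (k []))" by (simp add: matches_def tree_labels_def)
  then show ?thesis ..
qed

lemma card_plane_tree:
  "card (plane_tree k) = n + 1 \<longleftrightarrow> (\<exists>f. size f = n \<and> matches k f)"
proof
  assume *: "card (plane_tree k) = n + 1"
  then have "finite (plane_tree k)" by (intro card_ge_0_finite) simp
  then obtain f where f: "matches k f" using ex_matches by blast
  with * have "size f = n" by (simp add: plane_tree_matches)
  with f show "\<exists>f. size f = n \<and> matches k f" by blast
qed (auto simp: plane_tree_matches)

lemma finite_forests: "finite {f :: forest. size f = n}"
proof (induction n rule: less_induct)
  case (less n)
  have "{f :: forest. size f = n} \<subseteq>
    insert Void (\<Union>i<n. \<Union>j<n. (\<lambda>(c, r). Tree c r) ` ({c. size c = i} \<times> {r. size r = j}))"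
  proof
    fix f :: forest assume "f \<in> {f. size f = n}"
    then show "f \<in> insert Void (\<Union>i<n. \<Union>j<n. (\<lambda>(c, r). Tree c r) ` ({c. size c = i} \<times> {r. size r = j}))"
      by (cases f) (auto simp: image_iff)
  qed
  then show ?case by (rule finite_subset) (auto intro!: less)
qed

text \<open>The event fixes the coordinates at pairwise distinct words, which are
  independent.\<close>

lemma prob_matches:
  "{k \<in> space (offspring_measure \<mu>). matches k f} \<in> sets (offspring_measure \<mu>)"
  "measure (offspring_measure \<mu>) {k \<in> space (offspring_measure \<mu>). matches k f} =
     prod_list (map (pmf \<mu>) (width f # code f))"
proof -
  let ?M = "\<lambda>_ :: nat list. measure_pmf \<mu>"
  interpret product_prob_space ?M UNIV ..
  define lab where "lab w = (THE d. (w, d) \<in> set (tree_labels f))" for w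
  have dist: "distinct (map fst (tree_labels f))"
    using sorted_tree_labels[of f] by (auto simp: strict_sorted_iff)
  have lab: "lab (fst x) = snd x" if "x \<in> set (tree_labels f)" for x
    unfolding lab_def using that dist by (intro the_equality) (auto simp: eq_key_imp_eq_value)
  have eq: "{k \<in> space (offspring_measure \<mu>). matches k f} =
      {k \<in> space (PiM UNIV ?M). \<forall>w \<in> tree_words f. k w \<in> {lab w}}"
    by (auto simp: offspring_measure_def matches_def tree_words_def lab)
  show "{k \<in> space (offspring_measure \<mu>). matches k f} \<in> sets (offspring_measure \<mu>)"
    unfolding eq unfolding offspring_measure_def
    by (intro sets.sets_Collect_finite_All sets_Collect_single') auto
  have "emeasure (PiM UNIV ?M) {k \<in> space (PiM UNIV ?M). \<forall>w \<in> tree_words f. k w \<in> {lab w}} =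
     (\<Prod>w\<in>tree_words f. emeasure (measure_pmf \<mu>) {lab w})"
    by (rule emeasure_PiM_Collect) auto
  also have "\<dots> = ennreal (\<Prod>w\<in>tree_words f. pmf \<mu> (lab w))"
    by (simp add: emeasure_pmf_single prod_ennreal)
  finally have "measure (offspring_measure \<mu>) {k \<in> space (offspring_measure \<mu>). matches k f} =
     (\<Prod>w\<in>tree_words f. pmf \<mu> (lab w))"
    unfolding eq unfolding offspring_measure_def by (simp add: measure_def prod_nonneg)
  also have "\<dots> = prod_list (map (\<lambda>w. pmf \<mu> (lab w)) (map fst (tree_labels f)))"
    using dist by (simp add: tree_words_def prod.distinct_set_conv_list[of "map fst (tree_labels f)"]
        flip: set_map)
  also have "map (\<lambda>w. pmf \<mu> (lab w)) (map fst (tree_labels f)) = map (pmf \<mu>) (map snd (tree_labels f))"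
    by (auto simp: lab)
  also have "map snd (tree_labels f) = width f # code f"
    by (simp add: tree_labels_def map_snd_labelled)
  finally show "measure (offspring_measure \<mu>) {k \<in> space (offspring_measure \<mu>). matches k f} =
     prod_list (map (pmf \<mu>) (width f # code f))" .
qed

lemma prob_plane_tree:
  "measure (offspring_measure \<mu>)
     {k \<in> space (offspring_measure \<mu>). Q (plane_tree k) \<and> card (plane_tree k) = n + 1} =
   (\<Sum>f | size f = n \<and> Q (tree_words f). prod_list (map (pmf \<mu>) (width f # code f)))"
proof -
  interpret prob_space "offspring_measure \<mu>"
    unfolding offspring_measure_def by (intro prob_space_PiM measure_pmf.prob_space_axioms)
  define E where "E f = {k \<in> space (offspring_measure \<mu>). matches k f}" for f
  define F where "F = {f. size f = n \<and> Q (tree_words f)}"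
  have "finite F" unfolding F_def by (rule finite_subset[OF _ finite_forests[of n]]) auto
  have "{k \<in> space (offspring_measure \<mu>). Q (plane_tree k) \<and> card (plane_tree k) = n + 1} =
    (\<Union>f\<in>F. E f)"
    unfolding card_plane_tree by (auto simp: E_def F_def plane_tree_matches)
  moreover have "measure (offspring_measure \<mu>) (\<Union>f\<in>F. E f) = (\<Sum>f\<in>F. measure (offspring_measure \<mu>) (E f))"
    using \<open>finite F\<close> by (intro finite_measure_finite_Union)
      (auto simp: E_def disjoint_family_on_def prob_matches dest: matches_unique)
  ultimately show ?thesis by (simp add: E_def F_def prob_matches)
qed

section \<open>Trees as i.i.d. words\<close>

lemma pmf_replicate_pmf:
  "pmf (replicate_pmf n p) xs = (if length xs = n then prod_list (map (pmf p) xs) else 0)"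
proof (induction n arbitrary: xs)
  case 0
  then show ?case by (auto simp: pmf_return)
next
  case (Suc n)
  show ?case
  proof (cases xs)
    case Nil
    then show ?thesis by (auto simp: pmf_eq_0_set_pmf)
  next
    case (Cons y ys)
    have "replicate_pmf (Suc n) p = map_pmf (\<lambda>(x, xs). x # xs) (pair_pmf p (replicate_pmf n p))"
      by (simp add: map_pmf_def pair_pmf_def bind_assoc_pmf bind_return_pmf)
    moreover have "pmf (map_pmf (\<lambda>(x, xs). x # xs) (pair_pmf p (replicate_pmf n p)))
       ((\<lambda>(x, xs). x # xs) (y, ys)) = pmf (pair_pmf p (replicate_pmf n p)) (y, ys)"
      by (rule pmf_map_inj') (auto simp: inj_def)
    ultimately show ?thesis using Cons Suc[of ys] by (simp add: pmf_pair)
  qed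
qed

text \<open>The sum is the one in \<open>prob_plane_tree\<close>, so conditioned trees may be
  replaced by i.i.d. words of length \<open>n + 1\<close>.\<close>

lemma prob_code:
  "measure_pmf.prob (replicate_pmf (n + 1) \<mu>) {xs. \<exists>f. size f = n \<and> xs = code (Tree f Void) \<and> R f} =
   (\<Sum>f | size f = n \<and> R f. prod_list (map (pmf \<mu>) (width f # code f)))"
proof -
  let ?F = "{f. size f = n \<and> R f}"
  have "{xs. \<exists>f. size f = n \<and> xs = code (Tree f Void) \<and> R f} =
    (\<lambda>f. code (Tree f Void)) ` ?F" by auto
  moreover have "finite ?F" by (rule finite_subset[OF _ finite_forests[of n]]) auto
  moreover have "inj_on (\<lambda>f. code (Tree f Void)) ?F"
    by (auto simp: inj_on_def intro: code_inject)
  ultimately show ?thesis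
    by (simp add: measure_measure_pmf_finite sum.reindex pmf_replicate_pmf del: replicate_pmf.simps)
qed

text \<open>Mirroring is an involution that permutes the letters of the code and so preserves
  weights.\<close>

lemma prob_code_mirror:
  "measure_pmf.prob (replicate_pmf (n + 1) \<mu>) {xs. \<exists>f. size f = n \<and> xs = code (Tree f Void) \<and> R (mirror f)} =
   measure_pmf.prob (replicate_pmf (n + 1) \<mu>) {xs. \<exists>f. size f = n \<and> xs = code (Tree f Void) \<and> R f}"
  unfolding prob_code
proof (rule sum.reindex_bij_witness[where i = mirror and j = mirror])
  fix f
  have "mset (map (pmf \<mu>) (width f # code f)) = mset (map (pmf \<mu>) (width (mirror f) # code (mirror f)))"
    by (simp add: mset_code_mirror)
  then show "prod_list (map (pmf \<mu>) (width (mirror f) # code (mirror f))) =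
      prod_list (map (pmf \<mu>) (width f # code f))"
    by (metis prod_mset_prod_list)
qed auto

lemma excursion_eq_code:
  "measure_pmf.prob (replicate_pmf (n + 1) \<mu>) {xs. records 0 xs = 0 \<and> deficit 0 xs = 1 \<and> R xs} =
   measure_pmf.prob (replicate_pmf (n + 1) \<mu>)
       {xs. \<exists>f. size f = n \<and> xs = code (Tree f Void) \<and> R (code (Tree f Void))}"
proof (rule measure_pmf.finite_measure_eq_AE)
  have "(\<exists>f. size f = n \<and> xs = code (Tree f Void) \<and> R (code (Tree f Void))) \<longleftrightarrow>
      records 0 xs = 0 \<and> deficit 0 xs = 1 \<and> R xs" if "length xs = n + 1" for xs
  proof
    assume "\<exists>f. size f = n \<and> xs = code (Tree f Void) \<and> R (code (Tree f Void))"
    then obtain f where "xs = code (Tree f Void)" "R xs" by blast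
    then show "records 0 xs = 0 \<and> deficit 0 xs = 1 \<and> R xs"
      by (simp only: records_code deficit_code) simp
  next
    assume *: "records 0 xs = 0 \<and> deficit 0 xs = 1 \<and> R xs"
    then obtain g where g: "code g = xs" "width g = 1" using ex_code[of xs] by auto
    then obtain f r where "g = Tree f r" "width r = 0" by (cases g) auto
    then have "g = Tree f Void" by (cases r) auto
    with g that length_code[of g] * have "size f = n \<and> xs = code (Tree f Void) \<and> R (code (Tree f Void))" by simp
    then show "\<exists>f. size f = n \<and> xs = code (Tree f Void) \<and> R (code (Tree f Void))" by blast
  qed
  then show "AE xs in measure_pmf (replicate_pmf (n + 1) \<mu>).
    (xs \<in> {xs. records 0 xs = 0 \<and> deficit 0 xs = 1 \<and> R xs}) =
    (xs \<in> {xs. \<exists>f. size f = n \<and> xs = code (Tree f Void) \<and> R (code (Tree f Void))})"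
    by (auto simp: AE_measure_pmf_iff set_replicate_pmf simp del: replicate_pmf.simps code.simps)
qed auto

text \<open>Deleting the root identifies trees with \<open>n + 1\<close> vertices and forests with \<open>n\<close> vertices.\<close>

lemma conditioned_BGW_prob_words:
  "conditioned_BGW_prob \<mu> n Q =
     measure_pmf.prob (replicate_pmf (n + 1) \<mu>)
       {xs. \<exists>f. size f = n \<and> xs = code (Tree f Void) \<and> Q (tree_words f)} /
     measure_pmf.prob (replicate_pmf (n + 1) \<mu>) {xs. records 0 xs = 0 \<and> deficit 0 xs = 1}"
proof -
  have *: "measure (offspring_measure \<mu>)
     {k \<in> space (offspring_measure \<mu>). R (plane_tree k) \<and> card (plane_tree k) = n + 1} =
    measure_pmf.prob (replicate_pmf (n + 1) \<mu>)
       {xs. \<exists>f. size f = n \<and> xs = code (Tree f Void) \<and> R (tree_words f)}" for R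
    unfolding prob_plane_tree prob_code ..
  show ?thesis
    using *[of Q] *[of "\<lambda>_. True"] excursion_eq_code[of n \<mu> "\<lambda>_. True"]
    by (simp add: conditioned_BGW_prob_def cond_prob_def del: replicate_pmf.simps code.simps)
qed

subsection \<open>Records of random words\<close>

lemma measure_bind_pmf:
  "measure_pmf.prob (bind_pmf p f) A = measure_pmf.expectation p (\<lambda>x. measure_pmf.prob (f x) A)"
proof -
  have "ennreal (measure_pmf.prob (bind_pmf p f) A) = (\<integral>\<^sup>+x. ennreal (measure_pmf.prob (f x) A) \<partial>measure_pmf p)"
    by (simp flip: measure_pmf.emeasure_eq_measure)
  also have "\<dots> = ennreal (measure_pmf.expectation p (\<lambda>x. measure_pmf.prob (f x) A))"
    by (intro nn_integral_eq_integral measure_pmf.integrable_const_bound[where B = 1]) auto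
  finally show ?thesis by (simp add: integral_nonneg_AE)
qed

text \<open>Exchangeability: the weight of a word depends only on its multiset of letters.\<close>

lemma map_replicate_pmf_permute:
  assumes "inj h" "surj h" "\<And>xs. mset (h xs) = mset xs"
  shows "map_pmf h (replicate_pmf n p) = replicate_pmf n p"
proof (rule pmf_eqI)
  fix ys
  obtain xs where ys: "ys = h xs" using assms(2) by (metis surjD)
  have "length (h xs) = length xs" using assms(3) by (metis size_mset)
  moreover have "prod_list (map (pmf p) (h xs)) = prod_list (map (pmf p) xs)"
    using assms(3) by (metis mset_map prod_mset_prod_list)
  ultimately show "pmf (map_pmf h (replicate_pmf n p)) ys = pmf (replicate_pmf n p) ys"
    unfolding ys by (simp add: pmf_map_inj'[OF assms(1)] pmf_replicate_pmf)
qed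

lemma map_rev_replicate_pmf: "map_pmf rev (replicate_pmf n p) = replicate_pmf n p"
  by (rule map_replicate_pmf_permute) (auto intro!: surjI[of rev rev] injI)

lemma map_rotate_replicate_pmf: "map_pmf (rotate a) (replicate_pmf n p) = replicate_pmf n p"
proof (induction a)
  case (Suc a)
  have *: "map_pmf rotate1 (replicate_pmf n p) = replicate_pmf n p"
  proof (rule map_replicate_pmf_permute)
    show "mset (rotate1 xs) = mset xs" for xs :: "'a list" by (cases xs) auto
  qed (rule inj_rotate1 surj_rotate1)+
  have "map_pmf (rotate (Suc a)) (replicate_pmf n p) = map_pmf rotate1 (map_pmf (rotate a) (replicate_pmf n p))"
    by (simp add: pmf.map_comp rotate_def del: map_pmf_comp)
  then show ?case by (simp only: * Suc)
qed (simp add: rotate_def id_def[symmetric] pmf.map_id)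

lemma prob_rev_replicate_pmf:
  "measure_pmf.prob (replicate_pmf n p) {xs. Q (rev xs)} = measure_pmf.prob (replicate_pmf n p) {xs. Q xs}"
  by (subst (2) map_rev_replicate_pmf[symmetric]) (simp add: vimage_def)

lemma prob_rotate_replicate_pmf:
  "measure_pmf.prob (replicate_pmf n p) {xs. Q (rotate a xs)} = measure_pmf.prob (replicate_pmf n p) {xs. Q xs}"
  by (subst (2) map_rotate_replicate_pmf[symmetric, of n p a]) (simp add: vimage_def)

lemma AE_replicate_pmf: "AE xs in measure_pmf (replicate_pmf n p). length xs = n"
  by (simp add: AE_measure_pmf_iff set_replicate_pmf)

text \<open>All rotations have the same law, so the left side is the mean number of rotations
  without records on \<open>A\<close>, which the cycle lemma counts. The truncated
  \<open>n - sum_list xs\<close> is the negative part of the walk.\<close>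

lemma prob_cycle:
  assumes A: "\<And>a xs. A (rotate a xs) \<longleftrightarrow> A xs"
  shows "real n * measure_pmf.prob (replicate_pmf n \<mu>) {xs. records 0 (rev xs) = 0 \<and> A xs} =
    measure_pmf.expectation (replicate_pmf n \<mu>) (\<lambda>xs. real (n - sum_list xs) * indicator {xs. A xs} xs)"
proof -
  let ?W = "replicate_pmf n \<mu>"
  have "real n * measure_pmf.prob ?W {xs. records 0 (rev xs) = 0 \<and> A xs} =
     (\<Sum>a<n. measure_pmf.prob ?W {xs. records 0 (rev (rotate a xs)) = 0 \<and> A (rotate a xs)})"
    by (subst prob_rotate_replicate_pmf[where Q = "\<lambda>xs. records 0 (rev xs) = 0 \<and> A xs"]) simp
  also have "\<dots> = (\<Sum>a<n. measure_pmf.expectation ?W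
      (indicator {xs. records 0 (rev (rotate a xs)) = 0 \<and> A (rotate a xs)}))"
    by simp
  also have "\<dots> = measure_pmf.expectation ?W (\<lambda>xs. \<Sum>a<n.
      indicator {xs. records 0 (rev (rotate a xs)) = 0 \<and> A (rotate a xs)} xs)"
    by (intro Bochner_Integration.integral_sum[symmetric]
        measure_pmf.integrable_const_bound[where B = 1]) auto
  also have "\<dots> = measure_pmf.expectation ?W (\<lambda>xs. real (n - sum_list xs) * indicator {xs. A xs} xs)"
  proof (rule integral_cong_AE)
    show "AE xs in measure_pmf ?W. (\<Sum>a<n.
      indicator {xs. records 0 (rev (rotate a xs)) = 0 \<and> A (rotate a xs)} xs) =
      real (n - sum_list xs) * indicator {xs. A xs} xs"
      using AE_replicate_pmf
    proof eventually_elim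
      case (elim xs)
      have "(\<Sum>a<n. indicator {xs. records 0 (rev (rotate a xs)) = 0 \<and> A (rotate a xs)} xs :: real) =
        (\<Sum>a<n. if records 0 (rev (rotate a xs)) = 0 then indicator {xs. A xs} xs else 0)"
        by (intro sum.cong) (auto simp: indicator_def A)
      also have "\<dots> = real (card {a \<in> {..<n}. records 0 (rev (rotate a xs)) = 0}) * indicator {xs. A xs} xs"
        by (simp add: sum.If_cases Int_def)
      finally show ?case using cycle_lemma_rev[of xs] elim by simp
    qed
  qed auto
  finally show ?thesis .
qed

lemma prob_records_eq_0:
  "real n * measure_pmf.prob (replicate_pmf n \<mu>) {xs. records 0 xs = 0} =
    measure_pmf.expectation (replicate_pmf n \<mu>) (\<lambda>xs. real (n - sum_list xs))"
  using prob_cycle[of "\<lambda>_. True" n \<mu>] by (simp add: prob_rev_replicate_pmf[where Q = "\<lambda>xs. records 0 xs = 0"])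

section \<open>The tail of the number of records\<close>

text \<open>The word is reversed because \<open>replicate_pmf\<close> unfolds at the first letter,
  whereas \<open>records\<close> processes the last letter first.\<close>

definition record_prob :: "nat pmf \<Rightarrow> nat \<Rightarrow> nat \<Rightarrow> nat \<Rightarrow> real" where
  "record_prob \<mu> n e r = measure_pmf.prob (replicate_pmf n \<mu>) {xs. r \<le> records e (rev xs)}"

lemma record_prob_Suc:
  "record_prob \<mu> (Suc n) e (Suc r) =
     measure_pmf.expectation \<mu> (\<lambda>x. if e < x then record_prob \<mu> n 0 r else record_prob \<mu> n (e + 1 - x) (Suc r))"
proof -
  have "replicate_pmf (Suc n) \<mu> = bind_pmf \<mu> (\<lambda>x. map_pmf ((#) x) (replicate_pmf n \<mu>))"
    by (simp add: map_pmf_def)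
  then have "record_prob \<mu> (Suc n) e (Suc r) = measure_pmf.expectation \<mu> (\<lambda>x.
      measure_pmf.prob (replicate_pmf n \<mu>) {xs. Suc r \<le> records e (rev (x # xs))})"
    by (simp add: record_prob_def measure_bind_pmf vimage_def del: replicate_pmf.simps)
  also have "\<dots> = measure_pmf.expectation \<mu> (\<lambda>x. if e < x then record_prob \<mu> n 0 r
      else record_prob \<mu> n (e + 1 - x) (Suc r))"
    by (intro Bochner_Integration.integral_cong) (auto simp: record_prob_def records_append)
  finally show ?thesis .
qed

lemma record_prob_bounds: "0 \<le> record_prob \<mu> n e r" "record_prob \<mu> n e r \<le> 1"
  by (auto simp: record_prob_def)

lemma record_prob_0 [simp]: "record_prob \<mu> n e 0 = 1"
  by (simp add: record_prob_def)

lemma record_prob_mono_length: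
  "record_prob \<mu> n e r \<le> record_prob \<mu> (Suc n) e r"
proof -
  have "replicate_pmf (n + 1) \<mu> = bind_pmf (replicate_pmf n \<mu>) (\<lambda>xs. map_pmf (\<lambda>x. xs @ [x]) \<mu>)"
    unfolding replicate_pmf_distrib by (simp add: map_pmf_def bind_return_pmf bind_assoc_pmf)
  then have "record_prob \<mu> (Suc n) e r = measure_pmf.expectation (replicate_pmf n \<mu>) (\<lambda>xs.
      measure_pmf.prob \<mu> {x. r \<le> records e (rev (xs @ [x]))})"
    by (simp add: record_prob_def measure_bind_pmf vimage_def del: replicate_pmf.simps)
  also have "\<dots> \<ge> measure_pmf.expectation (replicate_pmf n \<mu>) (indicator {xs. r \<le> records e (rev xs)})"
  proof (intro integral_mono measure_pmf.integrable_const_bound[where B = 1] AE_I2)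
    fix xs
    show "indicator {xs. r \<le> records e (rev xs)} xs \<le> measure_pmf.prob \<mu> {x. r \<le> records e (rev (xs @ [x]))}"
    proof (cases "r \<le> records e (rev xs)")
      case True
      then have "{x. r \<le> records e (rev (xs @ [x]))} = UNIV" by auto
      then show ?thesis by simp
    qed simp
  qed auto
  finally show ?thesis by (simp add: record_prob_def)
qed

text \<open>After each record the recursion restarts from deficit zero.\<close>

lemma record_prob_le:
  "record_prob \<mu> n e (Suc r) \<le> record_prob \<mu> n e 1 * record_prob \<mu> n 0 1 ^ r"
proof (induction n arbitrary: e r)
  case 0
  then show ?case by (simp add: record_prob_def)
next
  case (Suc n)
  let ?q = "\<lambda>n. record_prob \<mu> n 0 1"
  have q: "0 \<le> ?q n" using record_prob_bounds by auto
  \<comment> \<open>At deficit 0 the leading factor of the induction hypothesis is one more power of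
    \<open>?q n\<close>.\<close>
  have *: "record_prob \<mu> n 0 r \<le> ?q n ^ r"
    using Suc[of 0 "r - 1"] by (cases r) auto
  have "record_prob \<mu> (Suc n) e (Suc r) \<le> measure_pmf.expectation \<mu> (\<lambda>x.
      (if e < x then 1 else record_prob \<mu> n (e + 1 - x) 1) * ?q n ^ r)"
    unfolding record_prob_Suc using * Suc[of _ r]
  proof (intro integral_mono measure_pmf.integrable_const_bound[where B = 1] AE_I2)
    show "norm ((if e < x then 1 else record_prob \<mu> n (e + 1 - x) 1) * ?q n ^ r) \<le> 1" for x
      using record_prob_bounds[of \<mu> n] by (auto simp: abs_mult intro!: mult_le_one power_le_one)
  qed (use record_prob_bounds[of \<mu> n] in auto)
  also have "\<dots> = record_prob \<mu> (Suc n) e 1 * ?q n ^ r"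
    using record_prob_Suc[of \<mu> n e 0] by (simp cong: if_cong)
  also have "\<dots> \<le> record_prob \<mu> (Suc n) e 1 * ?q (Suc n) ^ r"
    by (intro mult_left_mono power_mono record_prob_mono_length q) (use record_prob_bounds in auto)
  finally show ?case .
qed

text \<open>The geometric tail is made exponential by \<open>1 - u \<le> exp (- u)\<close>. Negative
  \<open>x\<close> is covered too, since \<open>nat\<close> then sets the threshold to 0.\<close>

lemma prob_records_ge:
  assumes "n > 0"
  shows "measure_pmf.prob (replicate_pmf n \<mu>) {xs. x < real (records 0 xs)} \<le>
    exp (- x * (measure_pmf.expectation (replicate_pmf n \<mu>) (\<lambda>xs. real (n - sum_list xs)) / real n))"
proof -
  define u where "u = measure_pmf.expectation (replicate_pmf n \<mu>) (\<lambda>xs. real (n - sum_list xs)) / real n"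
  have u: "u = measure_pmf.prob (replicate_pmf n \<mu>) {xs. records 0 xs = 0}"
    using prob_records_eq_0[of n \<mu>] assms by (simp add: u_def field_simps)
  have q: "record_prob \<mu> n 0 1 = 1 - u"
  proof -
    have "record_prob \<mu> n 0 1 = measure_pmf.prob (replicate_pmf n \<mu>) {xs. 1 \<le> records 0 xs}"
      unfolding record_prob_def by (rule prob_rev_replicate_pmf)
    also have "{xs. 1 \<le> records 0 xs} = space (measure_pmf (replicate_pmf n \<mu>)) - {xs. records 0 xs = 0}"
      by auto
    finally show ?thesis unfolding u by (subst (asm) measure_pmf.prob_compl) auto
  qed
  have u01: "0 \<le> u" "u \<le> 1" unfolding u by auto
  define r where "r = nat \<lceil>x\<rceil>"
  have "measure_pmf.prob (replicate_pmf n \<mu>) {xs. x < real (records 0 xs)} \<le>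
      measure_pmf.prob (replicate_pmf n \<mu>) {xs. r \<le> records 0 xs}"
    by (intro measure_pmf.finite_measure_mono) (auto simp: r_def nat_le_iff ceiling_le_iff)
  also have "\<dots> = record_prob \<mu> n 0 r"
    unfolding record_prob_def by (rule prob_rev_replicate_pmf[symmetric])
  also have "\<dots> \<le> (1 - u) ^ r"
    using record_prob_le[of \<mu> n 0 "r - 1"] unfolding q by (cases r) auto
  also have "\<dots> \<le> exp (- u) ^ r"
    using u01 exp_ge_add_one_self[of "- u"] by (intro power_mono) auto
  also have "\<dots> = exp (- (real r * u))" by (simp add: exp_of_nat_mult[symmetric])
  also have "\<dots> \<le> exp (- (x * u))"
    using u01 by (auto simp: r_def intro!: mult_right_mono)
      (metis of_nat_ceiling)
  finally show ?thesis by (simp add: u_def)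
qed

section \<open>Windows of a bridge and dyadic chaining\<close>

text \<open>Rotate the window to the front and fix its letters. The other \<open>n - l\<close>
  letters must then hit one prescribed sum, which has probability at most \<open>M\<close> whatever
  the window contains.\<close>

lemma prob_window:
  fixes \<mu> :: "nat pmf"
  assumes "a + l \<le> n" and M: "\<And>z. measure_pmf.prob (replicate_pmf (n - l) \<mu>) {xs. sum_list xs = z} \<le> M"
  shows "measure_pmf.prob (replicate_pmf n \<mu>) {xs. sum_list xs = s \<and> Q (take l (drop a xs))} \<le>
    measure_pmf.prob (replicate_pmf l \<mu>) {ys. Q ys} * M"
proof -
  have split: "replicate_pmf n \<mu> =
      bind_pmf (replicate_pmf l \<mu>) (\<lambda>xs. map_pmf ((@) xs) (replicate_pmf (n - l) \<mu>))"
    using replicate_pmf_distrib[of l "n - l" \<mu>] assms(1) by (simp add: map_pmf_def)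
  have M0: "0 \<le> M" using M[of 0] measure_nonneg order_trans by blast
  have "measure_pmf.prob (replicate_pmf n \<mu>) {xs. sum_list xs = s \<and> Q (take l (drop a xs))} =
    measure_pmf.prob (replicate_pmf n \<mu>) {xs. sum_list (rotate a xs) = s \<and> Q (take l (rotate a xs))}"
  proof (rule measure_pmf.finite_measure_eq_AE)
    show "AE xs in measure_pmf (replicate_pmf n \<mu>). (xs \<in> {xs. sum_list xs = s \<and> Q (take l (drop a xs))}) =
      (xs \<in> {xs. sum_list (rotate a xs) = s \<and> Q (take l (rotate a xs))})"
      using AE_replicate_pmf
    proof eventually_elim
      case (elim xs)
      have "take l (rotate a xs) = take l (drop a xs)"
      proof (cases "l = 0")
        case False
        then have "a < n" using assms(1) by simp
        then show ?thesis using elim assms(1) by (simp add: rotate_drop_take)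
      qed simp
      then show ?case by (simp add: sum_list_rotate)
    qed
  qed auto
  also have "\<dots> = measure_pmf.prob (replicate_pmf n \<mu>) {xs. sum_list xs = s \<and> Q (take l xs)}"
    by (rule prob_rotate_replicate_pmf)
  also have "\<dots> =
    measure_pmf.expectation (replicate_pmf l \<mu>) (\<lambda>xs. measure_pmf.prob (replicate_pmf (n - l) \<mu>)
      {ys. sum_list xs + sum_list ys = s \<and> Q (take l (xs @ ys))})"
    by (simp add: split measure_bind_pmf vimage_def)
  also have "\<dots> \<le> measure_pmf.expectation (replicate_pmf l \<mu>) (\<lambda>xs. indicator {ys. Q ys} xs * M)"
  proof (rule integral_mono_AE)
    show "integrable (measure_pmf (replicate_pmf l \<mu>)) (\<lambda>xs. indicator {ys. Q ys} xs * M)"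
      by (intro integrable_mult_left measure_pmf.integrable_const_bound[where B = 1]) auto
    show "integrable (measure_pmf (replicate_pmf l \<mu>)) (\<lambda>xs. measure_pmf.prob (replicate_pmf (n - l) \<mu>)
      {ys. sum_list xs + sum_list ys = s \<and> Q (take l (xs @ ys))})"
      by (intro measure_pmf.integrable_const_bound[where B = 1]) auto
    show "AE xs in measure_pmf (replicate_pmf l \<mu>). measure_pmf.prob (replicate_pmf (n - l) \<mu>)
      {ys. sum_list xs + sum_list ys = s \<and> Q (take l (xs @ ys))} \<le> indicator {ys. Q ys} xs * M"
      using AE_replicate_pmf
    proof eventually_elim
      case (elim xs)
      show ?case
      proof (cases "Q xs")
        case True
        have "measure_pmf.prob (replicate_pmf (n - l) \<mu>) {ys. sum_list xs + sum_list ys = s \<and> Q (take l (xs @ ys))}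
          \<le> measure_pmf.prob (replicate_pmf (n - l) \<mu>) {ys. sum_list ys = s - sum_list xs}"
          by (intro measure_pmf.finite_measure_mono) auto
        then show ?thesis using M[of "s - sum_list xs"] True by simp
      qed (use elim in simp)
    qed
  qed
  also have "\<dots> = measure_pmf.prob (replicate_pmf l \<mu>) {ys. Q ys} * M" by simp
  finally show ?thesis .
qed

text \<open>An interval shorter than \<open>2 ^ p\<close> with one endpoint at a multiple of
  \<open>2 ^ p\<close> needs at most one block of each scale. A general interval is cut at such a
  point, whence the factor 2.\<close>

lemma dyadic_chaining:
  fixes R :: "nat \<Rightarrow> nat \<Rightarrow> real" and \<rho> :: "nat \<Rightarrow> real"
  assumes zero: "\<And>i. R i i = 0"
    and sub: "\<And>i j k. i \<le> j \<Longrightarrow> j \<le> k \<Longrightarrow> k \<le> N \<Longrightarrow> R i k \<le> R i j + R j k"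
    and block: "\<And>q a. 2 ^ q dvd a \<Longrightarrow> a + 2 ^ q \<le> N \<Longrightarrow> R a (a + 2 ^ q) \<le> \<rho> q"
    and \<rho>: "\<And>q. 0 \<le> \<rho> q"
    and "i \<le> j" "j \<le> N" "j < i + 2 ^ p"
  shows "R i j \<le> 2 * (\<Sum>q<p. \<rho> q)"
proof -
  have left: "R i j \<le> (\<Sum>q<p. \<rho> q)" if "2 ^ p dvd i" "i \<le> j" "j < i + 2 ^ p" "j \<le> N" for p i j
    using that
  proof (induction p arbitrary: i)
    case 0
    then have "j = i" by simp
    then show ?case by (simp add: zero)
  next
    case (Suc p)
    have d: "2 ^ p dvd i" using Suc.prems(1) by (metis dvd_mult_right power_Suc)
    show ?case
    proof (cases "j < i + 2 ^ p")
      case True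
      then show ?thesis using Suc.IH[OF d] Suc.prems \<rho>[of p] by simp
    next
      case False
      then have "R i j \<le> R i (i + 2 ^ p) + R (i + 2 ^ p) j" using Suc.prems by (intro sub) auto
      moreover have "R (i + 2 ^ p) j \<le> (\<Sum>q<p. \<rho> q)" using False Suc.prems d by (intro Suc.IH) auto
      moreover have "R i (i + 2 ^ p) \<le> \<rho> p" using False Suc.prems d by (intro block) auto
      ultimately show ?thesis by simp
    qed
  qed
  have right: "R i j \<le> (\<Sum>q<p. \<rho> q)" if "2 ^ p dvd j" "i \<le> j" "j < i + 2 ^ p" "j \<le> N" for p i j
    using that
  proof (induction p arbitrary: j)
    case 0
    then have "j = i" by simp
    then show ?case by (simp add: zero)
  next
    case (Suc p)
    have d: "2 ^ p dvd j" using Suc.prems(1) by (metis dvd_mult_right power_Suc)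
    show ?case
    proof (cases "j < i + 2 ^ p")
      case True
      then show ?thesis using Suc.IH[OF d] Suc.prems \<rho>[of p] by simp
    next
      case False
      define m where "m = j - 2 ^ p"
      have m: "j = m + 2 ^ p" "i \<le> m" using False by (auto simp: m_def)
      have dm: "2 ^ p dvd m" unfolding m_def using d by (intro dvd_diff_nat) auto
      have "R i j \<le> R i m + R m j" using m Suc.prems by (intro sub) auto
      moreover have "R i m \<le> (\<Sum>q<p. \<rho> q)" using m Suc.prems dm by (intro Suc.IH) auto
      moreover have "R m j \<le> \<rho> p" using m Suc.prems dm block[of p m] by simp
      ultimately show ?thesis by simp
    qed
  qed
  show ?thesis
    using \<open>j < i + 2 ^ p\<close>
  proof (induction p)
    case 0
    then have "j = i" using \<open>i \<le> j\<close> by simp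
    then show ?case by (simp add: zero)
  next
    case (Suc p)
    show ?case
    proof (cases "j < i + 2 ^ p")
      case True
      then show ?thesis using Suc \<rho>[of p] by simp
    next
      case False
      \<comment> \<open>The last multiple of \<open>2 ^ p\<close> up to \<open>j\<close>. It does
        not precede \<open>i\<close>, because the interval has length at least
        \<open>2 ^ p\<close>.\<close>
      define c where "c = j div 2 ^ p * 2 ^ p"
      have c: "c \<le> j" "j < c + 2 ^ p" "2 ^ p dvd c"
        by (auto simp: c_def dividend_less_div_times add.commute[of "_ * _"])
      have "i \<le> c" using False c by simp
      have "R i j \<le> R i c + R c j" using c \<open>i \<le> c\<close> \<open>j \<le> N\<close> by (intro sub) auto
      moreover have "R c j \<le> (\<Sum>q<Suc p. \<rho> q)"
        using left[of p c j] c \<open>j \<le> N\<close> \<rho>[of p] by simp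
      moreover have "R i c \<le> (\<Sum>q<Suc p. \<rho> q)"
      proof (cases "c < i + 2 ^ p")
        case True
        then show ?thesis using right[of p c i] c \<open>i \<le> c\<close> \<open>j \<le> N\<close> \<rho>[of p] by simp
      next
        case False
        define m where "m = c - 2 ^ p"
        have m: "c = m + 2 ^ p" "i \<le> m" using False by (auto simp: m_def)
        have dm: "2 ^ p dvd m" unfolding m_def using c by (intro dvd_diff_nat) auto
        have "R i c \<le> R i m + R m c" using m c \<open>j \<le> N\<close> by (intro sub) auto
        moreover have "R i m \<le> (\<Sum>q<p. \<rho> q)"
          using m c dm \<open>j \<le> N\<close> Suc.prems by (intro right) auto
        moreover have "R m c \<le> \<rho> p" using m c dm block[of p m] \<open>j \<le> N\<close> by simp
        ultimately show ?thesis by simp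
      qed
      ultimately show ?thesis by simp
    qed
  qed
qed

subsection \<open>One-sided regularity of excursions\<close>

definition window :: "nat \<Rightarrow> nat \<Rightarrow> 'a list \<Rightarrow> 'a list" where
  "window i j xs = take (j - i) (drop i xs)"

definition records_holder :: "real \<Rightarrow> real \<Rightarrow> nat list \<Rightarrow> bool" where
  "records_holder K \<gamma> xs \<longleftrightarrow> (\<forall>i j. i \<le> j \<longrightarrow> j \<le> length xs \<longrightarrow>
     real (records 0 (window i j xs)) \<le> K * real (j - i) powr \<gamma>)"

lemma window_append:
  assumes "i \<le> j" "j \<le> k"
  shows "window i k xs = window i j xs @ window j k xs"
proof -
  have "take (k - i) (drop i xs) = take (j - i) (drop i xs) @ take (k - j) (drop (j - i) (drop i xs))"
    using assms by (metis add.commute diff_add_assoc2 le_add_diff_inverse2 take_add)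
  then show ?thesis using assms by (simp add: window_def)
qed

lemma records_window_subadditive:
  assumes "i \<le> j" "j \<le> k"
  shows "records 0 (window i k xs) \<le> records 0 (window i j xs) + records 0 (window j k xs)"
  using records_append_le by (simp add: window_append[OF assms])

lemma window_rotate_low:
  assumes "a < length xs" "i \<le> j" "j \<le> length xs - a"
  shows "window i j (rotate a xs) = window (i + a) (j + a) xs"
  using assms by (simp add: window_def rotate_drop_take add.commute)

lemma window_rotate_high:
  assumes "a < length xs" "length xs - a \<le> i" "i \<le> j" "j \<le> length xs"
  shows "window i j (rotate a xs) = window (i - (length xs - a)) (j - (length xs - a)) xs"
  using assms by (simp add: window_def rotate_drop_take drop_take min_absorb1)

text \<open>A window of the rotated word is a window of \<open>xs\<close>, or it splits at the seam
  into two such windows.\<close>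

lemma records_holder_rotate:
  assumes "records_holder K \<gamma> xs" "K \<ge> 0" "\<gamma> > 0"
  shows "records_holder (2 * K) \<gamma> (rotate a xs)"
proof (cases "xs = []")
  case True
  then show ?thesis using assms by (simp add: records_holder_def window_def)
next
  case False
  define b where "b = a mod length xs"
  have b: "b < length xs" using False by (simp add: b_def)
  have rot: "rotate a xs = rotate b xs" by (simp add: b_def rotate_conv_mod[of a])
  define l where "l = length xs - b"
  have low: "real (records 0 (window i j (rotate b xs))) \<le> K * real (j - i) powr \<gamma>"
    if "i \<le> j" "j \<le> l" for i j
  proof -
    have "j + b \<le> length xs" using that b by (simp add: l_def)
    then show ?thesis using assms(1) that window_rotate_low[OF b, of i j]
      unfolding records_holder_def l_def by (metis add_le_cancel_right diff_cancel2)
  qed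
  have high: "real (records 0 (window i j (rotate b xs))) \<le> K * real (j - i) powr \<gamma>"
    if "l \<le> i" "i \<le> j" "j \<le> length xs" for i j
  proof -
    have "j - l - (i - l) = j - i" "i - l \<le> j - l" "j - l \<le> length xs" using that by auto
    then show ?thesis using assms(1) window_rotate_high[OF b, of i j] that
      unfolding records_holder_def l_def by metis
  qed
  show ?thesis unfolding rot records_holder_def length_rotate
  proof (intro allI impI)
    fix i j assume ij: "i \<le> j" "j \<le> length xs"
    have nn: "0 \<le> K * real (j - i) powr \<gamma>" using assms by simp
    consider "j \<le> l" | "l \<le> i" | "i \<le> l" "l \<le> j" by linarith
    then show "real (records 0 (window i j (rotate b xs))) \<le> 2 * K * real (j - i) powr \<gamma>"
    proof cases
      case 1
      then show ?thesis using low[OF ij(1)] nn by simp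
    next
      case 2
      then show ?thesis using high[OF 2 ij] nn by simp
    next
      case 3
      have "real (records 0 (window i j (rotate b xs))) \<le>
         real (records 0 (window i l (rotate b xs))) + real (records 0 (window l j (rotate b xs)))"
        using records_window_subadditive[OF 3, of "rotate b xs"] by linarith
      also have "\<dots> \<le> K * real (l - i) powr \<gamma> + K * real (j - l) powr \<gamma>"
        using low[of i l] high[of l j] 3 ij by simp
      also have "\<dots> \<le> K * real (j - i) powr \<gamma> + K * real (j - i) powr \<gamma>"
        using 3 assms by (intro add_mono mult_left_mono powr_mono2) auto
      finally show ?thesis by simp
    qed
  qed
qed

text \<open>Sum \<open>n - 1\<close> means drift 1, so exactly one rotation qualifies in the cycle
  lemma. Regularity is not invariant under rotation; the failure event is enlarged to an invariant
  one, which weakens \<open>K\<close> to \<open>2 * K\<close>.\<close>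

lemma prob_bridge_eq:
  assumes "n > 0"
  shows "real n * measure_pmf.prob (replicate_pmf n \<mu>) {xs. records 0 xs = 0 \<and> deficit 0 xs = 1} =
    measure_pmf.prob (replicate_pmf n \<mu>) {xs. sum_list xs = n - 1}"
    (is "_ * ?P = _")
  and "K \<ge> 0 \<Longrightarrow> \<gamma> > 0 \<Longrightarrow> real n * measure_pmf.prob (replicate_pmf n \<mu>)
      {xs. records 0 xs = 0 \<and> deficit 0 xs = 1 \<and> \<not> records_holder (2 * K) \<gamma> xs} \<le>
    measure_pmf.prob (replicate_pmf n \<mu>) {xs. sum_list xs = n - 1 \<and> \<not> records_holder K \<gamma> xs}"
proof -
  let ?W = "replicate_pmf n \<mu>"
  have key: "real n * measure_pmf.prob ?W {xs. records 0 xs = 0 \<and> deficit 0 xs = 1 \<and> A (rev xs)} =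
    measure_pmf.prob ?W {xs. sum_list xs = n - 1 \<and> A xs}"
    if A: "\<And>a xs. A (rotate a xs) \<longleftrightarrow> A xs" for A
  proof -
    have "measure_pmf.prob ?W {xs. records 0 xs = 0 \<and> deficit 0 xs = 1 \<and> A (rev xs)} =
      measure_pmf.prob ?W {xs. records 0 xs = 0 \<and> sum_list (rev xs) = n - 1 \<and> A (rev xs)}"
    proof (rule measure_pmf.finite_measure_eq_AE)
      show "AE xs in measure_pmf ?W.
        (xs \<in> {xs. records 0 xs = 0 \<and> deficit 0 xs = 1 \<and> A (rev xs)}) =
        (xs \<in> {xs. records 0 xs = 0 \<and> sum_list (rev xs) = n - 1 \<and> A (rev xs)})"
        using AE_replicate_pmf
      proof eventually_elim
        case (elim xs)
        show ?case using deficit_records_0[of xs] elim assms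
          by (cases xs) (auto simp: sum_list_rev simp del: records.simps deficit.simps)
      qed
    qed auto
    also have "\<dots> = measure_pmf.prob ?W {xs. records 0 (rev xs) = 0 \<and> sum_list xs = n - 1 \<and> A xs}"
      using prob_rev_replicate_pmf[where Q = "\<lambda>xs. records 0 (rev xs) = 0 \<and> sum_list xs = n - 1 \<and> A xs"]
      by simp
    finally have "real n * measure_pmf.prob ?W {xs. records 0 xs = 0 \<and> deficit 0 xs = 1 \<and> A (rev xs)} =
      measure_pmf.expectation ?W (\<lambda>xs. real (n - sum_list xs) * indicator {xs. sum_list xs = n - 1 \<and> A xs} xs)"
      using prob_cycle[of "\<lambda>xs. sum_list xs = n - 1 \<and> A xs" n \<mu>] A by (simp add: sum_list_rotate)
    also have "\<dots> = measure_pmf.expectation ?W (indicator {xs. sum_list xs = n - 1 \<and> A xs})"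
      using assms by (intro Bochner_Integration.integral_cong) (auto simp: indicator_def)
    finally show ?thesis by simp
  qed
  show "real n * ?P = measure_pmf.prob (replicate_pmf n \<mu>) {xs. sum_list xs = n - 1}"
    using key[of "\<lambda>_. True"] by simp
  assume K: "K \<ge> 0" "\<gamma> > 0"
  \<comment> \<open>A rotation-invariant enlargement of the failure event; the reversal matches the
    one in the cycle lemma.\<close>
  define A where "A xs \<longleftrightarrow> (\<exists>a. \<not> records_holder (2 * K) \<gamma> (rev (rotate a xs)))" for xs :: "nat list"
  have A_rot: "A (rotate a xs) \<longleftrightarrow> A xs" for a xs
  proof
    show "A (rotate a xs) \<Longrightarrow> A xs" unfolding A_def by (auto simp: rotate_rotate)
  next
    assume "A xs"
    then obtain b where b: "\<not> records_holder (2 * K) \<gamma> (rev (rotate b xs))" unfolding A_def by blast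
    have "\<exists>c. rotate c (rotate a xs) = rotate b xs"
    proof (cases "xs = []")
      case False
      \<comment> \<open>Complete the rotation by \<open>a\<close> to a full turn, then rotate by
        \<open>b\<close>.\<close>
      define c where "c = b + (length xs - a mod length xs)"
      have "(c + a) mod length xs = (b + (length xs - a mod length xs + a mod length xs)) mod length xs"
        unfolding c_def by (metis add.assoc mod_add_right_eq)
      also have "length xs - a mod length xs + a mod length xs = length xs"
        using False by (simp add: less_imp_le)
      finally have "(c + a) mod length xs = b mod length xs" by simp
      then have "rotate (c + a) xs = rotate b xs" by (metis rotate_conv_mod)
      then show ?thesis by (auto simp: rotate_rotate)
    qed simp
    then show "A (rotate a xs)" using b unfolding A_def by metis
  qed
  have "real n * measure_pmf.prob ?W
      {xs. records 0 xs = 0 \<and> deficit 0 xs = 1 \<and> \<not> records_holder (2 * K) \<gamma> xs} \<le>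
    real n * measure_pmf.prob ?W {xs. records 0 xs = 0 \<and> deficit 0 xs = 1 \<and> A (rev xs)}"
    by (intro mult_left_mono measure_pmf.finite_measure_mono)
      (auto simp: A_def intro!: exI[of _ 0])
  also have "\<dots> = measure_pmf.prob ?W {xs. sum_list xs = n - 1 \<and> A xs}"
    by (rule key[OF A_rot])
  also have "\<dots> = measure_pmf.prob ?W {xs. sum_list (rev xs) = n - 1 \<and> A (rev xs)}"
    by (rule prob_rev_replicate_pmf[symmetric])
  also have "\<dots> \<le> measure_pmf.prob ?W {xs. sum_list xs = n - 1 \<and> \<not> records_holder K \<gamma> xs}"
  proof (rule measure_pmf.finite_measure_mono)
    have "\<not> records_holder K \<gamma> xs" if "A (rev xs)" for xs
    proof
      assume h: "records_holder K \<gamma> xs"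
      from that obtain a where "\<not> records_holder (2 * K) \<gamma> (rev (rotate a (rev xs)))"
        unfolding A_def by blast
      then have "\<not> records_holder (2 * K) \<gamma> (rotate (length xs - a mod length xs) xs)"
        by (simp add: rotate_rev)
      then show False using records_holder_rotate[OF h K] by blast
    qed
    then show "{xs. sum_list (rev xs) = n - 1 \<and> A (rev xs)} \<subseteq> {xs. sum_list xs = n - 1 \<and> \<not> records_holder K \<gamma> xs}"
      by (auto simp: sum_list_rev)
  qed auto
  finally show "real n * measure_pmf.prob ?W
      {xs. records 0 xs = 0 \<and> deficit 0 xs = 1 \<and> \<not> records_holder (2 * K) \<gamma> xs} \<le>
    measure_pmf.prob ?W {xs. sum_list xs = n - 1 \<and> \<not> records_holder K \<gamma> xs}" .
qed

text \<open>One factor 2 is due to cutting at a dyadic point, another to the top scale. The rest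
  bounds a geometric series in \<open>2 powr \<gamma>\<close> up to a power of 2 of at most twice
  the window length.\<close>

definition chaining_const :: "real \<Rightarrow> real" where
  "chaining_const \<gamma> = 4 * 2 powr \<gamma> / (2 powr \<gamma> - 1)"

lemma chaining_const_pos: "\<gamma> > 0 \<Longrightarrow> chaining_const \<gamma> > 0"
  by (simp add: chaining_const_def gr_one_powr)

text \<open>Scales above \<open>length xs / 2\<close> only involve one window, which splits into two controlled ones.\<close>

lemma records_holder_dyadic:
  assumes len: "length xs \<ge> 2" and "K \<ge> 0" "\<gamma> > 0"
    and dy: "\<And>q m. 2 * 2 ^ q \<le> length xs \<Longrightarrow> m < length xs div 2 ^ q \<Longrightarrow>
      real (records 0 (window (m * 2 ^ q) (m * 2 ^ q + 2 ^ q) xs)) \<le> K * (2 ^ q) powr \<gamma>"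
  shows "records_holder (chaining_const \<gamma> * K) \<gamma> xs"
  unfolding records_holder_def
proof (intro allI impI)
  fix i j assume ij: "i \<le> j" "j \<le> length xs"
  define N where "N = length xs"
  define R where "R i j = real (records 0 (window i j xs))" for i j
  define \<rho> where "\<rho> q = 2 * K * (2 ^ q) powr \<gamma>" for q :: nat
  have \<rho>0: "0 \<le> \<rho> q" for q unfolding \<rho>_def using \<open>K \<ge> 0\<close> by simp
  have dvd: "R a (a + 2 ^ q) \<le> K * (2 ^ q) powr \<gamma>" if "2 * 2 ^ q \<le> N" "2 ^ q dvd a" "a + 2 ^ q \<le> N" for a q
  proof -
    obtain m where m: "a = m * 2 ^ q" using \<open>2 ^ q dvd a\<close> by (metis dvdE mult.commute)
    have "Suc m * 2 ^ q \<le> N" using that m by simp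
    then have "Suc m \<le> N div 2 ^ q" by (simp add: less_eq_div_iff_mult_less_eq)
    then show ?thesis using dy[of q m] that(1) m unfolding R_def N_def by simp
  qed
  have sub: "R i k \<le> R i j + R j k" if "i \<le> j" "j \<le> k" for i j k
    using records_window_subadditive[OF that, of xs] unfolding R_def by linarith
  have block: "R a (a + 2 ^ q) \<le> \<rho> q" if a: "2 ^ q dvd a" "a + 2 ^ q \<le> N" for q a
  proof (cases "2 * 2 ^ q \<le> N")
    case True
    have "0 \<le> K * (2 ^ q) powr \<gamma>" using \<open>K \<ge> 0\<close> by simp
    then show ?thesis using dvd[OF True a] by (simp add: \<rho>_def)
  next
    case False
    have "a = 0"
    proof (rule ccontr)
      assume "a \<noteq> 0"
      then have "2 ^ q \<le> a" using a by (intro dvd_imp_le) auto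
      then show False using a False by simp
    qed
    obtain p where q: "q = Suc p" using False len N_def by (cases q) auto
    have 2: "2 * 2 ^ p \<le> N" using a q by simp
    have "R 0 (2 ^ q) \<le> R 0 (2 ^ p) + R (2 ^ p) (2 ^ p + 2 ^ p)"
      using sub[of 0 "2 ^ p" "2 ^ q"] q by (simp add: mult_2)
    also have "\<dots> \<le> K * (2 ^ p) powr \<gamma> + K * (2 ^ p) powr \<gamma>"
      using dvd[OF 2, of 0] dvd[OF 2, of "2 ^ p"] 2 by simp
    also have "\<dots> \<le> K * (2 ^ q) powr \<gamma> + K * (2 ^ q) powr \<gamma>"
      using q \<open>K \<ge> 0\<close> \<open>\<gamma> > 0\<close> by (intro add_mono mult_left_mono powr_mono2) auto
    finally show ?thesis using \<open>a = 0\<close> by (simp add: \<rho>_def)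
  qed
  show "real (records 0 (window i j xs)) \<le> chaining_const \<gamma> * K * real (j - i) powr \<gamma>"
  proof (cases "i = j")
    case True
    then show ?thesis by (simp add: window_def)
  next
    case False
    define d where "d = j - i"
    have d: "d \<ge> 1" using False ij by (simp add: d_def)
    obtain p0 where p0: "2 ^ p0 \<le> d" "d < 2 ^ Suc p0"
      using ex_power_ivl1[of 2 d] d by auto
    define p where "p = Suc p0"
    have p: "2 ^ p \<le> 2 * d" "d < 2 ^ p" using p0 by (auto simp: p_def)
    have chain: "R i j \<le> 2 * (\<Sum>q<p. \<rho> q)"
      by (rule dyadic_chaining[where N = N]) (use sub block \<rho>0 ij p in \<open>auto simp: R_def N_def window_def d_def\<close>)
    have "(\<Sum>q<p. \<rho> q) = 2 * K * (\<Sum>q<p. (2 powr \<gamma>) ^ q)"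
      by (simp add: \<rho>_def sum_distrib_left powr_realpow[symmetric] powr_powr mult.commute)
    moreover have "(\<Sum>q<p. (2 powr \<gamma>) ^ q) \<le> (2 powr \<gamma> * real d powr \<gamma>) / (2 powr \<gamma> - 1)"
    proof -
      have "(\<Sum>q<p. (2 powr \<gamma>) ^ q) = ((2 powr \<gamma>) ^ p - 1) / (2 powr \<gamma> - 1)"
        using \<open>\<gamma> > 0\<close> by (subst geometric_sum) (auto simp: gr_one_powr less_imp_neq[symmetric])
      also have "\<dots> \<le> (2 powr \<gamma> * real d powr \<gamma>) / (2 powr \<gamma> - 1)"
      proof (rule divide_right_mono)
        have "(2 powr \<gamma>) ^ p = (2 ^ p) powr \<gamma>"
          by (simp add: powr_realpow[symmetric] powr_powr mult.commute)
        also have "\<dots> \<le> (2 * real d) powr \<gamma>"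
        proof (rule powr_mono2)
          have "real (2 ^ p) \<le> real (2 * d)" using p(1) of_nat_mono by blast
          then show "2 ^ p \<le> 2 * real d" by simp
        qed (use \<open>\<gamma> > 0\<close> in auto)
        finally show "(2 powr \<gamma>) ^ p - 1 \<le> 2 powr \<gamma> * real d powr \<gamma>" by (simp add: powr_mult)
      qed (use \<open>\<gamma> > 0\<close> in \<open>simp add: gr_one_powr less_imp_le\<close>)
      finally show ?thesis .
    qed
    ultimately have "(\<Sum>q<p. \<rho> q) \<le> 2 * K * ((2 powr \<gamma> * real d powr \<gamma>) / (2 powr \<gamma> - 1))"
      using \<open>K \<ge> 0\<close> by (simp only:) (intro mult_left_mono, auto)
    with chain have "R i j \<le> 2 * (2 * K * ((2 powr \<gamma> * real d powr \<gamma>) / (2 powr \<gamma> - 1)))" by linarith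
    also have "\<dots> = chaining_const \<gamma> * K * real d powr \<gamma>" by (simp add: chaining_const_def)
    finally show ?thesis unfolding R_def d_def .
  qed
qed

text \<open>A union bound over at most \<open>N / 2 ^ q\<close> blocks per scale. Larger scales are
  left out so that at least half of the letters lie outside each block and \<open>M\<close> bounds
  the point masses of their sum.\<close>

lemma prob_not_holder_union:
  assumes N: "N \<ge> 2" and "K \<ge> 0" "\<gamma> > 0"
    and M: "\<And>q z. 2 * 2 ^ q \<le> N \<Longrightarrow> measure_pmf.prob (replicate_pmf (N - 2 ^ q) \<mu>) {xs. sum_list xs = z} \<le> M"
  shows "measure_pmf.prob (replicate_pmf N \<mu>)
      {xs. sum_list xs = s \<and> \<not> records_holder (chaining_const \<gamma> * K) \<gamma> xs} \<le>
    (\<Sum>q | 2 * 2 ^ q \<le> N. real N / 2 ^ q *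
       (measure_pmf.prob (replicate_pmf (2 ^ q) \<mu>) {xs. K * (2 ^ q) powr \<gamma> < real (records 0 xs)} * M))"
proof -
  let ?W = "replicate_pmf N \<mu>"
  define Q where "Q = {q. 2 * 2 ^ q \<le> N}"
  have fin: "finite Q"
  proof (rule finite_subset)
    show "Q \<subseteq> {..N}"
    proof
      fix q assume "q \<in> Q"
      then have "2 ^ q \<le> N" by (simp add: Q_def)
      from less_le_trans[OF less_exp this] show "q \<in> {..N}" by simp
    qed
  qed simp
  have M0: "M \<ge> 0" using M[of 0 0] N measure_nonneg order_trans by (metis mult_2 numeral_1_eq_Suc_0 one_add_one power_0)
  define B where "B q m = {xs. sum_list xs = s \<and> K * (2 ^ q) powr \<gamma> <
      real (records 0 (take (2 ^ q) (drop (m * 2 ^ q) xs)))}" for q m :: nat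
  have "measure_pmf.prob ?W {xs. sum_list xs = s \<and> \<not> records_holder (chaining_const \<gamma> * K) \<gamma> xs} \<le>
    measure_pmf.prob ?W (\<Union>q\<in>Q. \<Union>m<N div 2 ^ q. B q m)"
  proof (rule measure_pmf.finite_measure_mono_AE)
    show "AE xs in measure_pmf ?W. xs \<in> {xs. sum_list xs = s \<and> \<not> records_holder (chaining_const \<gamma> * K) \<gamma> xs}
       \<longrightarrow> xs \<in> (\<Union>q\<in>Q. \<Union>m<N div 2 ^ q. B q m)"
      using AE_replicate_pmf
    proof eventually_elim
      case (elim xs)
      show ?case
      proof
        assume a: "xs \<in> {xs. sum_list xs = s \<and> \<not> records_holder (chaining_const \<gamma> * K) \<gamma> xs}"
        then obtain q m where "2 * 2 ^ q \<le> N" "m < N div 2 ^ q"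
          "\<not> real (records 0 (window (m * 2 ^ q) (m * 2 ^ q + 2 ^ q) xs)) \<le> K * (2 ^ q) powr \<gamma>"
          using records_holder_dyadic[of xs K \<gamma>] elim N \<open>K \<ge> 0\<close> \<open>\<gamma> > 0\<close> by blast
        then have "xs \<in> B q m" "q \<in> Q" "m \<in> {..<N div 2 ^ q}"
          using a by (auto simp: B_def Q_def window_def)
        then show "xs \<in> (\<Union>q\<in>Q. \<Union>m<N div 2 ^ q. B q m)" by blast
      qed
    qed
  qed auto
  also have "\<dots> \<le> (\<Sum>q\<in>Q. \<Sum>m<N div 2 ^ q. measure_pmf.prob ?W (B q m))"
    by (intro order_trans[OF measure_pmf.finite_measure_subadditive_finite] fin sum_mono
        measure_pmf.finite_measure_subadditive_finite) auto
  also have "\<dots> \<le> (\<Sum>q\<in>Q. \<Sum>m<N div 2 ^ q.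
      measure_pmf.prob (replicate_pmf (2 ^ q) \<mu>) {xs. K * (2 ^ q) powr \<gamma> < real (records 0 xs)} * M)"
  proof (intro sum_mono)
    fix q m assume q: "q \<in> Q" and m: "m \<in> {..<N div 2 ^ q}"
    have "Suc m \<le> N div 2 ^ q" using m by simp
    then have "Suc m * 2 ^ q \<le> N" by (subst (asm) less_eq_div_iff_mult_less_eq) auto
    then show "measure_pmf.prob ?W (B q m) \<le>
       measure_pmf.prob (replicate_pmf (2 ^ q) \<mu>) {xs. K * (2 ^ q) powr \<gamma> < real (records 0 xs)} * M"
      unfolding B_def using q M by (intro prob_window) (auto simp: Q_def)
  qed
  also have "\<dots> \<le> (\<Sum>q\<in>Q. real N / 2 ^ q *
      (measure_pmf.prob (replicate_pmf (2 ^ q) \<mu>) {xs. K * (2 ^ q) powr \<gamma> < real (records 0 xs)} * M))"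
  proof (rule sum_mono)
    fix q
    have "real (N div 2 ^ q) \<le> real N / 2 ^ q"
    proof -
      have "real (N div 2 ^ q * 2 ^ q) \<le> real N" by (simp only: of_nat_le_iff div_times_less_eq_dividend)
      then show ?thesis by (simp add: pos_le_divide_eq)
    qed
    then show "(\<Sum>m<N div 2 ^ q.
      measure_pmf.prob (replicate_pmf (2 ^ q) \<mu>) {xs. K * (2 ^ q) powr \<gamma> < real (records 0 xs)} * M) \<le>
      real N / 2 ^ q *
      (measure_pmf.prob (replicate_pmf (2 ^ q) \<mu>) {xs. K * (2 ^ q) powr \<gamma> < real (records 0 xs)} * M)"
      using M0 by (simp del: times_divide_eq_left) (intro mult_right_mono, auto)
  qed
  finally show ?thesis by (simp add: Q_def)
qed

lemma exp_minus_le_fact: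
  assumes "x > (0 :: real)"
  shows "exp (- x) \<le> fact m / x ^ m"
proof -
  have "(\<Sum>n\<in>{m}. x ^ n / fact n) \<le> (\<Sum>n. x ^ n / fact n)"
    using assms summable_exp[of x]
    by (intro sum_le_suminf) (auto simp: divide_inverse mult.commute)
  then have "x ^ m / fact m \<le> exp x"
    by (simp add: exp_def divide_inverse mult.commute)
  then show ?thesis using assms by (simp add: exp_minus field_simps)
qed

text \<open>With \<open>y = N / l\<close>, a block of length \<open>l\<close> exceeds its share of
  records with probability at most \<open>exp (- (\<kappa> * y powr \<delta>))\<close>, where
  \<delta> is what \<gamma> and the growth exponent \<theta> leave of 1. By the choice of
  \<open>m\<close> this is at most a constant times \<open>1 / y ^ 2\<close>, enough for
  \<open>y\<close> blocks and all scales.\<close>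

lemma prob_excursion_not_holder:
  fixes b :: "nat \<Rightarrow> real"
  assumes N: "N \<ge> 2" and b: "\<And>n. b n > 0"
    and "0 < c" "0 < C1" "0 < \<gamma>" "0 < \<delta>" "real m * \<delta> \<ge> 2" "\<theta> = 1 - \<gamma> - \<delta>" "C > 0"
    and low: "\<And>l. l > 0 \<Longrightarrow> c * b l \<le> measure_pmf.expectation (replicate_pmf l \<mu>) (\<lambda>xs. real (l - sum_list xs))"
    and potter: "\<And>l. l > 0 \<Longrightarrow> l \<le> N \<Longrightarrow> b N \<le> C1 * (real N / real l) powr \<theta> * b l"
    and M: "\<And>n z. N \<le> 2 * n \<Longrightarrow> n \<le> N \<Longrightarrow> measure_pmf.prob (replicate_pmf n \<mu>) {xs. sum_list xs = z} \<le> M"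
  shows "real N * measure_pmf.prob (replicate_pmf N \<mu>)
      {xs. records 0 xs = 0 \<and> deficit 0 xs = 1 \<and>
        \<not> records_holder (2 * chaining_const \<gamma> * C * (real N / b N) * real N powr - \<gamma>) \<gamma> xs} \<le>
    M * fact m / (C * c / C1) ^ m"
proof -
  define K where "K = C * (real N / b N) * real N powr - \<gamma>"
  define \<kappa> where "\<kappa> = C * c / C1"
  have K: "K \<ge> 0" using \<open>C > 0\<close> less_imp_le[OF b[of N]] by (simp add: K_def)
  have \<kappa>: "\<kappa> > 0" using assms by (simp add: \<kappa>_def)
  have M0: "M \<ge> 0" using M[of N 0] measure_nonneg order_trans by (metis le_add2 mult_2 order_refl)
  \<comment> \<open>One factor \<open>1 / y\<close> pays for the number of blocks. The other one,
    \<open>2 ^ q / N\<close>, has sum at most 1 over the scales.\<close>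
  have scale: "real N / 2 ^ q *
       (measure_pmf.prob (replicate_pmf (2 ^ q) \<mu>) {xs. K * (2 ^ q) powr \<gamma> < real (records 0 xs)} * M)
     \<le> (M * fact m / \<kappa> ^ m) * (2 ^ q / real N)" if q: "2 * 2 ^ q \<le> N" for q :: nat
  proof -
    define l where "l = (2 :: nat) ^ q"
    have l: "l > 0" "l \<le> N" "real l = 2 ^ q" using q by (auto simp: l_def)
    define y where "y = real N / real l"
    have y: "y \<ge> 1" using l by (simp add: y_def)
    define u where "u = measure_pmf.expectation (replicate_pmf l \<mu>) (\<lambda>xs. real (l - sum_list xs)) / real l"
    have u: "u \<ge> c * b l / real l" unfolding u_def using low[OF l(1)] by (intro divide_right_mono) auto
    have Nl: "real N = y * real l" using l by (simp add: y_def)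
    have "\<kappa> * y powr \<delta> \<le> K * (2 ^ q) powr \<gamma> * u"
    proof -
      have "K * (2 ^ q) powr \<gamma> = C * real N / b N * (real l / real N) powr \<gamma>"
        using l N by (simp add: K_def powr_divide powr_minus l_def field_simps)
      also have "(real l / real N) powr \<gamma> = y powr - \<gamma>"
        using l N by (simp add: y_def powr_divide powr_minus field_simps)
      finally have 1: "K * (2 ^ q) powr \<gamma> * (c * b l / real l) = C * c * y powr (1 - \<gamma>) * (b l / b N)"
        using l y by (simp add: Nl powr_diff powr_minus field_simps)
      have "b N \<le> C1 * y powr \<theta> * b l" using potter[OF l(1,2)] by (simp add: y_def)
      then have "1 / (C1 * y powr \<theta>) \<le> b l / b N"
        using b[of N] b[of l] \<open>0 < C1\<close> y by (simp add: field_simps)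
      then have "C * c * y powr (1 - \<gamma>) * (1 / (C1 * y powr \<theta>)) \<le> C * c * y powr (1 - \<gamma>) * (b l / b N)"
        using assms by (intro mult_left_mono) auto
      moreover have "C * c * y powr (1 - \<gamma>) * (1 / (C1 * y powr \<theta>)) = \<kappa> * y powr \<delta>"
      proof -
        have "y powr (1 - \<gamma>) = y powr \<theta> * y powr \<delta>" by (simp add: \<open>\<theta> = 1 - \<gamma> - \<delta>\<close> flip: powr_add)
        then show ?thesis using y \<open>0 < C1\<close> by (simp add: \<kappa>_def field_simps)
      qed
      moreover have "K * (2 ^ q) powr \<gamma> * (c * b l / real l) \<le> K * (2 ^ q) powr \<gamma> * u"
        using K u by (intro mult_left_mono) auto
      ultimately show ?thesis using 1 by linarith
    qed
    then have "exp (- (K * (2 ^ q) powr \<gamma>) * u) \<le> exp (- (\<kappa> * y powr \<delta>))" by simp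
    also have "\<dots> \<le> fact m / (\<kappa> * y powr \<delta>) ^ m"
      using \<kappa> y by (intro exp_minus_le_fact) auto
    also have "\<dots> \<le> fact m / \<kappa> ^ m * (1 / y ^ 2)"
    proof -
      have "(y powr \<delta>) ^ m = y powr (\<delta> * real m)" using y by (simp add: powr_realpow[symmetric] powr_powr)
      also have "\<dots> \<ge> y powr 2" using y \<open>real m * \<delta> \<ge> 2\<close> by (intro powr_mono) (auto simp: mult.commute)
      finally have "y ^ 2 \<le> (y powr \<delta>) ^ m" using y by simp
      then have "fact m / (\<kappa> ^ m * (y powr \<delta>) ^ m) \<le> fact m / (\<kappa> ^ m * y ^ 2)"
        using \<kappa> y by (intro divide_left_mono mult_left_mono mult_pos_pos) auto
      then show ?thesis by (simp add: power_mult_distrib)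
    qed
    finally have "measure_pmf.prob (replicate_pmf l \<mu>) {xs. K * (2 ^ q) powr \<gamma> < real (records 0 xs)} \<le>
        fact m / \<kappa> ^ m * (1 / y ^ 2)"
      using prob_records_ge[OF l(1), of \<mu> "K * (2 ^ q) powr \<gamma>"] by (simp add: u_def)
    then have "y * (measure_pmf.prob (replicate_pmf l \<mu>) {xs. K * (2 ^ q) powr \<gamma> < real (records 0 xs)} * M)
       \<le> y * (fact m / \<kappa> ^ m * (1 / y ^ 2) * M)"
      using y M0 by (intro mult_left_mono mult_right_mono) auto
    also have "\<dots> = (M * fact m / \<kappa> ^ m) * (1 / y)" using y by (simp add: power2_eq_square field_simps)
    finally show ?thesis using l by (simp add: y_def l_def)
  qed
  have "real N * measure_pmf.prob (replicate_pmf N \<mu>)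
      {xs. records 0 xs = 0 \<and> deficit 0 xs = 1 \<and> \<not> records_holder (2 * (chaining_const \<gamma> * K)) \<gamma> xs} \<le>
     measure_pmf.prob (replicate_pmf N \<mu>) {xs. sum_list xs = N - 1 \<and> \<not> records_holder (chaining_const \<gamma> * K) \<gamma> xs}"
    using N K chaining_const_pos[OF \<open>0 < \<gamma>\<close>] \<open>0 < \<gamma>\<close> by (intro prob_bridge_eq(2)) auto
  also have "\<dots> \<le> (\<Sum>q | 2 * 2 ^ q \<le> N. real N / 2 ^ q *
       (measure_pmf.prob (replicate_pmf (2 ^ q) \<mu>) {xs. K * (2 ^ q) powr \<gamma> < real (records 0 xs)} * M))"
    using N K \<open>0 < \<gamma>\<close> by (intro prob_not_holder_union M) auto
  also have "\<dots> \<le> (\<Sum>q | 2 * 2 ^ q \<le> N. (M * fact m / \<kappa> ^ m) * (2 ^ q / real N))"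
    using scale by (intro sum_mono) auto
  also have "\<dots> = (M * fact m / \<kappa> ^ m) * ((\<Sum>q | 2 * 2 ^ q \<le> N. 2 ^ q) / real N)"
    by (simp add: sum_distrib_left sum_divide_distrib)
  also have "\<dots> \<le> (M * fact m / \<kappa> ^ m) * 1"
  proof (intro mult_left_mono)
    obtain p where p: "2 ^ p \<le> N" "N < 2 ^ Suc p" using ex_power_ivl1[of 2 N] N by auto
    have "{q. 2 * 2 ^ q \<le> N} \<subseteq> {..<p}"
    proof
      fix q assume "q \<in> {q. 2 * 2 ^ q \<le> N}"
      then have "2 * 2 ^ q \<le> N" by simp
      then have "(2 :: nat) ^ Suc q < 2 ^ Suc p" using p(2) by (metis le_less_trans power_Suc)
      then have "Suc q < Suc p" by (rule power_less_imp_less_exp[rotated]) simp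
      then show "q \<in> {..<p}" by simp
    qed
    then have "(\<Sum>q | 2 * 2 ^ q \<le> N. (2 :: real) ^ q) \<le> (\<Sum>q<p. 2 ^ q)" by (intro sum_mono2) auto
    also have "\<dots> \<le> 2 ^ p" by (subst geometric_sum) auto
    also have "\<dots> \<le> real N" using p(1) by (metis of_nat_le_iff of_nat_numeral of_nat_power)
    finally show "(\<Sum>q | 2 * 2 ^ q \<le> N. 2 ^ q) / real N \<le> 1" using N by simp
  qed (use M0 \<kappa> in auto)
  finally show ?thesis by (simp add: K_def \<kappa>_def mult.assoc)
qed

subsection \<open>Characteristic functions and inversion\<close>

text \<open>Without mass on the left the Laplace transform would be at most 1. Without mass on the
  right, \<open>- X\<close> would have a finite mean \<open>m\<close> with
  \<open>1 + l * m \<le> exp (l powr \<alpha>)\<close>; as \<alpha> exceeds 1, letting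
  \<open>l\<close> tend to 0 gives \<open>m = 0\<close> and hence \<open>X = 0\<close>.\<close>

lemma stable_law_pos_neg:
  assumes "stable_law \<alpha> \<nu>" "1 < \<alpha>"
  shows "measure \<nu> {0<..} > 0" "measure \<nu> {..<0} > 0"
proof -
  interpret real_distribution \<nu> using assms by (simp add: stable_law_def)
  have lap: "has_bochner_integral \<nu> (\<lambda>x. exp (- l * x)) (exp (l powr \<alpha>))" if "l \<ge> 0" for l
    using assms that by (simp add: stable_law_def)
  show "measure \<nu> {..<0} > 0"
  proof (rule ccontr)
    assume "\<not> measure \<nu> {..<0} > 0"
    then have "measure \<nu> {..<0} = 0" using measure_nonneg[of \<nu> "{..<0}"] by linarith
    then have "AE x in \<nu>. x \<notin> {..<0}"
      by (intro AE_I[where N = "{..<0}"]) (auto simp: emeasure_eq_measure)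
    then have "(\<integral>x. exp (- 1 * x) \<partial>\<nu>) \<le> (\<integral>x. 1 \<partial>\<nu>)"
      using lap[of 1] by (intro integral_mono_AE) (auto simp: has_bochner_integral_iff not_less)
    then have "exp (1 :: real) \<le> 1" using lap[of 1] prob_space by (simp add: has_bochner_integral_iff)
    then show False by simp
  qed
  show "measure \<nu> {0<..} > 0"
  proof (rule ccontr)
    assume "\<not> measure \<nu> {0<..} > 0"
    then have "measure \<nu> {0<..} = 0" using measure_nonneg[of \<nu> "{0<..}"] by linarith
    then have neg: "AE x in \<nu>. x \<le> 0"
      by (intro AE_I[where N = "{0<..}"]) (auto simp: emeasure_eq_measure)
    have i1: "integrable \<nu> (\<lambda>x. exp (- x))" using lap[of 1] by (simp add: has_bochner_integral_iff)
    have int: "integrable \<nu> (\<lambda>x. - x)"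
      by (rule Bochner_Integration.integrable_bound[OF i1])
        (use neg in \<open>auto elim!: eventually_mono intro!: order_trans[OF _ exp_ge_add_one_self]\<close>)
    define m where "m = (\<integral>x. - x \<partial>\<nu>)"
    have m: "m \<le> 2 * l powr (\<alpha> - 1)" if l: "0 < l" "l < 1" for l
    proof -
      have "(\<integral>x. 1 + l * (- x) \<partial>\<nu>) \<le> (\<integral>x. exp (- l * x) \<partial>\<nu>)"
        using lap[of l] l int exp_ge_add_one_self[of "- (l * x)" for x]
        by (intro integral_mono) (auto simp: has_bochner_integral_iff)
      then have "1 + l * m \<le> exp (l powr \<alpha>)"
        using lap[of l] l int prob_space by (simp add: has_bochner_integral_iff m_def)
      also have "\<dots> \<le> 1 + 2 * l powr \<alpha>"
      proof -
        have "l powr \<alpha> \<le> 1" using l assms(2) by (simp add: powr_le1)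
        then show ?thesis using exp_bound[of "l powr \<alpha>"] mult_left_le[of "l powr \<alpha>" "l powr \<alpha>"]
          by (simp add: power2_eq_square)
      qed
      finally have "m \<le> 2 * (l powr \<alpha> / l)" using l by (simp add: field_simps)
      then show ?thesis using l by (simp add: powr_diff)
    qed
    have "((\<lambda>l. 2 * l powr (\<alpha> - 1)) \<longlongrightarrow> 2 * 0) (at_right 0)"
      using assms(2) by (intro tendsto_mult tendsto_const tendsto_zero_powrI[where b = "\<alpha> - 1"])
        (auto simp: eventually_at_right_less eventually_at_right_field intro!: tendsto_intros exI[of _ 1])
    moreover have "\<forall>\<^sub>F l in at_right 0. m \<le> 2 * l powr (\<alpha> - 1)"
      unfolding eventually_at_right_field using m by (intro exI[of _ 1]) auto
    ultimately have "m \<le> 0" by (intro tendsto_lowerbound[where F = "at_right 0"]) auto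
    moreover have "0 \<le> m" unfolding m_def using neg by (intro integral_nonneg_AE) auto
    ultimately have "AE x in \<nu>. - x = 0"
      using integral_nonneg_eq_0_iff_AE[OF int] neg by (simp add: m_def)
    then have "(\<integral>x. exp (- 1 * x) \<partial>\<nu>) = (\<integral>x. 1 \<partial>\<nu>)" by (intro integral_cong_AE) auto
    then show False using lap[of 1] prob_space by (simp add: has_bochner_integral_iff)
  qed
qed

section \<open>The step law and its sums\<close>

definition step_law :: "nat pmf \<Rightarrow> real measure" where
  "step_law \<mu> = distr (measure_pmf \<mu>) borel (\<lambda>k. real k - 1)"

lemma real_distribution_step_law: "real_distribution (step_law \<mu>)"
proof -
  interpret prob_space "step_law \<mu>"
    unfolding step_law_def by (intro measure_pmf.prob_space_distr) auto
  show ?thesis by standard (auto simp: step_law_def)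
qed

lemma char_step_law: "char (step_law \<mu>) t = measure_pmf.expectation \<mu> (\<lambda>k. iexp (t * (real k - 1)))"
  unfolding char_def step_law_def by (subst integral_distr) auto

definition sum_pmf :: "nat pmf \<Rightarrow> nat \<Rightarrow> nat pmf" where
  "sum_pmf \<mu> n = map_pmf sum_list (replicate_pmf n \<mu>)"

lemma sum_pmf_0: "sum_pmf \<mu> 0 = return_pmf 0"
  by (simp add: sum_pmf_def)

lemma sum_pmf_Suc: "sum_pmf \<mu> (Suc n) = map_pmf (\<lambda>(x, s). x + s) (pair_pmf \<mu> (sum_pmf \<mu> n))"
  by (simp add: sum_pmf_def map_pmf_def pair_pmf_def bind_assoc_pmf bind_return_pmf)

lemma sum_pmf_add:
  "sum_pmf \<mu> (m + n) = map_pmf (\<lambda>(x, s). x + s) (pair_pmf (sum_pmf \<mu> m) (sum_pmf \<mu> n))"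
  by (simp add: sum_pmf_def replicate_pmf_distrib map_pmf_def pair_pmf_def bind_assoc_pmf bind_return_pmf)

text \<open>Adding \<open>B\<close> makes \<open>h\<close> nonnegative, so the identity can be taken
  from \<open>nn_integral\<close>.\<close>

lemma integral_bind_pmf_bounded:
  fixes h :: "'b \<Rightarrow> real"
  assumes "\<And>y. \<bar>h y\<bar> \<le> B"
  shows "measure_pmf.expectation (bind_pmf p f) h =
    measure_pmf.expectation p (\<lambda>x. measure_pmf.expectation (f x) h)"
proof -
  have i1: "integrable (measure_pmf q) h" for q
    using assms by (intro measure_pmf.integrable_const_bound[where B = B]) auto
  have bound: "\<bar>measure_pmf.expectation q h\<bar> \<le> B" for q
  proof -
    have "\<bar>measure_pmf.expectation q h\<bar> \<le> measure_pmf.expectation q (\<lambda>y. \<bar>h y\<bar>)"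
      by (rule integral_abs_bound)
    also have "\<dots> \<le> measure_pmf.expectation q (\<lambda>_. B)"
      using assms i1 by (intro integral_mono) auto
    finally show ?thesis by simp
  qed
  have i2: "integrable (measure_pmf p) (\<lambda>x. measure_pmf.expectation (f x) h)"
    using bound by (intro measure_pmf.integrable_const_bound[where B = B]) auto
  have nn: "0 \<le> h y + B" for y using assms[of y] by linarith
  have nn': "0 \<le> measure_pmf.expectation (f x) h + B" for x using bound[of "f x"] by linarith
  have "ennreal (measure_pmf.expectation (bind_pmf p f) (\<lambda>y. h y + B)) = (\<integral>\<^sup>+y. ennreal (h y + B) \<partial>bind_pmf p f)"
    using i1 nn by (intro nn_integral_eq_integral[symmetric]) auto
  also have "\<dots> = (\<integral>\<^sup>+x. \<integral>\<^sup>+y. ennreal (h y + B) \<partial>f x \<partial>p)" by simp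
  also have "\<dots> = (\<integral>\<^sup>+x. ennreal (measure_pmf.expectation (f x) h + B) \<partial>p)"
    using i1 nn by (intro nn_integral_cong) (simp add: nn_integral_eq_integral)
  also have "\<dots> = ennreal (measure_pmf.expectation p (\<lambda>x. measure_pmf.expectation (f x) h + B))"
    using i2 nn' by (intro nn_integral_eq_integral) auto
  finally have "measure_pmf.expectation (bind_pmf p f) (\<lambda>y. h y + B) =
      measure_pmf.expectation p (\<lambda>x. measure_pmf.expectation (f x) h + B)"
    using nn nn' by (subst (asm) ennreal_inj) (auto intro!: integral_nonneg_AE)
  then show ?thesis using i1 i2 by simp
qed

lemma integral_pair_pmf_times:
  fixes f :: "'a \<Rightarrow> complex"
  assumes f: "\<And>x. norm (f x) \<le> 1" and g: "\<And>y. norm (g y) \<le> 1"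
  shows "measure_pmf.expectation (pair_pmf p q) (\<lambda>(x, y). f x * g y) =
    measure_pmf.expectation p f * measure_pmf.expectation q g"
proof -
  define h where "h = (\<lambda>(x, y). f x * g y)"
  have h: "norm (h z) \<le> 1" for z
    unfolding h_def using f g by (cases z) (auto simp: norm_mult intro!: mult_le_one)
  have bind: "measure_pmf.expectation (pair_pmf p q) k =
      measure_pmf.expectation p (\<lambda>x. measure_pmf.expectation q (\<lambda>y. k (x, y)))"
    if "\<And>z. \<bar>k z\<bar> \<le> 1" for k :: "'a \<times> 'b \<Rightarrow> real"
    using integral_bind_pmf_bounded[OF that, of p "\<lambda>x. map_pmf (Pair x) q"]
    by (simp add: pair_pmf_def map_pmf_def[symmetric])
  have i1: "integrable (measure_pmf r) h" for r
    using h by (intro measure_pmf.integrable_const_bound[where B = 1]) auto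
  have i2: "integrable (measure_pmf q) (\<lambda>y. h (x, y))" for x
    using h by (intro measure_pmf.integrable_const_bound[where B = 1]) auto
  have i3: "integrable (measure_pmf p) (\<lambda>x. measure_pmf.expectation q (\<lambda>y. h (x, y)))"
  proof (intro measure_pmf.integrable_const_bound[where B = 1] AE_I2)
    fix x
    have "norm (measure_pmf.expectation q (\<lambda>y. h (x, y))) \<le> measure_pmf.expectation q (\<lambda>y. norm (h (x, y)))"
      by (rule integral_norm_bound)
    also have "\<dots> \<le> measure_pmf.expectation q (\<lambda>_. 1)"
      using h i2 by (intro integral_mono) auto
    finally show "norm (measure_pmf.expectation q (\<lambda>y. h (x, y))) \<le> 1" by simp
  qed simp
  have "\<bar>Re (h z)\<bar> \<le> 1" "\<bar>Im (h z)\<bar> \<le> 1" for z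
    using h[of z] abs_Re_le_cmod[of "h z"] abs_Im_le_cmod[of "h z"] by linarith+
  then have "measure_pmf.expectation (pair_pmf p q) h =
     measure_pmf.expectation p (\<lambda>x. measure_pmf.expectation q (\<lambda>y. h (x, y)))"
    using bind[of "\<lambda>z. Re (h z)"] bind[of "\<lambda>z. Im (h z)"] i1 i2 i3
    by (simp add: complex_eq_iff)
  then show ?thesis by (simp add: h_def)
qed

lemma char_sum_pmf:
  "measure_pmf.expectation (sum_pmf \<mu> n) (\<lambda>s. iexp (t * (real s - real n))) = char (step_law \<mu>) t ^ n"
proof (induction n)
  case 0
  then show ?case by (simp add: sum_pmf_0)
next
  case (Suc n)
  have "iexp (t * (real (x + s) - real (Suc n))) = iexp (t * (real x - 1)) * iexp (t * (real s - real n))"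
    for x s by (simp add: exp_add[symmetric] algebra_simps)
  then have "measure_pmf.expectation (sum_pmf \<mu> (Suc n)) (\<lambda>s. iexp (t * (real s - real (Suc n)))) =
    measure_pmf.expectation (pair_pmf \<mu> (sum_pmf \<mu> n)) (\<lambda>(x, s). iexp (t * (real x - 1)) * iexp (t * (real s - real n)))"
    by (simp add: sum_pmf_Suc case_prod_unfold del: of_nat_Suc of_nat_add)
  also have "\<dots> = measure_pmf.expectation \<mu> (\<lambda>x. iexp (t * (real x - 1))) *
      measure_pmf.expectation (sum_pmf \<mu> n) (\<lambda>s. iexp (t * (real s - real n)))"
    by (rule integral_pair_pmf_times) auto
  also have "\<dots> = char (step_law \<mu>) t * char (step_law \<mu>) t ^ n"
    unfolding Suc char_step_law ..
  finally show ?case by simp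
qed

lemma indep_coordinates:
  "prob_space.indep_vars (PiM UNIV (\<lambda>_ :: nat. measure_pmf \<mu>)) (\<lambda>_. measure_pmf \<mu>) (\<lambda>i \<omega>. \<omega> i) UNIV"
proof -
  interpret product_prob_space "\<lambda>_ :: nat. measure_pmf \<mu>" UNIV ..
  have "distr (PiM UNIV (\<lambda>_ :: nat. measure_pmf \<mu>)) (PiM UNIV (\<lambda>_ :: nat. measure_pmf \<mu>)) (\<lambda>x. \<lambda>i\<in>UNIV. x i) =
     distr (PiM UNIV (\<lambda>_ :: nat. measure_pmf \<mu>)) (PiM UNIV (\<lambda>_ :: nat. measure_pmf \<mu>)) (\<lambda>x. x)"
    by (simp add: restrict_UNIV)
  moreover have "distr (PiM UNIV (\<lambda>_ :: nat. measure_pmf \<mu>)) (measure_pmf \<mu>) (\<lambda>x. x i) = measure_pmf \<mu>" for i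
    using PiM_component[of i] by simp
  ultimately show ?thesis
    by (subst indep_vars_iff_distr_eq_PiM) auto
qed

text \<open>Both laws have the characteristic function
  \<open>char (step_law \<mu>) (t / B n) ^ n\<close>; Levy uniqueness moves the problem from the
  infinite product space to a \<open>pmf\<close>.\<close>

lemma rescaled_sum_law_eq:
  "rescaled_sum_law \<mu> B n = distr (measure_pmf (sum_pmf \<mu> n)) borel (\<lambda>s. (real s - real n) / B n)"
  (is "_ = ?R")
proof -
  let ?M = "PiM UNIV (\<lambda>_ :: nat. measure_pmf \<mu>)"
  interpret prob_space ?M by (intro prob_space_PiM measure_pmf.prob_space_axioms)
  let ?f = "\<lambda>\<xi> :: nat \<Rightarrow> nat. ((\<Sum>i = 1..n. real (\<xi> i)) - real n) / B n"
  have f_eq: "?f \<xi> = (\<Sum>i = 1..n. (real (\<xi> i) - 1) / B n)" for \<xi>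
    by (simp add: sum_subtractf flip: sum_divide_distrib)
  have meas: "(\<lambda>\<xi> :: nat \<Rightarrow> nat. (real (\<xi> i) - 1) / B n) \<in> borel_measurable ?M" for i
    by (rule measurable_compose[of "\<lambda>\<xi>. \<xi> i" ?M "measure_pmf \<mu>"]) auto
  have fm: "?f \<in> borel_measurable ?M" unfolding f_eq using meas by auto
  interpret L: prob_space "rescaled_sum_law \<mu> B n"
    unfolding rescaled_sum_law_def by (rule prob_space_distr[OF fm])
  have L: "real_distribution (rescaled_sum_law \<mu> B n)"
    by standard (auto simp: rescaled_sum_law_def)
  interpret R: prob_space ?R by (intro measure_pmf.prob_space_distr) auto
  have R: "real_distribution ?R" by standard auto
  have coord: "distr ?M (measure_pmf \<mu>) (\<lambda>\<xi>. \<xi> i) = measure_pmf \<mu>" for i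
  proof -
    interpret product_prob_space "\<lambda>_ :: nat. measure_pmf \<mu>" UNIV ..
    show ?thesis using PiM_component[of i] by simp
  qed
  have "char (rescaled_sum_law \<mu> B n) t = char ?R t" for t
  proof -
    have "indep_vars (\<lambda>_. borel) (\<lambda>i \<omega>. (real (\<omega> i) - 1) / B n) {1..n}"
      using indep_vars_subset[OF indep_vars_compose2[OF indep_coordinates, of "\<lambda>_ k. (real k - 1) / B n" "\<lambda>_. borel"]]
      by simp
    then have "char (rescaled_sum_law \<mu> B n) t = (\<Prod>i\<in>{1..n}. char (distr ?M borel (\<lambda>\<omega>. (real (\<omega> i) - 1) / B n)) t)"
      unfolding rescaled_sum_law_def f_eq by (rule char_distr_sum)
    also have "\<dots> = (\<Prod>i\<in>{1..n}. char (step_law \<mu>) (t / B n))"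
    proof (intro prod.cong refl)
      fix i
      have "char (distr ?M borel (\<lambda>\<omega>. (real (\<omega> i) - 1) / B n)) t =
          (CLINT \<omega>|?M. iexp (t * ((real (\<omega> i) - 1) / B n)))"
        unfolding char_def using meas by (subst integral_distr) auto
      also have "\<dots> = (CLINT k|distr ?M (measure_pmf \<mu>) (\<lambda>\<xi>. \<xi> i). iexp (t * ((real k - 1) / B n)))"
        by (subst integral_distr) auto
      finally show "char (distr ?M borel (\<lambda>\<omega>. (real (\<omega> i) - 1) / B n)) t = char (step_law \<mu>) (t / B n)"
        by (simp add: coord char_step_law)
    qed
    also have "\<dots> = char (step_law \<mu>) (t / B n) ^ n" by simp
    also have "\<dots> = char ?R t"
      by (subst char_sum_pmf[symmetric], subst char_def, subst integral_distr) auto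
    finally show ?thesis .
  qed
  then show ?thesis by (intro Levy_uniqueness L R ext)
qed

lemma char_rescaled_sum_law: "char (rescaled_sum_law \<mu> B n) t = char (step_law \<mu>) (t / B n) ^ n"
  unfolding rescaled_sum_law_eq
  by (subst char_sum_pmf[symmetric], subst char_def, subst integral_distr) auto

lemma real_distribution_rescaled: "real_distribution (rescaled_sum_law \<mu> B n)"
proof -
  interpret R: prob_space "rescaled_sum_law \<mu> B n"
    unfolding rescaled_sum_law_eq by (intro measure_pmf.prob_space_distr) auto
  show ?thesis by standard (auto simp: rescaled_sum_law_eq)
qed

lemma integral_rescaled:
  fixes f :: "real \<Rightarrow> real"
  assumes [measurable]: "f \<in> borel_measurable borel"
  shows "integral\<^sup>L (rescaled_sum_law \<mu> B n) f =
    measure_pmf.expectation (sum_pmf \<mu> n) (\<lambda>s. f ((real s - real n) / B n))"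
  unfolding rescaled_sum_law_eq by (subst integral_distr) auto

section \<open>Aperiodicity and Fourier inversion\<close>

lemma cnj_char: "cnj (char M t) = char M (- t)"
proof -
  have "cnj (char M t) = (CLINT x|M. cnj (iexp (t * x)))" unfolding char_def by (rule Bochner_Integration.integral_cnj[symmetric])
  also have "\<dots> = char M (- t)" unfolding char_def
    by (intro Bochner_Integration.integral_cong) (simp_all add: exp_cnj)
  finally show ?thesis .
qed

lemma norm_char_minus: "norm (char M (- t)) = norm (char M t)"
  by (metis cnj_char complex_mod_cnj)

text \<open>With \<open>u = char M t\<close>, the variable \<open>Re (cnj u * iexp (t * x))\<close>
  is at most 1 and has mean 1, so it equals 1 almost surely.\<close>

lemma (in real_distribution) AE_iexp_of_norm_char_1:
  assumes "norm (char M t) = 1"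
  shows "AE x in M. iexp (t * x) = char M t"
proof -
  define u where "u = char M t"
  have u: "norm u = 1" using assms by (simp add: u_def)
  define g where "g = (\<lambda>x. cnj u * iexp (t * x))"
  have norm_g: "norm (g x) = 1" for x by (simp add: g_def norm_mult u)
  have int: "integrable M g"
    by (rule integrable_const_bound[where B = 1]) (auto simp: norm_g, simp add: g_def)
  have le: "Re (g x) \<le> 1" for x using complex_Re_le_cmod[of "g x"] by (simp add: norm_g)
  have "(\<integral>x. 1 - Re (g x) \<partial>M) = 1 - Re (\<integral>x. g x \<partial>M)"
    using int prob_space by (subst Bochner_Integration.integral_diff) auto
  also have "(\<integral>x. g x \<partial>M) = cnj u * u" by (simp add: u_def g_def char_def)
  also have "cnj u * u = 1" using u complex_norm_square[of u] by (simp add: mult.commute)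
  finally have "(\<integral>x. 1 - Re (g x) \<partial>M) = 0" by simp
  moreover have "integrable M (\<lambda>x. 1 - Re (g x))"
    using int by (intro Bochner_Integration.integrable_diff integrable_Re) auto
  ultimately have "AE x in M. 1 - Re (g x) = 0"
    using le by (subst (asm) integral_nonneg_eq_0_iff_AE) auto
  then show ?thesis
  proof eventually_elim
    case (elim x)
    have "(Re (g x))\<^sup>2 + (Im (g x))\<^sup>2 = 1" using norm_g[of x] by (simp add: cmod_def)
    then have "g x = 1" using elim by (simp add: complex_eq_iff)
    have "iexp (t * x) = (u * cnj u) * iexp (t * x)" using u complex_norm_square[of u] by simp
    also have "\<dots> = u * g x" unfolding g_def by (rule mult.assoc)
    finally show ?case using \<open>g x = 1\<close> by (simp add: u_def)
  qed
qed

text \<open>If the modulus were 1, all \<open>iexp (t * k)\<close> on the support would coincide,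
  with value 1 as 0 is in the support. The integers \<open>z\<close> with \<open>t * z\<close> a
  multiple of \<open>2 * pi\<close> form a group, which would then contain 1, against
  \<open>t \<noteq> 0\<close> and \<open>\<bar>t\<bar> \<le> pi\<close>.\<close>

lemma norm_char_step_law_less_1:
  assumes "pmf \<mu> 0 > 0" "group_closure (int ` set_pmf \<mu>) = UNIV" "t \<noteq> 0" "\<bar>t\<bar> \<le> pi"
  shows "norm (char (step_law \<mu>) t) < 1"
proof (rule ccontr)
  assume not_less: "\<not> norm (char (step_law \<mu>) t) < 1"
  interpret real_distribution "step_law \<mu>" by (rule real_distribution_step_law)
  have "norm (char (step_law \<mu>) t) = 1" using not_less cmod_char_le_1[of t] by simp
  from AE_iexp_of_norm_char_1[OF this]
  have "AE k in measure_pmf \<mu>. iexp (t * (real k - 1)) = char (step_law \<mu>) t"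
    unfolding step_law_def by (subst (asm) AE_distr_iff) auto
  then have u: "iexp (t * (real k - 1)) = char (step_law \<mu>) t" if "k \<in> set_pmf \<mu>" for k
    using that by (simp only: AE_measure_pmf_iff)
  have one': "iexp (t * real k) = 1" if "k \<in> set_pmf \<mu>" for k
  proof -
    have "0 \<in> set_pmf \<mu>" using assms(1) by (simp add: set_pmf_iff)
    from u[OF this] u[OF that] have "iexp (t * (real k - 1)) = iexp (- t)" by simp
    then have "iexp (t * (real k - 1)) * iexp t = iexp (- t) * iexp t" by (simp only:)
    then show ?thesis by (simp add: exp_add[symmetric] algebra_simps)
  qed
  have "\<exists>m :: int. t * of_int z = of_int (2 * m) * pi" if "z \<in> group_closure (int ` set_pmf \<mu>)" for z
    using that
  proof induction
    case (base s)
    then consider "s = 0" | k where "s = int k" "k \<in> set_pmf \<mu>" by auto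
    then show ?case
    proof cases
      case 1
      then show ?thesis by (intro exI[of _ 0]) simp
    next
      case 2
      then show ?thesis using one'[OF 2(2)] by (auto simp: exp_eq_1)
    qed
  next
    case (diff s z)
    then obtain m n :: int where "t * of_int s = of_int (2 * m) * pi" "t * of_int z = of_int (2 * n) * pi" by blast
    then show ?case by (intro exI[of _ "m - n"]) (simp add: algebra_simps)
  qed
  from this[of 1] assms(2) obtain m :: int where m: "t = of_int (2 * m) * pi" by auto
  then have "\<bar>of_int (2 * m)\<bar> * pi \<le> 1 * pi" using assms(4) by (simp add: abs_mult)
  then have "\<bar>of_int (2 * m) :: real\<bar> \<le> 1" by (simp only: mult_le_cancel_right_pos pi_gt_zero)
  then have "m = 0" by linarith
  with m assms(3) show False by simp
qed

lemma integral_iexp_period: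
  "(CLINT t|lborel. indicator {- pi..pi} t *\<^sub>R iexp (t * of_int j)) = (if j = 0 then 2 * pi else 0)"
proof (cases "j = 0")
  case True
  have "(CLINT t|lborel. indicator {- pi..pi} t *\<^sub>R iexp (t * of_int j)) = complex_of_real pi - complex_of_real (- pi)"
    using True by (intro integral_FTC_atLeastAtMost)
      (auto intro!: derivative_eq_intros continuous_intros simp: has_vector_derivative_of_real)
  then show ?thesis using True by simp
next
  case False
  have "(CLINT t|lborel. indicator {- pi..pi} t *\<^sub>R iexp (t * of_int j)) =
     iexp (pi * of_int j) / (\<i> * of_int j) - iexp (- pi * of_int j) / (\<i> * of_int j)"
  proof (intro integral_FTC_atLeastAtMost)
    show "((\<lambda>t. iexp (t * of_int j) / (\<i> * of_int j)) has_vector_derivative iexp (t * of_int j)) (at t within {- pi..pi})" for t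
    proof -
      define c where "c = \<i> * complex_of_int j"
      have "c \<noteq> 0" using False by (simp add: c_def)
      then have "((\<lambda>z. exp (z * c) / c) has_field_derivative exp (of_real t * c)) (at (complex_of_real t))"
        by (auto intro!: derivative_eq_intros)
      from has_vector_derivative_real_field[OF this] show ?thesis
        by (simp add: o_def c_def mult.left_commute)
    qed
  qed (auto intro!: continuous_intros)
  also have "iexp (pi * of_int j) = iexp (- pi * of_int j)"
  proof -
    have "\<i> * complex_of_real (pi * of_int j) =
        \<i> * complex_of_real (- pi * of_int j) + of_int (2 * j) * pi * \<i>"
      by (simp add: algebra_simps)
    then have "iexp (pi * of_int j) = iexp (- pi * of_int j) * exp (of_int (2 * j) * pi * \<i>)"
      by (simp only: exp_add)
    moreover have "exp (of_int (2 * j) * pi * \<i>) = 1" unfolding exp_eq_1 by auto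
    ultimately show ?thesis by (simp only: mult_1_right)
  qed
  finally show ?thesis using False by simp
qed

lemma sum_pmf_inversion:
  "complex_of_real (2 * pi * pmf (sum_pmf \<mu> n) z) =
    (CLINT t|lborel. indicator {- pi..pi} t *\<^sub>R (iexp (- t * (real z - real n)) * char (step_law \<mu>) t ^ n))"
proof -
  let ?P = "measure_pmf (sum_pmf \<mu> n)"
  interpret pair_sigma_finite ?P lborel ..
  define f :: "nat \<times> real \<Rightarrow> complex" where "f = (\<lambda>(s, t). indicator {- pi..pi} t *\<^sub>R iexp (t * (real s - real z)))"
  have meas: "f \<in> borel_measurable (?P \<Otimes>\<^sub>M lborel)"
  proof -
    have "f \<in> borel_measurable (count_space UNIV \<Otimes>\<^sub>M lborel)"
      by (rule measurable_pair_measure_countable1) (auto simp: f_def)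
    moreover have "sets (?P \<Otimes>\<^sub>M lborel) = sets (count_space UNIV \<Otimes>\<^sub>M lborel)"
      by (intro sets_pair_measure_cong) auto
    ultimately show ?thesis by (simp cong: measurable_cong_sets)
  qed
  have int: "integrable (?P \<Otimes>\<^sub>M lborel) f"
  proof (rule Fubini_integrable[OF meas])
    have "(\<integral>t. norm (f (s, t)) \<partial>lborel) = 2 * pi" for s
    proof -
      have "(\<integral>t. norm (f (s, t)) \<partial>lborel) = (\<integral>t. indicator {- pi..pi} t \<partial>lborel)"
        by (intro Bochner_Integration.integral_cong) (auto simp: f_def indicator_def)
      then show ?thesis by simp
    qed
    then show "integrable ?P (\<lambda>s. \<integral>t. norm (f (s, t)) \<partial>lborel)" by simp
    show "AE s in ?P. integrable lborel (\<lambda>t. f (s, t))"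
      by (intro AE_I2) (auto simp: f_def intro!: integrable_mult_indicator[OF _ ] borel_integrable_compact
          [where S = "{- pi..pi}", simplified] continuous_intros)
  qed
  have "(CLINT s|?P. CLINT t|lborel. f (s, t)) = (CLINT t|lborel. CLINT s|?P. f (s, t))"
    using Fubini_integral[of "\<lambda>s t. f (s, t)"] int by simp
  moreover have "(CLINT s|?P. CLINT t|lborel. f (s, t)) = (CLINT s|?P. complex_of_real (2 * pi * indicator {z} s))"
  proof (intro Bochner_Integration.integral_cong refl)
    fix s :: nat
    show "(CLINT t|lborel. f (s, t)) = complex_of_real (2 * pi * indicator {z} s)"
      using integral_iexp_period[of "int s - int z"] by (simp add: f_def indicator_def)
  qed
  moreover have "\<dots> = complex_of_real (2 * pi * pmf (sum_pmf \<mu> n) z)"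
    by (subst integral_complex_of_real) (simp add: measure_pmf_single)
  moreover have "(CLINT s|?P. f (s, t)) =
      indicator {- pi..pi} t *\<^sub>R (iexp (- t * (real z - real n)) * char (step_law \<mu>) t ^ n)" for t
  proof -
    have "(CLINT s|?P. f (s, t)) =
       (CLINT s|?P. indicator {- pi..pi} t *\<^sub>R (iexp (- t * (real z - real n)) * iexp (t * (real s - real n))))"
      by (intro Bochner_Integration.integral_cong refl) (simp add: f_def exp_add[symmetric] algebra_simps)
    also have "\<dots> = indicator {- pi..pi} t *\<^sub>R (iexp (- t * (real z - real n)) * char (step_law \<mu>) t ^ n)"
      unfolding char_sum_pmf[symmetric] by simp
    finally show ?thesis .
  qed
  ultimately show ?thesis by simp
qed

subsection \<open>The domain of attraction\<close>

text \<open>The hypothesis says that \<open>X\<close> has the law of \<open>l * (X + X')\<close>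
  with an independent copy \<open>X'\<close>. Comparing Laplace transforms at 1 gives
  \<open>exp 1 = exp (2 * l powr \<alpha>)\<close>.\<close>

lemma sub_stable_scale:
  assumes st: "stable_law \<alpha> \<nu>" and "0 < \<alpha>" "0 \<le> l"
    and char: "\<And>t. char \<nu> t = (char \<nu> (l * t))\<^sup>2"
  shows "2 * l powr \<alpha> = 1"
proof -
  interpret real_distribution \<nu> using st by (simp add: stable_law_def)
  interpret P: pair_prob_space \<nu> \<nu> ..
  let ?M = "distr (\<nu> \<Otimes>\<^sub>M \<nu>) borel (\<lambda>(x, y). l * (x + y))"
  have [measurable]: "(\<lambda>(x, y). l * (x + y)) \<in> borel_measurable (\<nu> \<Otimes>\<^sub>M \<nu>)" by measurable
  interpret M: prob_space ?M by (rule P.prob_space_distr) measurable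
  have M: "real_distribution ?M" by standard auto
  have "char ?M t = char \<nu> t" for t
  proof -
    have "char ?M t = (CLINT z|\<nu> \<Otimes>\<^sub>M \<nu>. iexp (l * t * fst z) * iexp (l * t * snd z))"
      unfolding char_def by (subst integral_distr)
        (auto simp: exp_add[symmetric] algebra_simps split_beta intro!: Bochner_Integration.integral_cong)
    also have "\<dots> = (CLINT x|\<nu>. CLINT y|\<nu>. iexp (l * t * x) * iexp (l * t * y))"
    proof -
      have "integrable (\<nu> \<Otimes>\<^sub>M \<nu>) (\<lambda>z. iexp (l * t * fst z) * iexp (l * t * snd z))"
        by (rule P.integrable_const_bound[where B = 1]) (auto simp: norm_mult)
      from P.integral_fst'[OF this] show ?thesis by simp
    qed
    also have "\<dots> = (char \<nu> (l * t))\<^sup>2" by (simp add: char_def power2_eq_square)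
    finally show ?thesis by (simp add: char[of t])
  qed
  then have MM: "?M = \<nu>" using M by (intro Levy_uniqueness ext) (auto simp: real_distribution_axioms)
  have lap: "(\<integral>\<^sup>+x. ennreal (exp (- k * x)) \<partial>\<nu>) = ennreal (exp (k powr \<alpha>))" if "k \<ge> 0" for k
    using st that unfolding stable_law_def
    by (subst nn_integral_eq_integral) (auto simp: has_bochner_integral_iff)
  have "ennreal (exp 1) = (\<integral>\<^sup>+x. ennreal (exp (- 1 * x)) \<partial>\<nu>)" using lap[of 1] by simp
  also have "\<dots> = (\<integral>\<^sup>+x. ennreal (exp (- 1 * x)) \<partial>?M)" by (simp add: MM)
  also have "\<dots> = (\<integral>\<^sup>+z. ennreal (exp (- l * fst z)) * ennreal (exp (- l * snd z)) \<partial>(\<nu> \<Otimes>\<^sub>M \<nu>))"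
  proof (subst nn_integral_distr)
    have "exp (- 1 * (l * (x + y))) = exp (- l * x) * exp (- l * y)" for x y :: real
      by (simp add: exp_add[symmetric] algebra_simps)
    then have "ennreal (exp (- 1 * (l * (x + y)))) = ennreal (exp (- l * x)) * ennreal (exp (- l * y))" for x y :: real
      by (simp only: ennreal_mult exp_ge_zero)
    then show "(\<integral>\<^sup>+z. ennreal (exp (- 1 * (case z of (x, y) \<Rightarrow> l * (x + y)))) \<partial>(\<nu> \<Otimes>\<^sub>M \<nu>)) =
      (\<integral>\<^sup>+z. ennreal (exp (- l * fst z)) * ennreal (exp (- l * snd z)) \<partial>(\<nu> \<Otimes>\<^sub>M \<nu>))"
      by (simp only: split_beta)
  qed auto
  also have "\<dots> = (\<integral>\<^sup>+x. \<integral>\<^sup>+y. ennreal (exp (- l * x)) * ennreal (exp (- l * y)) \<partial>\<nu> \<partial>\<nu>)"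
  proof -
    have "(\<lambda>z. ennreal (exp (- l * fst z)) * ennreal (exp (- l * snd z))) \<in> borel_measurable (\<nu> \<Otimes>\<^sub>M \<nu>)"
      by measurable
    from nn_integral_fst[OF this] show ?thesis by simp
  qed
  also have "\<dots> = ennreal (exp (l powr \<alpha>)) * ennreal (exp (l powr \<alpha>))"
    using lap[OF \<open>0 \<le> l\<close>] by (simp add: nn_integral_cmult nn_integral_multc)
  also have "\<dots> = ennreal (exp (l powr \<alpha>) * exp (l powr \<alpha>))"
    by (rule ennreal_mult[symmetric]) auto
  also have "exp (l powr \<alpha>) * exp (l powr \<alpha>) = exp (2 * l powr \<alpha>)"
    by (simp only: mult_2 exp_add)
  finally have "exp 1 = exp (2 * l powr \<alpha>)" by (subst (asm) ennreal_inj) auto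
  then show ?thesis by simp
qed

section \<open>Test functions and divergence of the scaling\<close>

text \<open>A tent on \<open>{0..b}\<close>, continuous and bounded so that weak convergence
  applies. Composed with multiplication by \<sigma> = 1 or - 1 it tests one side of the
  origin.\<close>

definition bump :: "real \<Rightarrow> real \<Rightarrow> real" where
  "bump b x = max 0 (min x (b - x))"

lemma bump_bounds: "0 \<le> bump b x" "b \<ge> 0 \<Longrightarrow> bump b x \<le> b" "\<not> (0 < x \<and> x < b) \<Longrightarrow> bump b x = 0"
  by (auto simp: bump_def)

lemma bump_continuous: "isCont (\<lambda>x. bump b (\<sigma> * x)) x"
  unfolding bump_def by (intro continuous_intros)

lemma bump_measurable [measurable]: "bump b \<in> borel_measurable borel"
  unfolding bump_def by measurable

lemma ex_bump_pos:
  assumes "real_distribution \<nu>" "measure \<nu> {x. 0 < \<sigma> * x} > 0"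
  shows "\<exists>b>0. (\<integral>x. bump b (\<sigma> * x) \<partial>\<nu>) > 0"
proof (rule ccontr)
  interpret real_distribution \<nu> by fact
  assume *: "\<not> ?thesis"
  have int: "integrable \<nu> (\<lambda>x. bump b (\<sigma> * x))" if "b > 0" for b
    using bump_bounds that by (intro integrable_const_bound[where B = b]) (auto simp: less_imp_le)
  have "AE x in \<nu>. \<forall>k :: nat. bump (real (Suc k)) (\<sigma> * x) = 0"
  proof (subst AE_all_countable, intro allI)
    fix k :: nat
    have "(\<integral>x. bump (real (Suc k)) (\<sigma> * x) \<partial>\<nu>) = 0"
    proof (rule antisym)
      have "\<not> (\<integral>x. bump (real (Suc k)) (\<sigma> * x) \<partial>\<nu>) > 0"
        using * by (metis of_nat_0_less_iff zero_less_Suc)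
      then show "(\<integral>x. bump (real (Suc k)) (\<sigma> * x) \<partial>\<nu>) \<le> 0" by simp
    qed (auto simp: bump_bounds intro!: integral_nonneg_AE AE_I2)
    then show "AE x in \<nu>. bump (real (Suc k)) (\<sigma> * x) = 0"
      by (subst (asm) integral_nonneg_eq_0_iff_AE[OF int]) (auto simp: bump_bounds)
  qed
  then have "AE x in \<nu>. \<not> 0 < \<sigma> * x"
  proof eventually_elim
    case (elim x)
    show ?case
    proof
      assume "0 < \<sigma> * x"
      obtain k :: nat where "\<sigma> * x < real k" using reals_Archimedean2 by blast
      then have "bump (real (Suc k)) (\<sigma> * x) > 0" using \<open>0 < \<sigma> * x\<close> by (simp add: bump_def)
      then show False using elim by simp
    qed
  qed
  then have "measure \<nu> {x. 0 < \<sigma> * x} = 0"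
    using prob_eq_0[of "{x. 0 < \<sigma> * x}"] by simp
  with assms(2) show False by simp
qed

text \<open>The tent is at most \<open>b\<close> and vanishes except at no more than
  \<open>b * \<bar>\<beta>\<bar>\<close> integers. They lie on one side of \<open>n\<close>, so the
  distance to \<open>n\<close> counts them; a negative \<beta> selects the left side.\<close>

lemma expectation_bump_le:
  assumes M: "\<And>z. 0 < (real z - real n) / \<beta> \<Longrightarrow> (real z - real n) / \<beta> < b \<Longrightarrow> pmf (sum_pmf \<mu> n) z \<le> M"
    and "b > 0" "M \<ge> 0"
  shows "measure_pmf.expectation (sum_pmf \<mu> n) (\<lambda>s. bump b ((real s - real n) / \<beta>)) \<le> b * (b * \<bar>\<beta>\<bar>) * M"
proof (cases "\<beta> = 0")
  case True
  then show ?thesis by (simp add: bump_def)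
next
  case False
  define Z where "Z = {z :: nat. 0 < (real z - real n) / \<beta> \<and> (real z - real n) / \<beta> < b}"
  define h where "h z = nat \<bar>int z - int n\<bar>" for z
  have img: "h ` Z \<subseteq> {1..nat \<lfloor>b * \<bar>\<beta>\<bar>\<rfloor>}"
  proof
    fix j assume "j \<in> h ` Z"
    then obtain z where z: "z \<in> Z" "j = h z" by auto
    have ne: "z \<noteq> n" using z by (auto simp: Z_def)
    have "\<bar>real z - real n\<bar> / \<bar>\<beta>\<bar> < b" using z by (simp add: Z_def flip: abs_divide)
    then have "\<bar>real z - real n\<bar> < b * \<bar>\<beta>\<bar>" using False by (simp add: field_simps)
    moreover have "real_of_int \<bar>int z - int n\<bar> = \<bar>real z - real n\<bar>" by simp
    ultimately have "\<bar>int z - int n\<bar> \<le> \<lfloor>b * \<bar>\<beta>\<bar>\<rfloor>" by (simp only: le_floor_iff)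
    then show "j \<in> {1..nat \<lfloor>b * \<bar>\<beta>\<bar>\<rfloor>}" using ne z by (auto simp: h_def)
  qed
  have inj: "inj_on h Z"
  proof (rule inj_onI)
    fix y z assume yz: "y \<in> Z" "z \<in> Z" "h y = h z"
    have "(y > n \<and> z > n) \<or> (y < n \<and> z < n)"
      using yz by (cases "\<beta> > 0") (auto simp: Z_def zero_less_divide_iff)
    then show "y = z" using yz(3) by (auto simp: h_def)
  qed
  have fin: "finite Z" using finite_imageD[OF finite_subset[OF img] inj] by simp
  have "card Z \<le> card {1..nat \<lfloor>b * \<bar>\<beta>\<bar>\<rfloor>}" by (rule card_inj_on_le[OF inj img]) simp
  then have "card Z \<le> nat \<lfloor>b * \<bar>\<beta>\<bar>\<rfloor>" by simp
  then have card: "real (card Z) \<le> b * \<bar>\<beta>\<bar>"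
    using \<open>b > 0\<close> by (simp add: nat_le_iff le_nat_iff le_floor_iff)
  have "measure_pmf.expectation (sum_pmf \<mu> n) (\<lambda>s. bump b ((real s - real n) / \<beta>)) \<le>
     measure_pmf.expectation (sum_pmf \<mu> n) (\<lambda>s. b * indicator Z s)"
    using bump_bounds(1,2)[of b] bump_bounds(3)[of _ b] \<open>b > 0\<close>
    by (intro integral_mono measure_pmf.integrable_const_bound[where B = b]) (auto simp: Z_def indicator_def)
  also have "\<dots> = b * measure_pmf.prob (sum_pmf \<mu> n) Z" by simp
  also have "measure_pmf.prob (sum_pmf \<mu> n) Z = (\<Sum>z\<in>Z. pmf (sum_pmf \<mu> n) z)"
    using fin by (rule measure_measure_pmf_finite)
  also have "b * \<dots> \<le> b * (\<Sum>z\<in>Z. M)" using M \<open>b > 0\<close> by (intro mult_left_mono sum_mono) (auto simp: Z_def)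
  also have "\<dots> = b * (real (card Z) * M)" by simp
  also have "\<dots> \<le> b * ((b * \<bar>\<beta>\<bar>) * M)" using card \<open>b > 0\<close> \<open>M \<ge> 0\<close> by (intro mult_left_mono mult_right_mono) auto
  finally show ?thesis by (simp add: mult.assoc)
qed

lemma tendsto_less_eventually:
  fixes f g :: "nat \<Rightarrow> real"
  assumes "f \<longlonglongrightarrow> a" "g \<longlonglongrightarrow> b" "a < b"
  shows "eventually (\<lambda>n. f n < g n) sequentially"
proof -
  obtain c where "a < c" "c < b" using dense[OF assms(3)] by blast
  with order_tendstoD(2)[OF assms(1)] order_tendstoD(1)[OF assms(2)]
  have "eventually (\<lambda>n. f n < c) sequentially" "eventually (\<lambda>n. c < g n) sequentially" by auto
  then show ?thesis by eventually_elim simp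
qed

locale stable_domain =
  fixes \<mu> :: "nat pmf" and \<alpha> :: real and B :: "nat \<Rightarrow> real" and \<nu> :: "real measure"
  assumes pmf_0: "pmf \<mu> 0 > 0"
    and aperiodic: "group_closure (int ` set_pmf \<mu>) = UNIV"
    and \<alpha>: "1 < \<alpha>"
    and B_mono: "mono_on {1..} B"
    and stable: "stable_law \<alpha> \<nu>"
    and conv: "weak_conv_m (rescaled_sum_law \<mu> B) \<nu>"
begin

sublocale real_distribution \<nu> using stable by (simp add: stable_law_def)

sublocale step: real_distribution "step_law \<mu>" by (rule real_distribution_step_law)

abbreviation \<phi> where "\<phi> \<equiv> char (step_law \<mu>)"

text \<open>Moving arguments and subsequences replace locally uniform convergence. In Skorohod's
  representation the exponentials converge pointwise.\<close>

lemma char_limit: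
  assumes r: "strict_mono r" and t: "t \<longlonglongrightarrow> t0"
  shows "(\<lambda>k. \<phi> (t k / B (r k)) ^ r k) \<longlonglongrightarrow> char \<nu> t0"
proof -
  have "weak_conv_m (\<lambda>k. rescaled_sum_law \<mu> B (r k)) \<nu>"
    using conv LIMSEQ_subseq_LIMSEQ[OF _ r] unfolding weak_conv_m_def weak_conv_def by (auto simp: o_def)
  from Skorohod[OF real_distribution_rescaled real_distribution_axioms this]
  obtain \<Omega> :: "real measure" and Ys Y where \<Omega>: "prob_space \<Omega>" and Ys: "\<And>n. Ys n \<in> measurable \<Omega> borel"
    "\<And>n. distr \<Omega> borel (Ys n) = rescaled_sum_law \<mu> B (r n)" and Y: "Y \<in> measurable \<Omega> lborel"
    "distr \<Omega> borel Y = \<nu>" and lim: "\<And>x. x \<in> space \<Omega> \<Longrightarrow> (\<lambda>n. Ys n x) \<longlonglongrightarrow> Y x"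
    by blast
  interpret \<Omega>: prob_space \<Omega> by fact
  note [measurable] = Ys(1)
  have [measurable]: "Y \<in> borel_measurable \<Omega>" using Y(1) by simp
  have "(\<lambda>k. CLINT x|\<Omega>. iexp (t k * Ys k x)) \<longlonglongrightarrow> (CLINT x|\<Omega>. iexp (t0 * Y x))"
  proof (rule integral_dominated_convergence[where w = "\<lambda>_. 1"])
    show "AE x in \<Omega>. (\<lambda>k. iexp (t k * Ys k x)) \<longlonglongrightarrow> iexp (t0 * Y x)"
      using lim t by (intro AE_I2 tendsto_intros) auto
  qed auto
  moreover have "(CLINT x|\<Omega>. iexp (t k * Ys k x)) = \<phi> (t k / B (r k)) ^ r k" for k
    by (subst char_rescaled_sum_law[symmetric], subst Ys(2)[symmetric], subst char_def, subst integral_distr)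
      auto
  moreover have "(CLINT x|\<Omega>. iexp (t0 * Y x)) = char \<nu> t0"
    unfolding char_def Y(2)[symmetric] by (subst integral_distr) auto
  ultimately show ?thesis by simp
qed

lemma norm_\<phi>_less_1: "t \<noteq> 0 \<Longrightarrow> \<bar>t\<bar> \<le> pi \<Longrightarrow> norm (\<phi> t) < 1"
  by (rule norm_char_step_law_less_1[OF pmf_0 aperiodic])

lemma ex_bump: "\<sigma> = 1 \<or> \<sigma> = - 1 \<Longrightarrow> \<exists>b>0. (\<integral>x. bump b (\<sigma> * x) \<partial>\<nu>) > 0"
  using stable_law_pos_neg[OF stable \<alpha>]
  by (intro ex_bump_pos real_distribution_axioms) (auto simp: greaterThan_def lessThan_def)

lemma bump_limit:
  assumes "b > 0"
  shows "(\<lambda>n. measure_pmf.expectation (sum_pmf \<mu> n) (\<lambda>s. bump b (\<sigma> * ((real s - real n) / B n))))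
     \<longlonglongrightarrow> (\<integral>x. bump b (\<sigma> * x) \<partial>\<nu>)"
proof -
  have "(\<lambda>n. integral\<^sup>L (rescaled_sum_law \<mu> B n) (\<lambda>x. bump b (\<sigma> * x))) \<longlonglongrightarrow> (\<integral>x. bump b (\<sigma> * x) \<partial>\<nu>)"
    using bump_bounds assms
    by (intro weak_conv_imp_integral_bdd_continuous_conv[where B = b] real_distribution_rescaled
        real_distribution_axioms conv bump_continuous) (auto simp: less_imp_le)
  then show ?thesis by (subst (asm) integral_rescaled) auto
qed

text \<open>The inversion formula with absolute values inside, a bound that does not depend on the
  point \<open>z\<close>.\<close>

definition pmf_bound :: "nat \<Rightarrow> real" where
  "pmf_bound n = (LINT t|lborel. indicator {- pi..pi} t * norm (\<phi> t) ^ n) / (2 * pi)"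

lemma pmf_sum_le: "pmf (sum_pmf \<mu> n) z \<le> pmf_bound n"
proof -
  have "2 * pi * pmf (sum_pmf \<mu> n) z = norm (complex_of_real (2 * pi * pmf (sum_pmf \<mu> n) z))"
    by (simp only: norm_of_real) (simp add: abs_mult)
  also have "\<dots> \<le> (LINT t|lborel. norm (indicator {- pi..pi} t *\<^sub>R (iexp (- t * (real z - real n)) * \<phi> t ^ n)))"
    unfolding sum_pmf_inversion by (rule integral_norm_bound)
  also have "\<dots> = (LINT t|lborel. indicator {- pi..pi} t * norm (\<phi> t) ^ n)"
    by (intro Bochner_Integration.integral_cong) (auto simp: norm_mult norm_power)
  finally show ?thesis by (simp add: pmf_bound_def field_simps)
qed

lemma pmf_bound_tendsto_0: "pmf_bound \<longlonglongrightarrow> 0"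
proof -
  have "(\<lambda>n. LINT t|lborel. indicator {- pi..pi} t * norm (\<phi> t) ^ n) \<longlonglongrightarrow> integral\<^sup>L (lborel :: real measure) (\<lambda>_. 0 :: real)"
  proof (rule integral_dominated_convergence[where w = "indicator {- pi..pi}"])
    have "AE t in lborel. t \<noteq> (0 :: real)" by (rule AE_lborel_singleton)
    then show "AE t in lborel. (\<lambda>n. indicator {- pi..pi} t * norm (\<phi> t) ^ n) \<longlonglongrightarrow> (0 :: real)"
    proof eventually_elim
      case (elim t)
      show ?case
      proof (cases "\<bar>t\<bar> \<le> pi")
        case True
        then have "(\<lambda>n. norm (\<phi> t) ^ n) \<longlonglongrightarrow> 0"
          using norm_\<phi>_less_1[OF elim] by (intro LIMSEQ_realpow_zero) auto
        then show ?thesis by (rule tendsto_mult_right_zero)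
      next
        case False
        then have "indicator {- pi..pi} t = (0 :: real)" by (auto simp: indicator_def)
        then show ?thesis by simp
      qed
    qed
    show "AE t in lborel. norm (indicator {- pi..pi} t * norm (\<phi> t) ^ n) \<le> indicator {- pi..pi} t" for n
      using step.cmod_char_le_1 by (intro AE_I2) (auto simp: indicator_def power_le_one)
  qed auto
  then show ?thesis unfolding pmf_bound_def[abs_def] by (intro tendsto_eq_intros) auto
qed

text \<open>Where \<open>B n\<close> stays bounded, the tent meets boundedly many points of
  vanishing mass, yet its expectation has a positive limit. So the modulus diverges, and
  monotonicity decides the sign.\<close>

lemma B_at_top: "filterlim B at_top sequentially"
proof -
  obtain b where b: "b > 0" "(\<integral>x. bump b (1 * x) \<partial>\<nu>) > 0" using ex_bump[of 1] by auto
  have big: "eventually (\<lambda>n. K < \<bar>B n\<bar>) sequentially" if "K > 0" for K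
  proof -
    have "(\<lambda>n. b * (b * K) * pmf_bound n) \<longlonglongrightarrow> b * (b * K) * 0"
      by (intro tendsto_intros pmf_bound_tendsto_0)
    then have "eventually (\<lambda>n. b * (b * K) * pmf_bound n <
       measure_pmf.expectation (sum_pmf \<mu> n) (\<lambda>s. bump b (1 * ((real s - real n) / B n)))) sequentially"
      using bump_limit[OF b(1), of 1] b(2) by (intro tendsto_less_eventually) auto
    then show ?thesis
    proof eventually_elim
      case (elim n)
      show ?case
      proof (rule ccontr)
        assume "\<not> K < \<bar>B n\<bar>"
        have M: "0 \<le> pmf_bound n" using pmf_sum_le[of n 0] pmf_nonneg[of "sum_pmf \<mu> n" 0] by linarith
        have "measure_pmf.expectation (sum_pmf \<mu> n) (\<lambda>s. bump b ((real s - real n) / B n)) \<le>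
           b * (b * \<bar>B n\<bar>) * pmf_bound n"
          using pmf_sum_le b M by (intro expectation_bump_le)
        also have "\<dots> \<le> b * (b * K) * pmf_bound n"
          using \<open>\<not> K < \<bar>B n\<bar>\<close> b M by (intro mult_right_mono mult_left_mono) auto
        finally show False using elim by simp
      qed
    qed
  qed
  show ?thesis unfolding filterlim_at_top
  proof
    fix Z
    have pos: "0 < max \<bar>Z\<bar> \<bar>B 1\<bar> + 1" by simp
    show "eventually (\<lambda>n. Z \<le> B n) sequentially"
      using big[OF pos] eventually_ge_at_top[of 1]
    proof eventually_elim
      case (elim n)
      have "B 1 \<le> B n" using B_mono elim(2) by (auto simp: mono_on_def)
      then show ?case using elim(1) by linarith
    qed
  qed
qed

end

section \<open>Doubling of the scaling sequence\<close>

text \<open>A Potter-type bound. Doubling \<open>l\<close> until \<open>N\<close> is passed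
  overshoots by at most one step, which accounts for the constant
  \<open>2 powr \<theta>\<close>.\<close>

lemma doubling_growth:
  fixes b :: "nat \<Rightarrow> real"
  assumes mono: "\<And>m n. st \<le> m \<Longrightarrow> m \<le> n \<Longrightarrow> b m \<le> b n"
    and dbl: "\<And>n. st \<le> n \<Longrightarrow> b (2 * n) \<le> 2 powr \<theta> * b n"
    and "\<theta> \<ge> 0" "st \<le> l" "0 < l" "l \<le> N" "b l \<ge> 0"
  shows "b N \<le> 2 powr \<theta> * (real N / real l) powr \<theta> * b l"
proof -
  have iter: "b (2 ^ k * l) \<le> (2 powr \<theta>) ^ k * b l" for k
  proof (induction k)
    case (Suc k)
    have "l \<le> 2 ^ k * l" by simp
    then have "b (2 * (2 ^ k * l)) \<le> 2 powr \<theta> * b (2 ^ k * l)" using assms by (intro dbl) linarith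
    also have "\<dots> \<le> 2 powr \<theta> * ((2 powr \<theta>) ^ k * b l)" using Suc by (intro mult_left_mono) auto
    finally show ?case by (simp add: mult.assoc)
  qed simp
  have "N div l > 0" using assms by (simp add: div_greater_zero_iff)
  then obtain k where k: "2 ^ k \<le> N div l" "N div l < 2 ^ Suc k" using ex_power_ivl1[of 2 "N div l"] by auto
  have "N < 2 ^ Suc k * l" using k(2) assms(5) by (simp add: div_less_iff_less_mult del: power_Suc)
  then have "b N \<le> b (2 ^ Suc k * l)" using assms by (intro mono) auto
  also have "\<dots> \<le> (2 powr \<theta>) ^ Suc k * b l" by (rule iter)
  also have "\<dots> = 2 powr \<theta> * (2 ^ k) powr \<theta> * b l"
    by (simp add: powr_realpow[symmetric] powr_powr mult.commute)
  also have "\<dots> \<le> 2 powr \<theta> * (real N / real l) powr \<theta> * b l"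
  proof (intro mult_right_mono mult_left_mono powr_mono2)
    have "2 ^ k * l \<le> N" using k(1) assms(5) by (simp add: less_eq_div_iff_mult_less_eq)
    then have "real (2 ^ k * l) \<le> real N" by (simp only: of_nat_le_iff)
    then show "2 ^ k \<le> real N / real l" using assms(5) by (simp add: field_simps)
  qed (use assms in auto)
  finally show ?thesis .
qed

context stable_domain
begin

lemma B_pos: "eventually (\<lambda>n. B n > 0) sequentially"
  using B_at_top unfolding filterlim_at_top_dense by blast

text \<open>A sum of \<open>2 * q k\<close> steps consists of two independent sums of
  \<open>q k\<close> steps; normalising these by \<open>B (2 * q k)\<close> instead of
  \<open>B (q k)\<close> rescales their limit by \<open>l\<close>.\<close>

lemma char_scale_of_limit:
  assumes q: "strict_mono q" and lim: "(\<lambda>k. B (q k) / B (2 * q k)) \<longlonglongrightarrow> l"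
  shows "char \<nu> t = (char \<nu> (l * t))\<^sup>2"
proof -
  have "strict_mono (\<lambda>k. 2 * q k)" using q by (auto simp: strict_mono_def)
  then have 1: "(\<lambda>k. \<phi> (t / B (2 * q k)) ^ (2 * q k)) \<longlonglongrightarrow> char \<nu> t"
    using char_limit[of "\<lambda>k. 2 * q k" "\<lambda>_. t" t] by simp
  have "(\<lambda>k. B (q k) / B (2 * q k) * t) \<longlonglongrightarrow> l * t" by (intro tendsto_intros lim)
  from char_limit[OF q this]
  have 2: "(\<lambda>k. (\<phi> (B (q k) / B (2 * q k) * t / B (q k)) ^ q k)\<^sup>2) \<longlonglongrightarrow> (char \<nu> (l * t))\<^sup>2"
    by (intro tendsto_intros)
  have "eventually (\<lambda>k. B (q k) > 0) sequentially"
    using eventually_subseq[OF q B_pos] by simp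
  then have "eventually (\<lambda>k. (\<phi> (B (q k) / B (2 * q k) * t / B (q k)) ^ q k)\<^sup>2 =
      \<phi> (t / B (2 * q k)) ^ (2 * q k)) sequentially"
    by eventually_elim (simp add: power_mult[symmetric] mult.commute)
  with 2 have "(\<lambda>k. \<phi> (t / B (2 * q k)) ^ (2 * q k)) \<longlonglongrightarrow> (char \<nu> (l * t))\<^sup>2"
    by (rule Lim_transform_eventually)
  with 1 show ?thesis by (rule LIMSEQ_unique)
qed

text \<open>By monotonicity the ratios eventually lie in \<open>{0..1}\<close>, and every
  subsequential limit solves \<open>2 * l powr \<alpha> = 1\<close>.\<close>

lemma B_ratio: "(\<lambda>n. B n / B (2 * n)) \<longlonglongrightarrow> 2 powr (- 1 / \<alpha>)"
proof (rule ccontr)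
  define d where "d n = B n / B (2 * n)" for n
  assume "\<not> ?thesis"
  then obtain e where e: "e > 0" "\<not> eventually (\<lambda>n. \<bar>d n - 2 powr (- 1 / \<alpha>)\<bar> < e) sequentially"
    unfolding tendsto_iff d_def dist_real_def by blast
  have "eventually (\<lambda>n. d n \<in> {0..1}) sequentially"
    using B_pos eventually_ge_at_top[of 1]
  proof eventually_elim
    case (elim n)
    then have "B n \<le> B (2 * n)" using B_mono by (auto simp: mono_on_def)
    then show ?case using elim by (simp add: d_def)
  qed
  note d01 = this
  have "\<exists>\<^sub>F n in sequentially. d n \<in> {0..1} \<and> e \<le> \<bar>d n - 2 powr (- 1 / \<alpha>)\<bar>"
    unfolding frequently_def
  proof
    assume "eventually (\<lambda>n. \<not> (d n \<in> {0..1} \<and> e \<le> \<bar>d n - 2 powr (- 1 / \<alpha>)\<bar>)) sequentially"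
    with d01 have "eventually (\<lambda>n. \<bar>d n - 2 powr (- 1 / \<alpha>)\<bar> < e) sequentially"
      by eventually_elim (simp only: simp_thms not_le)
    with e(2) show False ..
  qed
  then have inf: "infinite {n. d n \<in> {0..1} \<and> e \<le> \<bar>d n - 2 powr (- 1 / \<alpha>)\<bar>}" (is "infinite ?A")
    unfolding cofinite_eq_sequentially[symmetric] frequently_cofinite .
  define r where "r = enumerate ?A"
  have r: "strict_mono r" unfolding r_def by (rule strict_mono_enumerate[OF inf])
  have rA: "r k \<in> ?A" for k unfolding r_def by (rule enumerate_in_set[OF inf])
  have "\<forall>k. (d \<circ> r) k \<in> {0..1}" using rA by auto
  with compact_Icc[of 0 "1 :: real"] obtain l s where l: "l \<in> {0..1}" and s: "strict_mono s"
    and lim: "((d \<circ> r) \<circ> s) \<longlonglongrightarrow> l"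
    unfolding compact_def by blast
  have q: "strict_mono (r \<circ> s)" using r s by (rule strict_mono_o)
  have "(\<lambda>k. B ((r \<circ> s) k) / B (2 * (r \<circ> s) k)) \<longlonglongrightarrow> l" using lim by (simp add: d_def o_def)
  then have "2 * l powr \<alpha> = 1"
    using l \<alpha> by (intro sub_stable_scale[OF stable] char_scale_of_limit[OF q]) auto
  then have "l powr \<alpha> = 2 powr (- 1)" by (simp add: powr_minus)
  then have "(l powr \<alpha>) powr (1 / \<alpha>) = (2 powr (- 1)) powr (1 / \<alpha>)" by (simp only:)
  also have "\<dots> = 2 powr (- 1 / \<alpha>)" by (simp only: powr_powr) simp
  also have "(l powr \<alpha>) powr (1 / \<alpha>) = l" using l \<alpha> by (simp add: powr_powr)
  finally have l_eq: "l = 2 powr (- 1 / \<alpha>)" .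
  have "(\<lambda>k. \<bar>((d \<circ> r) \<circ> s) k - 2 powr (- 1 / \<alpha>)\<bar>) \<longlonglongrightarrow> \<bar>l - 2 powr (- 1 / \<alpha>)\<bar>"
    by (intro tendsto_intros lim)
  then have "e \<le> \<bar>l - 2 powr (- 1 / \<alpha>)\<bar>"
    by (rule tendsto_lowerbound) (use rA in auto)
  with l_eq e show False by simp
qed

lemma char_scale: "char \<nu> t = (char \<nu> (2 powr (- 1 / \<alpha>) * t))\<^sup>2"
  using char_scale_of_limit[of "\<lambda>k. k" "2 powr (- 1 / \<alpha>)" t] B_ratio by (simp add: strict_mono_def)

lemma B_double_le:
  assumes "1 / \<alpha> < \<theta>"
  shows "eventually (\<lambda>n. B (2 * n) \<le> 2 powr \<theta> * B n) sequentially"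
proof -
  have "2 powr (- \<theta>) < 2 powr (- 1 / \<alpha>)" using assms by simp
  from order_tendstoD(1)[OF B_ratio this] eventually_ge_at_top[of 1] B_pos
  show ?thesis
  proof eventually_elim
    case (elim n)
    then have "B n \<le> B (2 * n)" using B_mono by (auto simp: mono_on_def)
    then have "B (2 * n) > 0" using elim by simp
    then show ?case using elim(1) by (simp add: powr_minus field_simps)
  qed
qed

lemma B_double_ge:
  assumes "\<theta> < 1 / \<alpha>"
  shows "eventually (\<lambda>n. 2 powr \<theta> * B n \<le> B (2 * n)) sequentially"
proof -
  have "2 powr (- 1 / \<alpha>) < 2 powr (- \<theta>)" using assms by simp
  from order_tendstoD(2)[OF B_ratio this] eventually_ge_at_top[of 1] B_pos
  show ?thesis
  proof eventually_elim
    case (elim n)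
    then have "B n \<le> B (2 * n)" using B_mono by (auto simp: mono_on_def)
    then have "B (2 * n) > 0" using elim by simp
    then show ?case using elim(1) by (simp add: powr_minus field_simps)
  qed
qed

text \<open>If \<open>\<bar>char \<nu> s\<bar> = 1\<close>, the same holds at the points \<open>l ^ k * s\<close>, so that differences of typical points
  lie in all the lattices of mesh \<open>2 * pi / (l ^ k * s)\<close>.\<close>

lemma norm_char_less_1:
  assumes "s \<noteq> 0"
  shows "norm (char \<nu> s) < 1"
proof (rule ccontr)
  assume "\<not> ?thesis"
  then have s1: "norm (char \<nu> s) = 1" using cmod_char_le_1[of s] by simp
  define l where "l = (2 :: real) powr (- 1 / \<alpha>)"
  have l: "0 < l" "l < 1" using \<alpha> by (auto simp: l_def powr_less_one)
  have norm1: "norm (char \<nu> (l ^ k * s)) = 1" for k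
  proof (induction k)
    case (Suc k)
    have "1 = (norm (char \<nu> (l * (l ^ k * s))))\<^sup>2"
      using Suc char_scale[of "l ^ k * s"] by (simp add: l_def norm_power)
    then have "norm (char \<nu> (l * (l ^ k * s))) = 1"
      by (metis norm_ge_zero one_power2 power2_eq_iff_nonneg zero_le_one)
    then show ?case by (simp add: mult.assoc)
  qed (simp add: s1)
  define G where "G = {x. \<forall>k :: nat. iexp (l ^ k * s * x) = char \<nu> (l ^ k * s)}"
  have "AE x in \<nu>. x \<in> G"
    unfolding G_def mem_Collect_eq AE_all_countable by (intro allI AE_iexp_of_norm_char_1 norm1)
  moreover have "\<exists>x\<in>G. x \<in> A" if "measure \<nu> A > 0" "A \<in> sets borel" for A
  proof (rule ccontr)
    assume "\<not> ?thesis"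
    with calculation have "AE x in \<nu>. x \<notin> A" by (auto elim!: eventually_mono)
    then have "measure \<nu> A = 0" using that(2) by (subst prob_eq_0) auto
    with that show False by simp
  qed
  ultimately obtain x y where xy: "x \<in> G" "x > 0" "y \<in> G" "y < 0"
    using stable_law_pos_neg[OF stable \<alpha>] by (metis borel_open greaterThan_iff lessThan_iff open_greaterThan open_lessThan)
  \<comment> \<open>As \<open>l < 1\<close>, the lattices become coarser than the distance from
    \<open>y\<close> to \<open>x\<close>, and only the multiple 0 is left.\<close>
  have "(\<lambda>k. l ^ k * (\<bar>s\<bar> * (x - y))) \<longlonglongrightarrow> 0 * (\<bar>s\<bar> * (x - y))"
    using l by (intro tendsto_intros LIMSEQ_realpow_zero) auto
  then have "eventually (\<lambda>k. l ^ k * (\<bar>s\<bar> * (x - y)) < 2 * pi) sequentially"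
    by (rule order_tendstoD) auto
  then obtain k where k: "l ^ k * (\<bar>s\<bar> * (x - y)) < 2 * pi" by (auto simp: eventually_sequentially)
  have Im_eq: "a = b + of_int m * pi"
    if "\<i> * complex_of_real a = \<i> * complex_of_real b + of_real (of_int m * pi) * \<i>" for a b m
    using arg_cong[OF that, of Im] by simp
  have "iexp (l ^ k * s * x) = iexp (l ^ k * s * y)" using xy by (simp add: G_def)
  then obtain n :: int where n: "\<i> * complex_of_real (l ^ k * s * x) =
      \<i> * complex_of_real (l ^ k * s * y) + (of_int (2 * n) * pi) * \<i>"
    unfolding exp_eq by blast
  then have "l ^ k * s * x = l ^ k * s * y + of_int (2 * n) * pi"
    by (rule Im_eq)
  then have eq: "l ^ k * s * (x - y) = of_int (2 * n) * pi" by (simp add: algebra_simps)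
  have abs: "l ^ k * (\<bar>s\<bar> * (x - y)) = \<bar>of_int (2 * n)\<bar> * pi"
    using arg_cong[OF eq, of abs] l xy by (simp add: abs_mult)
  then have "\<bar>of_int (2 * n) :: real\<bar> * pi < 2 * pi" using k by simp
  then have "\<bar>of_int (2 * n) :: real\<bar> < 2" by (simp only: mult_less_cancel_right_pos pi_gt_zero)
  then have "n = 0" by linarith
  then have "l ^ k * (\<bar>s\<bar> * (x - y)) = 0" using abs by simp
  then show False using l xy assms by simp
qed

section \<open>Domination of the characteristic functions\<close>

text \<open>Away from 0 the modulus of the limit has a maximum below 1 on a compact interval.
  Infinitely many violations would, along a convergent choice of points, contradict it through
  \<open>char_limit\<close>.\<close>

lemma uniform_gap:
  "\<exists>\<rho><1. eventually (\<lambda>m. \<forall>s\<in>{1 / 2..1}. norm (\<phi> (s / B m)) ^ m \<le> \<rho>) sequentially"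
proof -
  have "continuous_on {1 / 2..1} (\<lambda>s. norm (char \<nu> s))"
    by (intro continuous_intros continuous_at_imp_continuous_on ballI isCont_char)
  then obtain s0 where s0: "s0 \<in> {1 / 2..1}" "\<And>s. s \<in> {1 / 2..1} \<Longrightarrow> norm (char \<nu> s) \<le> norm (char \<nu> s0)"
    using continuous_attains_sup[of "{1 / 2..1 :: real}" "\<lambda>s. norm (char \<nu> s)"] by fastforce
  have "norm (char \<nu> s0) < 1" using s0(1) by (intro norm_char_less_1) auto
  then obtain \<rho> where \<rho>: "norm (char \<nu> s0) < \<rho>" "\<rho> < 1" using dense by blast
  have "eventually (\<lambda>m. \<forall>s\<in>{1 / 2..1}. norm (\<phi> (s / B m)) ^ m \<le> \<rho>) sequentially"
  proof (rule ccontr)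
    assume "\<not> ?thesis"
    then have "\<exists>\<^sub>F m in sequentially. \<exists>s\<in>{1 / 2..1}. \<rho> < norm (\<phi> (s / B m)) ^ m"
      unfolding frequently_def by (simp add: not_less)
    then have inf: "infinite {m. \<exists>s\<in>{1 / 2..1}. \<rho> < norm (\<phi> (s / B m)) ^ m}" (is "infinite ?A")
      unfolding cofinite_eq_sequentially[symmetric] frequently_cofinite .
    define r where "r = enumerate ?A"
    have r: "strict_mono r" unfolding r_def by (rule strict_mono_enumerate[OF inf])
    have "r k \<in> ?A" for k unfolding r_def by (rule enumerate_in_set[OF inf])
    then have "\<forall>k. \<exists>s. s \<in> {1 / 2..1} \<and> \<rho> < norm (\<phi> (s / B (r k))) ^ r k" by blast
    then obtain \<sigma> where \<sigma>: "\<And>k. \<sigma> k \<in> {1 / 2..1}" "\<And>k. \<rho> < norm (\<phi> (\<sigma> k / B (r k))) ^ r k" by metis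
    have "\<forall>k. \<sigma> k \<in> {1 / 2..1}" using \<sigma>(1) by blast
    with compact_Icc[of "1 / 2" "1 :: real"] obtain l s where l: "l \<in> {1 / 2..1}" and s: "strict_mono s"
      and lim: "(\<sigma> \<circ> s) \<longlonglongrightarrow> l"
      unfolding compact_def by blast
    have "(\<lambda>k. norm (\<phi> ((\<sigma> \<circ> s) k / B ((r \<circ> s) k)) ^ (r \<circ> s) k)) \<longlonglongrightarrow> norm (char \<nu> l)"
      by (intro tendsto_norm char_limit strict_mono_o r s lim)
    then have "\<rho> \<le> norm (char \<nu> l)"
      by (rule tendsto_lowerbound) (use \<sigma>(2) in \<open>auto simp: norm_power less_imp_le\<close>)
    with s0(2)[OF l] \<rho> show False by simp
  qed
  with \<rho> show ?thesis by blast
qed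

text \<open>The loss \<open>V u = 1 - norm (\<phi> u)\<close> is tested at a length \<open>m\<close>
  for which \<open>u * B m\<close> is of order 1: there \<open>m * V u\<close> is bounded below. For
  \<open>n \<ge> m\<close>, the crude bound \<open>B n \<le> 2 * (n / m) * B m\<close> turns the
  factor \<open>n / m\<close> into a multiple of \<open>s = u * B n\<close>, so
  \<open>n * V u\<close> grows at least linearly in \<open>s\<close>.\<close>

lemma domination:
  "\<exists>C>0. eventually (\<lambda>n. B n > 0 \<and> (\<forall>s. \<bar>s\<bar> \<le> pi * B n \<longrightarrow> norm (\<phi> (s / B n)) ^ n \<le> C * inverse (1 + s\<^sup>2))) sequentially"
proof -
  obtain \<rho> where \<rho>: "\<rho> < 1" "eventually (\<lambda>m. \<forall>s\<in>{1 / 2..1}. norm (\<phi> (s / B m)) ^ m \<le> \<rho>) sequentially"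
    using uniform_gap by blast
  have "eventually (\<lambda>n. B (2 * n) \<le> 2 powr 1 * B n) sequentially" using \<alpha> by (intro B_double_le) simp
  with \<rho>(2) B_pos eventually_ge_at_top[of 1]
  have "eventually (\<lambda>n. (\<forall>s\<in>{1 / 2..1}. norm (\<phi> (s / B n)) ^ n \<le> \<rho>) \<and> B n > 0 \<and> n \<ge> 1 \<and> B (2 * n) \<le> 2 * B n)
     sequentially" by eventually_elim simp
  then obtain n1 where n1: "\<And>n. n \<ge> n1 \<Longrightarrow> (\<forall>s\<in>{1 / 2..1}. norm (\<phi> (s / B n)) ^ n \<le> \<rho>) \<and> B n > 0 \<and> n \<ge> 1 \<and> B (2 * n) \<le> 2 * B n"
    by (auto simp: eventually_sequentially)
  have mono: "B m \<le> B n" if "n1 \<le> m" "m \<le> n" for m n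
    using B_mono n1[of m] that by (auto simp: mono_on_def)
  define V where "V u = 1 - norm (\<phi> u)" for u
  have V_le: "norm (\<phi> u) ^ n \<le> exp (- real n * V u)" for u n
  proof -
    have "norm (\<phi> u) \<le> exp (- V u)" using exp_ge_add_one_self[of "- V u"] by (simp add: V_def)
    then have "norm (\<phi> u) ^ n \<le> exp (- V u) ^ n" by (intro power_mono) auto
    also have "\<dots> = exp (real n * - V u)" by (rule exp_of_nat_mult[symmetric])
    finally show ?thesis by simp
  qed
  \<comment> \<open>Frequencies below \<open>u0\<close> have a matching length
    \<open>m \<ge> n1\<close>. Those in \<open>{u0..pi}\<close> form a compact set away from 0,
    where aperiodicity gives a gap.\<close>
  define u0 where "u0 = min 1 (1 / B n1)"
  have u0: "u0 > 0" "u0 \<le> 1" using n1[of n1] by (auto simp: u0_def)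
  have "continuous_on {u0..pi} (\<lambda>s. norm (\<phi> s))"
    by (intro continuous_intros continuous_at_imp_continuous_on ballI step.isCont_char)
  moreover have "{u0..pi} \<noteq> {}" using u0 pi_ge_two by auto
  ultimately obtain um where um: "um \<in> {u0..pi}" "\<And>u. u \<in> {u0..pi} \<Longrightarrow> norm (\<phi> u) \<le> norm (\<phi> um)"
    using continuous_attains_sup[OF compact_Icc, of u0 pi "\<lambda>u. norm (\<phi> u)"] by blast
  have "norm (\<phi> um) < 1" using um(1) u0 by (intro norm_\<phi>_less_1) auto
  define c0 where "c0 = min (1 - \<rho>) (V um)"
  have c0: "c0 > 0" using \<rho>(1) \<open>norm (\<phi> um) < 1\<close> by (simp add: c0_def V_def)
  define K where "K = max 1 (pi * B n1)"
  have K: "K \<ge> 1" by (simp add: K_def)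
  have ex_m: "\<exists>m\<ge>n1. u * B m \<le> K \<and> c0 \<le> real m * V u" if u: "0 < u" "u \<le> pi" for u
  proof (cases "u < u0")
    case False
    have "V um \<le> V u" using um(2)[of u] False u by (simp add: V_def)
    moreover have "0 \<le> V u" using step.cmod_char_le_1 by (simp add: V_def)
    ultimately have "c0 \<le> real n1 * V u"
      using n1[of n1] mult_right_mono[of 1 "real n1" "V u"] by (simp add: c0_def)
    moreover have "u * B n1 \<le> K" using u n1[of n1] by (auto simp: K_def intro!: max.coboundedI2 mult_right_mono)
    ultimately show ?thesis by blast
  next
    case True
    define A where "A = {m. n1 \<le> m \<and> u * B m \<le> 1}"
    have "u < 1 / B n1" using True by (simp add: u0_def)
    then have "n1 \<in> A" using n1[of n1] by (simp add: A_def field_simps less_imp_le)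
    have "eventually (\<lambda>m. 1 / u < B m) sequentially"
      using B_at_top unfolding filterlim_at_top_dense by blast
    then obtain M where M: "\<And>m. m \<ge> M \<Longrightarrow> 1 / u < B m" by (auto simp: eventually_sequentially)
    have "A \<subseteq> {..M}"
    proof
      fix m assume "m \<in> A"
      then show "m \<in> {..M}" using M[of m] u by (cases "m \<le> M") (auto simp: A_def field_simps)
    qed
    then have fin: "finite A" by (rule finite_subset) simp
    define m where "m = Max A"
    have mA: "m \<in> A" unfolding m_def using \<open>n1 \<in> A\<close> fin by (intro Max_in) auto
    \<comment> \<open>\<open>m\<close> is maximal with \<open>u * B m \<le> 1\<close>. Since
      \<open>Suc m \<le> 2 * m\<close> and doubling the length at most doubles \<open>B\<close>, the
      value \<open>u * B m\<close> cannot fall below \<open>1 / 2\<close>.\<close>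
    have "Suc m \<notin> A"
      using Max_ge[OF fin, of "Suc m"] by (auto simp: m_def)
    then have "1 < u * B (Suc m)" using mA by (simp add: A_def)
    also have "B (Suc m) \<le> B (2 * m)" using mA n1[of m] by (intro mono) (auto simp: A_def)
    also have "B (2 * m) \<le> 2 * B m" using mA n1[of m] by (simp add: A_def)
    finally have "u * B m \<in> {1 / 2..1}" using u mA by (simp add: A_def)
    moreover have "\<forall>s\<in>{1 / 2..1}. norm (\<phi> (s / B m)) ^ m \<le> \<rho>" using n1[of m] mA by (auto simp: A_def)
    ultimately have "norm (\<phi> (u * B m / B m)) ^ m \<le> \<rho>" by blast
    moreover have "u * B m / B m = u" using n1[of m] mA by (simp add: A_def)
    ultimately have "norm (\<phi> u) ^ m \<le> \<rho>" by (simp only:)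
    \<comment> \<open>Bernoulli's inequality turns the gap of the \<open>m\<close>-th power into a
      lower bound on \<open>m * V u\<close>.\<close>
    moreover have "1 + real m * (- V u) \<le> (1 + - V u) ^ m"
      using norm_ge_zero[of "\<phi> u"] by (intro Bernoulli_inequality) (simp add: V_def)
    ultimately have "1 + real m * (- V u) \<le> \<rho>" by (simp add: V_def)
    then have "c0 \<le> real m * V u" unfolding c0_def by (intro min.coboundedI1) simp
    then show ?thesis using mA K by (intro exI[of _ m]) (auto simp: A_def)
  qed
  define c where "c = c0 / (2 * K)"
  have c: "c > 0" using c0 K by (simp add: c_def)
  have main: "norm (\<phi> (s / B n)) ^ n \<le> exp (c * K) * exp (- c * s)"
    if n: "n \<ge> n1" and s: "0 \<le> s" "s \<le> pi * B n" for n s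
  proof (cases "s \<le> K")
    case True
    have "norm (\<phi> (s / B n)) ^ n \<le> 1" using step.cmod_char_le_1 by (intro power_le_one) auto
    also have "1 \<le> exp (c * K) * exp (- c * s)" using True c by (simp add: exp_add[symmetric])
    finally show ?thesis .
  next
    case False
    define u where "u = s / B n"
    have Bn: "B n > 0" using n1 n by simp
    have u: "0 < u" "u \<le> pi" "s = u * B n" using False K s Bn by (auto simp: u_def field_simps)
    obtain m where m: "m \<ge> n1" "u * B m \<le> K" "c0 \<le> real m * V u" using ex_m[OF u(1,2)] by blast
    have "m \<le> n"
    proof (rule ccontr)
      assume "\<not> m \<le> n"
      then have "B n \<le> B m" using n by (intro mono) auto
      then have "u * B n \<le> u * B m" using u by (intro mult_left_mono) auto
      then show False using False u(3) m(2) by linarith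
    qed
    have m0: "m > 0" using n1[of m] m by simp
    have "B n \<le> 2 powr 1 * (real n / real m) powr 1 * B m"
    proof (rule doubling_growth[where st = n1])
      show "B m \<ge> 0" using n1[of m] m by simp
      show "B (2 * k) \<le> 2 powr 1 * B k" if "n1 \<le> k" for k using n1[of k] that by simp
    qed (use m m0 \<open>m \<le> n\<close> mono in auto)
    then have "u * B n \<le> u * (2 * (real n / real m) * B m)"
      using u m0 by (intro mult_left_mono) auto
    also have "\<dots> = 2 * (real n / real m) * (u * B m)" by simp
    also have "\<dots> \<le> 2 * (real n / real m) * K" using m by (intro mult_left_mono) auto
    finally have "s * c \<le> 2 * (real n / real m) * K * c" using c u by (intro mult_right_mono) auto
    also have "\<dots> = real n / real m * c0" using K by (simp add: c_def)
    also have "\<dots> \<le> real n / real m * (real m * V u)" using m by (intro mult_left_mono) auto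
    also have "\<dots> = real n * V u" using m0 by simp
    finally have sc: "s * c \<le> real n * V u" .
    have "norm (\<phi> u) ^ n \<le> exp (- real n * V u)" by (rule V_le)
    also have "\<dots> \<le> exp (- c * s)" using sc by (simp add: mult.commute)
    also have "\<dots> \<le> exp (c * K) * exp (- c * s)" using c K by simp
    finally show ?thesis by (simp add: u_def)
  qed
  define C where "C = exp (c * K) * max 1 (2 / c\<^sup>2)"
  have "C > 0" by (simp add: C_def)
  have decay: "exp (- c * s) \<le> max 1 (2 / c\<^sup>2) * inverse (1 + s\<^sup>2)" if "s \<ge> 0" for s
  proof -
    have "1 + c * s + (c * s)\<^sup>2 / 2 \<le> exp (c * s)" using c that by (intro exp_lower_Taylor_quadratic) simp
    moreover have "0 \<le> c * s" using c that by simp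
    ultimately have "1 + (c * s)\<^sup>2 / 2 \<le> exp (c * s)" by linarith
    moreover have "1 + s\<^sup>2 \<le> max 1 (2 / c\<^sup>2) * (1 + (c * s)\<^sup>2 / 2)"
    proof -
      define M where "M = max 1 (2 / c\<^sup>2)"
      define q where "q = (c * s)\<^sup>2 / 2"
      have "s\<^sup>2 = 2 / c\<^sup>2 * q" using c by (simp add: power_mult_distrib q_def)
      also have "\<dots> \<le> M * q" unfolding M_def q_def by (intro mult_right_mono) auto
      finally have "1 + s\<^sup>2 \<le> M + M * q" unfolding M_def by linarith
      then show ?thesis unfolding M_def[symmetric] q_def[symmetric] by (simp add: algebra_simps)
    qed
    ultimately have "1 + s\<^sup>2 \<le> max 1 (2 / c\<^sup>2) * exp (c * s)"
      using mult_left_mono[of "1 + (c * s)\<^sup>2 / 2" "exp (c * s)" "max 1 (2 / c\<^sup>2)"] by linarith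
    then show ?thesis
      by (simp add: exp_minus field_simps add_pos_nonneg)
  qed
  have "norm (\<phi> (s / B n)) ^ n \<le> C * inverse (1 + s\<^sup>2)" if n: "n \<ge> n1" and s: "\<bar>s\<bar> \<le> pi * B n" for n s
  proof -
    have "norm (\<phi> (s / B n)) = norm (\<phi> (\<bar>s\<bar> / B n))"
      using norm_char_minus[of "step_law \<mu>" "s / B n"] by (cases "s \<ge> 0") (auto simp: abs_if)
    then have "norm (\<phi> (s / B n)) ^ n \<le> exp (c * K) * exp (- c * \<bar>s\<bar>)"
      using main[OF n, of "\<bar>s\<bar>"] s by simp
    also have "\<dots> \<le> exp (c * K) * (max 1 (2 / c\<^sup>2) * inverse (1 + \<bar>s\<bar>\<^sup>2))"
      by (intro mult_left_mono decay) auto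
    finally show ?thesis by (simp add: C_def mult.assoc)
  qed
  then have "eventually (\<lambda>n. B n > 0 \<and> (\<forall>s. \<bar>s\<bar> \<le> pi * B n \<longrightarrow> norm (\<phi> (s / B n)) ^ n \<le> C * inverse (1 + s\<^sup>2))) sequentially"
    unfolding eventually_sequentially using n1 by blast
  with \<open>C > 0\<close> show ?thesis by blast
qed

end

subsection \<open>The local limit theorem\<close>

lemma integrable_inverse_1_plus_square_UNIV: "integrable lborel (\<lambda>s :: real. inverse (1 + s\<^sup>2))"
  using integrable_inverse_1_plus_square unfolding set_integrable_def by (simp add: einterval_def)

context stable_domain
begin

lemma eventually_B_gt: "eventually (\<lambda>n. K < B n) sequentially"
  using B_at_top unfolding filterlim_at_top_dense by blast

lemma char_bound: "\<exists>C>0. \<forall>s. norm (char \<nu> s) \<le> C * inverse (1 + s\<^sup>2)"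
proof -
  obtain C where C: "C > 0" "eventually (\<lambda>n. B n > 0 \<and>
      (\<forall>s. \<bar>s\<bar> \<le> pi * B n \<longrightarrow> norm (\<phi> (s / B n)) ^ n \<le> C * inverse (1 + s\<^sup>2))) sequentially"
    using domination by blast
  have "norm (char \<nu> s) \<le> C * inverse (1 + s\<^sup>2)" for s
  proof (rule tendsto_upperbound)
    show "(\<lambda>n. norm (\<phi> (s / B n) ^ n)) \<longlonglongrightarrow> norm (char \<nu> s)"
      using char_limit[of "\<lambda>n. n" "\<lambda>_. s" s] by (intro tendsto_norm) (simp add: strict_mono_def)
    show "eventually (\<lambda>n. norm (\<phi> (s / B n) ^ n) \<le> C * inverse (1 + s\<^sup>2)) sequentially"
      using C(2) eventually_B_gt[of "\<bar>s\<bar> / pi"]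
      by eventually_elim (simp add: norm_power field_simps)
  qed simp
  with C(1) show ?thesis by blast
qed

lemma integrable_char: "integrable lborel (char \<nu>)"
proof -
  obtain C where C: "C > 0" "\<And>s. norm (char \<nu> s) \<le> C * inverse (1 + s\<^sup>2)" using char_bound by blast
  show ?thesis
    by (rule Bochner_Integration.integrable_bound[where f = "\<lambda>s. C * inverse (1 + s\<^sup>2)"])
      (use C in \<open>auto intro!: integrable_inverse_1_plus_square_UNIV AE_I2 simp: abs_mult\<close>)
qed

definition limit_density :: "real \<Rightarrow> real" where
  "limit_density y = Re (CLINT s|lborel. iexp (- s * y) * char \<nu> s) / (2 * pi)"

lemma integrable_density: "integrable lborel (\<lambda>s. iexp (- s * y) * char \<nu> s)"
  by (rule Bochner_Integration.integrable_bound[OF integrable_char]) (auto simp: norm_mult)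

lemma limit_density_le: "limit_density y \<le> (LINT s|lborel. norm (char \<nu> s)) / (2 * pi)"
proof -
  have "Re (CLINT s|lborel. iexp (- s * y) * char \<nu> s) \<le> norm (CLINT s|lborel. iexp (- s * y) * char \<nu> s)"
    by (rule complex_Re_le_cmod)
  also have "\<dots> \<le> (LINT s|lborel. norm (iexp (- s * y) * char \<nu> s))" by (rule integral_norm_bound)
  also have "\<dots> = (LINT s|lborel. norm (char \<nu> s))" by (simp add: norm_mult)
  finally show ?thesis by (simp add: limit_density_def divide_right_mono)
qed

lemma isCont_limit_density: "isCont limit_density y"
  unfolding continuous_at_sequentially
proof safe
  fix X assume X: "X \<longlonglongrightarrow> y"
  have "(\<lambda>n. CLINT s|lborel. iexp (- s * X n) * char \<nu> s) \<longlonglongrightarrow> (CLINT s|lborel. iexp (- s * y) * char \<nu> s)"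
  proof (rule integral_dominated_convergence[where w = "\<lambda>s. norm (char \<nu> s)"])
    show "AE s in lborel. (\<lambda>n. iexp (- s * X n) * char \<nu> s) \<longlonglongrightarrow> iexp (- s * y) * char \<nu> s"
      using X by (intro AE_I2 tendsto_intros)
  qed (auto simp: norm_mult intro!: integrable_norm integrable_char)
  then show "(limit_density \<circ> X) \<longlonglongrightarrow> limit_density y"
    unfolding o_def limit_density_def by (intro tendsto_intros) auto
qed

text \<open>The distance in mean between the rescaled characteristic function, cut off at the ends
  of the period, and its limit. It bounds the error at all lattice points at once.\<close>

definition local_error :: "nat \<Rightarrow> real" where
  "local_error n = (LINT s|lborel. norm (indicator {- (pi * B n)..pi * B n} s *\<^sub>R \<phi> (s / B n) ^ n - char \<nu> s)) / (2 * pi)"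

lemma local_error_tendsto_0: "local_error \<longlonglongrightarrow> 0"
proof -
  obtain C where C: "C > 0" "eventually (\<lambda>n. B n > 0 \<and>
      (\<forall>s. \<bar>s\<bar> \<le> pi * B n \<longrightarrow> norm (\<phi> (s / B n)) ^ n \<le> C * inverse (1 + s\<^sup>2))) sequentially"
    using domination by blast
  then obtain N where N: "\<And>n s. n \<ge> N \<Longrightarrow> \<bar>s\<bar> \<le> pi * B n \<Longrightarrow> norm (\<phi> (s / B n)) ^ n \<le> C * inverse (1 + s\<^sup>2)"
    by (auto simp: eventually_sequentially)
  obtain D where D: "D > 0" "\<And>s. norm (char \<nu> s) \<le> D * inverse (1 + s\<^sup>2)" using char_bound by blast
  let ?g = "\<lambda>n s. indicator {- (pi * B n)..pi * B n} s *\<^sub>R \<phi> (s / B n) ^ n"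
  \<comment> \<open>The index is shifted because domination holds only from \<open>N\<close>
    on.\<close>
  have "(\<lambda>n. LINT s|lborel. norm (?g (n + N) s - char \<nu> s)) \<longlonglongrightarrow> integral\<^sup>L (lborel :: real measure) (\<lambda>_. 0 :: real)"
  proof (rule integral_dominated_convergence[where w = "\<lambda>s. (C + D) * inverse (1 + s\<^sup>2)"])
    show "AE s in lborel. (\<lambda>n. norm (?g (n + N) s - char \<nu> s)) \<longlonglongrightarrow> 0"
    proof (rule AE_I2)
      fix s :: real
      have "eventually (\<lambda>n. \<phi> (s / B n) ^ n = ?g n s) sequentially"
        using eventually_B_gt[of "\<bar>s\<bar> / pi"]
        by eventually_elim (auto simp: indicator_def field_simps abs_le_iff)
      with char_limit[of "\<lambda>n. n" "\<lambda>_. s" s] have "(\<lambda>n. ?g n s) \<longlonglongrightarrow> char \<nu> s"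
        by (auto simp: strict_mono_def intro: Lim_transform_eventually)
      then have "(\<lambda>n. ?g (n + N) s - char \<nu> s) \<longlonglongrightarrow> char \<nu> s - char \<nu> s"
        by (intro tendsto_intros LIMSEQ_ignore_initial_segment)
      then show "(\<lambda>n. norm (?g (n + N) s - char \<nu> s)) \<longlonglongrightarrow> 0" by (simp add: tendsto_norm_zero)
    qed
    show "AE s in lborel. norm (norm (?g (n + N) s - char \<nu> s)) \<le> (C + D) * inverse (1 + s\<^sup>2)" for n
    proof (rule AE_I2)
      fix s :: real
      have "norm (?g (n + N) s) \<le> C * inverse (1 + s\<^sup>2)"
        using N[of "n + N" s] C(1) by (auto simp: indicator_def norm_power abs_le_iff)
      moreover have "(C + D) * inverse (1 + s\<^sup>2) = C * inverse (1 + s\<^sup>2) + D * inverse (1 + s\<^sup>2)"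
        by (rule distrib_right)
      ultimately show "norm (norm (?g (n + N) s - char \<nu> s)) \<le> (C + D) * inverse (1 + s\<^sup>2)"
        using D(2)[of s] norm_triangle_ineq4[of "?g (n + N) s" "char \<nu> s"]
        unfolding real_norm_def abs_norm_cancel by linarith
    qed
  qed (auto intro!: integrable_inverse_1_plus_square_UNIV)
  then have "(\<lambda>n. LINT s|lborel. norm (?g n s - char \<nu> s)) \<longlonglongrightarrow> 0"
    by (rule LIMSEQ_offset[where k = N, OF tendsto_eq_rhs]) simp
  from tendsto_divide[OF this tendsto_const[of "2 * pi"]]
  show ?thesis by (simp add: local_error_def[abs_def])
qed

text \<open>Substitute \<open>t = s / B n\<close> in the inversion formula. The phases have modulus
  1, so the remaining bound is uniform in \<open>z\<close>.\<close>

lemma local_limit: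
  assumes "B n > 0"
  shows "\<bar>B n * pmf (sum_pmf \<mu> n) z - limit_density ((real z - real n) / B n)\<bar> \<le> local_error n"
proof -
  define y where "y = (real z - real n) / B n"
  let ?g = "\<lambda>s. indicator {- (pi * B n)..pi * B n} s *\<^sub>R \<phi> (s / B n) ^ n"
  have int_g: "integrable lborel ?g"
  proof (rule Bochner_Integration.integrable_bound[where f = "indicator {- (pi * B n)..pi * B n} :: real \<Rightarrow> real"])
    show "AE s in lborel. norm (?g s) \<le> norm (indicator {- (pi * B n)..pi * B n} s :: real)"
      using step.cmod_char_le_1 by (intro AE_I2) (auto simp: indicator_def norm_power power_le_one)
    show "integrable lborel (indicator {- (pi * B n)..pi * B n} :: real \<Rightarrow> real)"
      by (intro integrable_real_indicator) (auto simp: emeasure_lborel_Icc_eq)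
  qed auto
  have int_g': "integrable lborel (\<lambda>s. iexp (- s * y) * ?g s)"
    by (rule Bochner_Integration.integrable_bound[OF int_g]) (auto simp: norm_mult)
  have "complex_of_real (2 * pi * pmf (sum_pmf \<mu> n) z) =
     \<bar>1 / B n\<bar> *\<^sub>R (CLINT s|lborel. indicator {- pi..pi} (0 + 1 / B n * s) *\<^sub>R
        (iexp (- (0 + 1 / B n * s) * (real z - real n)) * \<phi> (0 + 1 / B n * s) ^ n))"
    unfolding sum_pmf_inversion using assms by (subst lborel_integral_real_affine[where c = "1 / B n" and t = 0]) auto
  also have "(CLINT s|lborel. indicator {- pi..pi} (0 + 1 / B n * s) *\<^sub>R
        (iexp (- (0 + 1 / B n * s) * (real z - real n)) * \<phi> (0 + 1 / B n * s) ^ n)) =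
      (CLINT s|lborel. iexp (- s * y) * ?g s)"
  proof (intro Bochner_Integration.integral_cong refl)
    fix s :: real
    have "indicator {- pi..pi} (0 + 1 / B n * s) = (indicator {- (pi * B n)..pi * B n} s :: real)"
      using assms by (auto simp: indicator_def field_simps)
    moreover have "- (0 + 1 / B n * s) * (real z - real n) = - s * y" by (simp add: y_def)
    ultimately show "indicator {- pi..pi} (0 + 1 / B n * s) *\<^sub>R
        (iexp (- (0 + 1 / B n * s) * (real z - real n)) * \<phi> (0 + 1 / B n * s) ^ n) = iexp (- s * y) * ?g s"
      by (simp only:) simp
  qed
  finally have "complex_of_real (2 * pi * (B n * pmf (sum_pmf \<mu> n) z)) = (CLINT s|lborel. iexp (- s * y) * ?g s)"
    using assms by (simp add: scaleR_conv_of_real field_simps)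
  then have eq: "2 * pi * (B n * pmf (sum_pmf \<mu> n) z) = Re (CLINT s|lborel. iexp (- s * y) * ?g s)"
    by (metis Re_complex_of_real)
  have "\<bar>2 * pi * (B n * pmf (sum_pmf \<mu> n) z) - Re (CLINT s|lborel. iexp (- s * y) * char \<nu> s)\<bar> =
     \<bar>Re ((CLINT s|lborel. iexp (- s * y) * ?g s) - (CLINT s|lborel. iexp (- s * y) * char \<nu> s))\<bar>"
    unfolding eq by simp
  also have "\<dots> \<le> norm ((CLINT s|lborel. iexp (- s * y) * ?g s) - (CLINT s|lborel. iexp (- s * y) * char \<nu> s))"
    by (rule abs_Re_le_cmod)
  also have "(CLINT s|lborel. iexp (- s * y) * ?g s) - (CLINT s|lborel. iexp (- s * y) * char \<nu> s) =
     (CLINT s|lborel. iexp (- s * y) * ?g s - iexp (- s * y) * char \<nu> s)"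
    by (rule Bochner_Integration.integral_diff[OF int_g' integrable_density, symmetric])
  also have "norm \<dots> \<le> (LINT s|lborel. norm (iexp (- s * y) * ?g s - iexp (- s * y) * char \<nu> s))"
    by (rule integral_norm_bound)
  also have "\<dots> = 2 * pi * local_error n"
    unfolding local_error_def
    by (simp add: right_diff_distrib[symmetric] norm_mult del: mult_scaleR_right)
  finally have bound: "\<bar>2 * pi * (B n * pmf (sum_pmf \<mu> n) z) - Re (CLINT s|lborel. iexp (- s * y) * char \<nu> s)\<bar>
      \<le> 2 * pi * local_error n" .
  have "\<bar>x - r / (2 * pi)\<bar> \<le> e" if "\<bar>2 * pi * x - r\<bar> \<le> 2 * pi * e" for x r e :: real
  proof -
    have "x - r / (2 * pi) = (2 * pi * x - r) / (2 * pi)" by (simp add: field_simps)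
    then have "\<bar>x - r / (2 * pi)\<bar> = \<bar>2 * pi * x - r\<bar> / (2 * pi)" by (simp add: abs_divide)
    also have "\<dots> \<le> 2 * pi * e / (2 * pi)" using that by (intro divide_right_mono) auto
    finally show ?thesis by simp
  qed
  from this[OF bound] have "\<bar>B n * pmf (sum_pmf \<mu> n) z - limit_density y\<bar> \<le> local_error n"
    unfolding limit_density_def .
  then show ?thesis by (simp add: y_def)
qed

end

lemma diff_inverse_le_divide:
  fixes b :: real
  assumes "b > 0" "y * b - 1 \<le> x"
  shows "y - 1 / b \<le> x / b"
proof -
  have "(y * b - 1) / b \<le> x / b" using assms by (intro divide_right_mono) auto
  then show ?thesis using assms by (simp add: diff_divide_distrib)
qed

context stable_domain
begin

text \<open>Any exponent strictly between \<open>1 / \<alpha>\<close> and 1 bounds the growth of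
  \<open>B\<close>. As a consequence \<open>n + y * B n\<close> is eventually nonnegative and can be
  rounded to a natural number.\<close>

lemma B_over_n: "(\<lambda>n. B n / real n) \<longlonglongrightarrow> 0"
proof -
  define \<theta> where "\<theta> = (1 / \<alpha> + 1) / 2"
  have \<theta>: "1 / \<alpha> < \<theta>" "\<theta> < 1" "0 < \<theta>" using \<alpha> by (auto simp: \<theta>_def field_simps)
  have "eventually (\<lambda>n. B (2 * n) \<le> 2 powr \<theta> * B n \<and> B n > 0 \<and> n \<ge> 1) sequentially"
    using B_double_le[OF \<theta>(1)] B_pos eventually_ge_at_top[of 1] by eventually_elim simp
  then obtain k where k: "\<And>n. n \<ge> k \<Longrightarrow> B (2 * n) \<le> 2 powr \<theta> * B n \<and> B n > 0 \<and> n \<ge> 1"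
    by (auto simp: eventually_sequentially)
  define D where "D = 2 powr \<theta> * B k"
  have k1: "k \<ge> 1" using k[of k] by simp
  have up: "B n \<le> D * real n powr \<theta>" if "n \<ge> k" for n
  proof -
    have "B n \<le> 2 powr \<theta> * (real n / real k) powr \<theta> * B k"
    proof (rule doubling_growth[where st = k])
      show "B m \<le> B n" if "k \<le> m" "m \<le> n" for m n using B_mono k1 that by (auto simp: mono_on_def)
    qed (use k[of k] k \<theta> that in \<open>auto simp: less_imp_le\<close>)
    also have "\<dots> \<le> 2 powr \<theta> * (real n) powr \<theta> * B k"
      using k1 k[of k] \<theta> that
      by (intro mult_right_mono mult_left_mono powr_mono2) (auto simp: field_simps less_imp_le)
    finally show ?thesis by (simp add: D_def mult_ac)
  qed
  show ?thesis
  proof (rule tendsto_sandwich)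
    show "eventually (\<lambda>n. 0 \<le> B n / real n) sequentially"
      using B_pos by eventually_elim simp
    show "eventually (\<lambda>n. B n / real n \<le> D * real n powr (\<theta> - 1)) sequentially"
      using eventually_ge_at_top[of k] eventually_gt_at_top[of 0]
    proof eventually_elim
      case (elim n)
      have "B n / real n \<le> D * real n powr \<theta> / real n" using up[OF elim(1)] elim(2) by (intro divide_right_mono) auto
      then show ?case using elim(2) by (simp add: powr_diff)
    qed
    have "(\<lambda>n. real n powr (\<theta> - 1)) \<longlonglongrightarrow> 0"
      using \<theta> by (intro tendsto_neg_powr filterlim_real_sequentially) auto
    from tendsto_mult_right_zero[OF this, of D]
    show "(\<lambda>n. D * real n powr (\<theta> - 1)) \<longlonglongrightarrow> 0" .
  qed simp
qed

lemma eventually_shift_nonneg: "eventually (\<lambda>n. 0 \<le> real n + y * B n) sequentially"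
proof -
  have "(\<lambda>n. y * (B n / real n)) \<longlonglongrightarrow> y * 0" by (intro tendsto_intros B_over_n)
  then have "eventually (\<lambda>n. - 1 < y * (B n / real n)) sequentially" by (rule order_tendstoD) simp
  with eventually_gt_at_top[of 0] show ?thesis
    by eventually_elim (simp add: field_simps)
qed

definition lattice_point :: "real \<Rightarrow> nat \<Rightarrow> nat" where
  "lattice_point y n = nat \<lfloor>real n + y * B n\<rfloor>"

lemma lattice_point_tendsto: "(\<lambda>n. (real (lattice_point y n) - real n) / B n) \<longlonglongrightarrow> y"
proof (rule tendsto_sandwich)
  show "eventually (\<lambda>n. y - 1 / B n \<le> (real (lattice_point y n) - real n) / B n) sequentially"
    using B_pos
  proof eventually_elim
    case (elim n)
    have "real n + y * B n - 1 \<le> real (lattice_point y n)" unfolding lattice_point_def by linarith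
    then show ?case using elim by (intro diff_inverse_le_divide) auto
  qed
  show "eventually (\<lambda>n. (real (lattice_point y n) - real n) / B n \<le> y) sequentially"
    using B_pos eventually_shift_nonneg[of y]
  proof eventually_elim
    case (elim n)
    then have "real (lattice_point y n) \<le> real n + y * B n" unfolding lattice_point_def by linarith
    then show ?case using elim by (simp add: field_simps)
  qed
  have "(\<lambda>n. 1 / B n) \<longlonglongrightarrow> 0" by (rule tendsto_divide_0[OF tendsto_const filterlim_at_top_imp_at_infinity[OF B_at_top]])
  then have "(\<lambda>n. y - 1 / B n) \<longlonglongrightarrow> y - 0" by (intro tendsto_intros)
  then show "(\<lambda>n. y - 1 / B n) \<longlonglongrightarrow> y" by simp
qed simp

lemma pmf_limit:
  assumes "(\<lambda>n. (real (z n) - real n) / B n) \<longlonglongrightarrow> y"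
  shows "(\<lambda>n. B n * pmf (sum_pmf \<mu> n) (z n)) \<longlonglongrightarrow> limit_density y"
proof -
  have "(\<lambda>n. B n * pmf (sum_pmf \<mu> n) (z n) - limit_density ((real (z n) - real n) / B n)) \<longlonglongrightarrow> 0"
  proof (rule Lim_null_comparison[OF _ local_error_tendsto_0])
    show "eventually (\<lambda>n. norm (B n * pmf (sum_pmf \<mu> n) (z n) - limit_density ((real (z n) - real n) / B n))
       \<le> local_error n) sequentially"
      using B_pos by eventually_elim (use local_limit in simp)
  qed
  moreover have "(\<lambda>n. limit_density ((real (z n) - real n) / B n)) \<longlonglongrightarrow> limit_density y"
    using isCont_tendsto_compose[OF isCont_limit_density assms] .
  ultimately have "(\<lambda>n. (B n * pmf (sum_pmf \<mu> n) (z n) - limit_density ((real (z n) - real n) / B n)) +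
      limit_density ((real (z n) - real n) / B n)) \<longlonglongrightarrow> 0 + limit_density y"
    by (rule tendsto_add)
  then show ?thesis by simp
qed

lemma limit_density_nonneg: "0 \<le> limit_density y"
proof (rule tendsto_lowerbound[OF pmf_limit[OF lattice_point_tendsto]])
  show "eventually (\<lambda>n. 0 \<le> B n * pmf (sum_pmf \<mu> n) (lattice_point y n)) sequentially"
    using B_pos by eventually_elim simp
qed simp

text \<open>Otherwise all point masses on that side are at most \<open>local_error n / B n\<close>,
  and the tent, which meets at most \<open>b * B n\<close> points, has vanishing
  expectation.\<close>

lemma limit_density_pos_side:
  assumes "\<sigma> = 1 \<or> \<sigma> = - 1"
  shows "\<exists>y. 0 < \<sigma> * y \<and> 0 < limit_density y"
proof (rule ccontr)
  assume "\<not> ?thesis"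
  then have zero: "limit_density y = 0" if "0 < \<sigma> * y" for y
    using that limit_density_nonneg[of y] by (metis less_eq_real_def)
  obtain b where b: "b > 0" "(\<integral>x. bump b (\<sigma> * x) \<partial>\<nu>) > 0" using ex_bump[OF assms] by blast
  have "(\<integral>x. bump b (\<sigma> * x) \<partial>\<nu>) \<le> b * b * 0"
  proof (rule tendsto_le[OF _ _ bump_limit[OF b(1)]])
    show "(\<lambda>n. b * b * local_error n) \<longlonglongrightarrow> b * b * 0" by (intro tendsto_intros local_error_tendsto_0)
    show "eventually (\<lambda>n. measure_pmf.expectation (sum_pmf \<mu> n) (\<lambda>s. bump b (\<sigma> * ((real s - real n) / B n)))
        \<le> b * b * local_error n) sequentially"
      using B_pos
    proof eventually_elim
      case (elim n)
      have eq: "\<sigma> * ((real s - real n) / B n) = (real s - real n) / (\<sigma> * B n)" for s :: nat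
        using assms elim by (auto simp: minus_divide_left)
      have err: "0 \<le> local_error n" using local_limit[OF elim, of 0] by linarith
      have "measure_pmf.expectation (sum_pmf \<mu> n) (\<lambda>s. bump b ((real s - real n) / (\<sigma> * B n))) \<le>
         b * (b * \<bar>\<sigma> * B n\<bar>) * (local_error n / B n)"
      proof (rule expectation_bump_le)
        fix z assume "0 < (real z - real n) / (\<sigma> * B n)"
        then have "limit_density ((real z - real n) / B n) = 0"
          by (intro zero) (simp only: eq)
        then show "pmf (sum_pmf \<mu> n) z \<le> local_error n / B n"
          using local_limit[OF elim, of z] elim by (simp add: field_simps)
      qed (use b elim err in auto)
      also have "\<dots> = b * b * local_error n" using assms elim by (auto simp: abs_mult)
      finally show ?case by (simp only: eq)
    qed
  qed simp
  with b(2) show False by simp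
qed

section \<open>Positivity of the limit density at 0\<close>

lemma pmf_sum_add_ge:
  assumes "finite X" "\<And>x. x \<in> X \<Longrightarrow> x \<le> w"
  shows "(\<Sum>x\<in>X. pmf (sum_pmf \<mu> m) x * pmf (sum_pmf \<mu> n) (w - x)) \<le> pmf (sum_pmf \<mu> (m + n)) w"
proof -
  let ?P = "pair_pmf (sum_pmf \<mu> m) (sum_pmf \<mu> n)"
  have "(\<Sum>x\<in>X. pmf (sum_pmf \<mu> m) x * pmf (sum_pmf \<mu> n) (w - x)) = (\<Sum>p\<in>(\<lambda>x. (x, w - x)) ` X. pmf ?P p)"
    by (subst sum.reindex) (auto simp: inj_on_def pmf_pair)
  also have "\<dots> = measure_pmf.prob ?P ((\<lambda>x. (x, w - x)) ` X)"
    using assms(1) by (subst measure_measure_pmf_finite) auto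
  also have "\<dots> \<le> measure_pmf.prob ?P ((\<lambda>(x, s). x + s) -` {w})"
    using assms(2) by (intro measure_pmf.finite_measure_mono) auto
  also have "\<dots> = pmf (sum_pmf \<mu> (m + n)) w"
    unfolding sum_pmf_add by (simp add: pmf_map)
  finally show ?thesis .
qed

text \<open>To be at \<open>w n\<close> after \<open>2 * n\<close> steps, the first half may end
  near \<open>n + y * B n\<close> and the second contribute about \<open>n + y' * B n\<close>. There
  are of order \<open>B n\<close> such midpoints, each of weight at least of order
  \<open>1 / (B n) ^ 2\<close>, so the point mass is at least of order \<open>1 / B n\<close>.
  Normalising by \<open>B (2 * n)\<close> brings in the factor
  \<open>2 powr (- 1 / \<alpha>)\<close>.\<close>

lemma limit_density_add:
  assumes "0 < limit_density y" "0 < limit_density y'"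
  shows "0 < limit_density (2 powr (- 1 / \<alpha>) * (y + y'))"
proof -
  define l where "l = (2 :: real) powr (- 1 / \<alpha>)"
  define a where "a = min (limit_density y) (limit_density y') / 2"
  have a: "a > 0" "a < limit_density y" "a < limit_density y'" using assms by (auto simp: a_def)
  have "eventually (\<lambda>x. a < limit_density x) (at y)" "eventually (\<lambda>x. a < limit_density x) (at y')"
    using isCont_limit_density a unfolding isCont_def by (auto intro: order_tendstoD)
  then obtain d1 d2 where d: "d1 > 0" "d2 > 0" "\<And>x. x \<noteq> y \<Longrightarrow> dist x y < d1 \<Longrightarrow> a < limit_density x"
    "\<And>x. x \<noteq> y' \<Longrightarrow> dist x y' < d2 \<Longrightarrow> a < limit_density x"
    unfolding eventually_at by blast
  define \<delta> where "\<delta> = min d1 d2"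
  have \<delta>: "\<delta> > 0" "\<And>x. \<bar>x - y\<bar> < \<delta> \<Longrightarrow> a < limit_density x" "\<And>x. \<bar>x - y'\<bar> < \<delta> \<Longrightarrow> a < limit_density x"
  proof -
    show "\<delta> > 0" using d by (simp add: \<delta>_def)
    show "a < limit_density x" if "\<bar>x - y\<bar> < \<delta>" for x
      using d(3)[of x] a that by (cases "x = y") (auto simp: \<delta>_def dist_real_def)
    show "a < limit_density x" if "\<bar>x - y'\<bar> < \<delta>" for x
      using d(4)[of x] a that by (cases "x = y'") (auto simp: \<delta>_def dist_real_def)
  qed
  define w where "w n = nat \<lfloor>real (2 * n) + (y + y') * B n\<rfloor>" for n
  have strict: "strict_mono (\<lambda>n :: nat. 2 * n)" by (simp add: strict_mono_def)
  have pos2: "eventually (\<lambda>n. B (2 * n) > 0) sequentially"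
    using eventually_subseq[OF strict B_pos] by simp
  have inv_B: "(\<lambda>n. 1 / B n) \<longlonglongrightarrow> 0"
    by (rule tendsto_divide_0[OF tendsto_const filterlim_at_top_imp_at_infinity[OF B_at_top]])
  have w_real: "eventually (\<lambda>n. real (2 * n) + (y + y') * B n - 1 \<le> real (w n) \<and>
      real (w n) \<le> real (2 * n) + (y + y') * B n) sequentially"
    using eventually_shift_nonneg[of y] eventually_shift_nonneg[of y']
  proof eventually_elim
    case (elim n)
    then have "0 \<le> real (2 * n) + (y + y') * B n" by (simp add: distrib_right)
    then show ?case unfolding w_def by linarith
  qed
  have w_lim: "(\<lambda>n. (real (w n) - real (2 * n)) / B (2 * n)) \<longlonglongrightarrow> l * (y + y')"
  proof -
    have "(\<lambda>n. (real (w n) - real (2 * n)) / B n) \<longlonglongrightarrow> y + y'"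
    proof (rule tendsto_sandwich)
      show "eventually (\<lambda>n. y + y' - 1 / B n \<le> (real (w n) - real (2 * n)) / B n) sequentially"
        using w_real B_pos by eventually_elim (intro diff_inverse_le_divide, auto)
      show "eventually (\<lambda>n. (real (w n) - real (2 * n)) / B n \<le> y + y') sequentially"
        using w_real B_pos by eventually_elim (simp add: field_simps)
      have "(\<lambda>n. y + y' - 1 / B n) \<longlonglongrightarrow> y + y' - 0" by (intro tendsto_intros inv_B)
      then show "(\<lambda>n. y + y' - 1 / B n) \<longlonglongrightarrow> y + y'" by simp
    qed simp
    then have "(\<lambda>n. B n / B (2 * n) * ((real (w n) - real (2 * n)) / B n)) \<longlonglongrightarrow> l * (y + y')"
      unfolding l_def by (intro tendsto_mult B_ratio)
    moreover have "eventually (\<lambda>n. B n / B (2 * n) * ((real (w n) - real (2 * n)) / B n) =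
       (real (w n) - real (2 * n)) / B (2 * n)) sequentially"
      using B_pos by eventually_elim simp
    ultimately show ?thesis by (rule Lim_transform_eventually)
  qed
  have small_error: "eventually (\<lambda>n. local_error n < a / 2) sequentially"
    using a(1) by (intro order_tendstoD(2)[OF local_error_tendsto_0]) simp
  have lower: "eventually (\<lambda>n. \<delta> * a\<^sup>2 / 16 \<le> B n * pmf (sum_pmf \<mu> (2 * n)) (w n)) sequentially"
    \<comment> \<open>The threshold \<open>8 / \<delta>\<close> absorbs the roundings to
      integers.\<close>
    using B_pos eventually_B_gt[of "8 / \<delta>"] w_real small_error
      eventually_shift_nonneg[of "y - \<delta>"] eventually_shift_nonneg[of "y' - \<delta>"]
  proof eventually_elim
    case (elim n)
    note Bn = elim(1)
    have Bd: "\<delta> * B n > 8" using elim(2) \<delta>(1) by (simp add: field_simps)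
    have div: "a / (2 * B n) \<le> p" if "a / 2 \<le> B n * p" for p
    proof -
      have "a / 2 / B n \<le> B n * p / B n" using that Bn by (intro divide_right_mono) auto
      then show ?thesis using Bn by simp
    qed
    have near: "a / 2 \<le> B n * pmf (sum_pmf \<mu> n) x"
      if "\<bar>(real x - real n) / B n - y\<bar> < \<delta> \<or> \<bar>(real x - real n) / B n - y'\<bar> < \<delta>" for x
      using local_limit[OF Bn, of x] \<delta>(2,3)[of "(real x - real n) / B n"] that elim(4) by linarith
    \<comment> \<open>The midpoints run from \<open>y - \<delta> / 2\<close> to about
      \<open>y\<close> on the rescaled scale, so both parts stay within \<delta> of their
      targets.\<close>
    define x0 where "x0 = nat \<lceil>real n + (y - \<delta> / 2) * B n\<rceil>"
    define K where "K = nat \<lfloor>\<delta> * B n / 2\<rfloor>"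
    have nn: "0 \<le> real n + (y - \<delta> / 2) * B n"
    proof -
      have "(y - \<delta>) * B n \<le> (y - \<delta> / 2) * B n" using \<delta>(1) Bn by (intro mult_right_mono) auto
      then show ?thesis using elim(5) by linarith
    qed
    have x0: "real n + (y - \<delta> / 2) * B n \<le> real x0" "real x0 \<le> real n + (y - \<delta> / 2) * B n + 1"
      using nn unfolding x0_def by linarith+
    have K: "\<delta> * B n / 4 \<le> real K" "real K \<le> \<delta> * B n / 2"
      using Bd unfolding K_def by linarith+
    define X where "X = {x0..<x0 + K}"
    have X: "\<bar>(real x - real n) / B n - y\<bar> < \<delta>" "x \<le> w n"
      "\<bar>(real (w n - x) - real n) / B n - y'\<bar> < \<delta>" if "x \<in> X" for x
    proof -
      have x: "real x0 \<le> real x" "real x \<le> real x0 + real K" using that by (auto simp: X_def)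
      have 1: "(y - \<delta> / 2) * B n \<le> real x - real n" "real x - real n \<le> y * B n + 1"
        using x x0 K by (auto simp: left_diff_distrib)
      have e1: "real x - real n - y * B n \<ge> - (\<delta> / 2 * B n)" "real x - real n - y * B n \<le> 1"
        using 1 by (auto simp: left_diff_distrib)
      have "\<bar>real x - real n - y * B n\<bar> < \<delta> * B n" using e1 Bd by linarith
      then show "\<bar>(real x - real n) / B n - y\<bar> < \<delta>" using Bn by (simp add: field_simps abs_less_iff)
      have "0 \<le> real n + (y' - \<delta>) * B n" by (rule elim(6))
      then have "real x \<le> real (w n)"
        using e1 elim(3) Bd by (simp add: left_diff_distrib distrib_right)
      then show "x \<le> w n" by simp
      then have "real (w n - x) = real (w n) - real x" by simp
      then have "\<bar>real (w n - x) - real n - y' * B n\<bar> < \<delta> * B n"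
        using e1 elim(3) Bd by (simp add: distrib_right) linarith
      then show "\<bar>(real (w n - x) - real n) / B n - y'\<bar> < \<delta>" using Bn by (simp add: field_simps abs_less_iff)
    qed
    have "real K * (a / (2 * B n) * (a / (2 * B n))) =
        (\<Sum>x\<in>X. a / (2 * B n) * (a / (2 * B n)))" by (simp add: X_def)
    also have "\<dots> \<le> (\<Sum>x\<in>X. pmf (sum_pmf \<mu> n) x * pmf (sum_pmf \<mu> n) (w n - x))"
    proof (intro sum_mono mult_mono)
      fix x assume "x \<in> X"
      show "a / (2 * B n) \<le> pmf (sum_pmf \<mu> n) x" using X(1)[OF \<open>x \<in> X\<close>] by (intro div near) simp
      show "a / (2 * B n) \<le> pmf (sum_pmf \<mu> n) (w n - x)"
        using X(3)[OF \<open>x \<in> X\<close>] by (intro div near) simp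
    qed (use a Bn in auto)
    also have "\<dots> \<le> pmf (sum_pmf \<mu> (n + n)) (w n)" by (rule pmf_sum_add_ge) (use X(2) in \<open>auto simp: X_def\<close>)
    finally have "real K * (a / (2 * B n) * (a / (2 * B n))) \<le> pmf (sum_pmf \<mu> (2 * n)) (w n)"
      by (simp only: mult_2)
    then have "B n * (real K * (a / (2 * B n) * (a / (2 * B n)))) \<le> B n * pmf (sum_pmf \<mu> (2 * n)) (w n)"
      using Bn by (intro mult_left_mono) auto
    moreover have "B n * (\<delta> * B n / 4 * (a / (2 * B n) * (a / (2 * B n)))) \<le>
        B n * (real K * (a / (2 * B n) * (a / (2 * B n))))"
      using K Bn a by (intro mult_left_mono mult_right_mono) auto
    moreover have "B n * (\<delta> * B n / 4 * (a / (2 * B n) * (a / (2 * B n)))) = \<delta> * a\<^sup>2 / 16"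
      using Bn by (simp add: power2_eq_square)
    ultimately show ?case by linarith
  qed
  have upper: "(\<lambda>n. B n * pmf (sum_pmf \<mu> (2 * n)) (w n)) \<longlonglongrightarrow> l * limit_density (l * (y + y'))"
  proof -
    have "(\<lambda>n. B (2 * n) * pmf (sum_pmf \<mu> (2 * n)) (w n) - limit_density ((real (w n) - real (2 * n)) / B (2 * n))) \<longlonglongrightarrow> 0"
    proof (rule Lim_null_comparison)
      show "(\<lambda>n. local_error (2 * n)) \<longlonglongrightarrow> 0"
        using LIMSEQ_subseq_LIMSEQ[OF local_error_tendsto_0 strict] by (simp add: o_def)
      show "eventually (\<lambda>n. norm (B (2 * n) * pmf (sum_pmf \<mu> (2 * n)) (w n) -
          limit_density ((real (w n) - real (2 * n)) / B (2 * n))) \<le> local_error (2 * n)) sequentially"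
        using pos2 by eventually_elim (use local_limit in \<open>simp only: real_norm_def\<close>)
    qed
    moreover have "(\<lambda>n. limit_density ((real (w n) - real (2 * n)) / B (2 * n))) \<longlonglongrightarrow> limit_density (l * (y + y'))"
      by (rule isCont_tendsto_compose[OF isCont_limit_density w_lim])
    ultimately have "(\<lambda>n. (B (2 * n) * pmf (sum_pmf \<mu> (2 * n)) (w n) - limit_density ((real (w n) - real (2 * n)) / B (2 * n))) +
       limit_density ((real (w n) - real (2 * n)) / B (2 * n))) \<longlonglongrightarrow> 0 + limit_density (l * (y + y'))"
      by (rule tendsto_add)
    then have "(\<lambda>n. B (2 * n) * pmf (sum_pmf \<mu> (2 * n)) (w n)) \<longlonglongrightarrow> limit_density (l * (y + y'))" by simp
    then have "(\<lambda>n. B n / B (2 * n) * (B (2 * n) * pmf (sum_pmf \<mu> (2 * n)) (w n))) \<longlonglongrightarrow> l * limit_density (l * (y + y'))"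
      unfolding l_def by (intro tendsto_mult B_ratio)
    moreover have "eventually (\<lambda>n. B n / B (2 * n) * (B (2 * n) * pmf (sum_pmf \<mu> (2 * n)) (w n)) =
      B n * pmf (sum_pmf \<mu> (2 * n)) (w n)) sequentially"
      using pos2 by eventually_elim simp
    ultimately show ?thesis by (rule Lim_transform_eventually)
  qed
  have "\<delta> * a\<^sup>2 / 16 \<le> l * limit_density (l * (y + y'))"
    by (rule tendsto_lowerbound[OF upper lower]) simp
  moreover have "0 < \<delta> * a\<^sup>2 / 16" using \<delta>(1) a by simp
  ultimately have "0 < l * limit_density (l * (y + y'))" by linarith
  moreover have "l > 0" by (simp add: l_def)
  ultimately show ?thesis by (simp add: zero_less_mult_iff l_def)
qed

text \<open>Add up \<open>2 ^ k\<close> points, \<open>j\<close> of them equal to \<open>a\<close>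
  and the others to \<open>b\<close>, along a binary tree; each level contributes one factor
  \<open>2 powr (- 1 / \<alpha>)\<close>.\<close>

lemma limit_density_dyadic:
  assumes "0 < limit_density a" "0 < limit_density b" "j \<le> 2 ^ k"
  shows "0 < limit_density ((2 powr (- 1 / \<alpha>)) ^ k * (real j * a + (2 ^ k - real j) * b))"
  using assms(3)
proof (induction k arbitrary: j)
  case 0
  then have "j = 0 \<or> j = 1" by auto
  then show ?case using assms(1,2) by auto
next
  case (Suc k)
  define i where "i = min j (2 ^ k)"
  have i: "i \<le> 2 ^ k" "j - i \<le> 2 ^ k" "i \<le> j" using Suc.prems by (auto simp: i_def)
  let ?l = "2 powr (- 1 / \<alpha>)"
  have "0 < limit_density (?l * (?l ^ k * (real i * a + (2 ^ k - real i) * b) +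
      ?l ^ k * (real (j - i) * a + (2 ^ k - real (j - i)) * b)))"
    by (intro limit_density_add Suc.IH i)
  also have "?l * (?l ^ k * (real i * a + (2 ^ k - real i) * b) +
      ?l ^ k * (real (j - i) * a + (2 ^ k - real (j - i)) * b)) =
      ?l ^ Suc k * (real j * a + (2 ^ Suc k - real j) * b)"
    using i(3) by (simp add: of_nat_diff algebra_simps)
  finally show ?case .
qed

text \<open>The contraction in \<open>limit_density_dyadic\<close> fixes 0, so it suffices to write
  0 exactly as a dyadic average of two points of positive density. For this \<open>a\<close> is
  moved slightly, and continuity keeps the density positive.\<close>

lemma limit_density_0_pos: "0 < limit_density 0"
proof -
  obtain a where a: "0 < a" "0 < limit_density a" using limit_density_pos_side[of 1] by auto
  obtain b where b: "b < 0" "0 < limit_density b" using limit_density_pos_side[of "- 1"] by auto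
  \<comment> \<open>The weight with \<open>t * a + (1 - t) * b = 0\<close>.\<close>
  define t where "t = - b / (a - b)"
  have t: "0 < t" "t < 1" using a b by (auto simp: t_def field_simps)
  define j where "j k = nat \<lfloor>t * 2 ^ k\<rfloor>" for k :: nat
  have j_le: "real (j k) \<le> t * 2 ^ k" and j_ge: "t * 2 ^ k - 1 \<le> real (j k)" for k
  proof -
    have "0 \<le> t * 2 ^ k" using t by simp
    then show "real (j k) \<le> t * 2 ^ k" "t * 2 ^ k - 1 \<le> real (j k)" unfolding j_def by linarith+
  qed
  have jt: "(\<lambda>k. real (j k) / 2 ^ k) \<longlonglongrightarrow> t"
  proof (rule tendsto_sandwich)
    show "eventually (\<lambda>k. t - (1 / 2) ^ k \<le> real (j k) / 2 ^ k) sequentially"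
    proof (intro always_eventually allI)
      fix k
      have "(t * 2 ^ k - 1) / 2 ^ k \<le> real (j k) / 2 ^ k" using j_ge by (intro divide_right_mono) auto
      then show "t - (1 / 2) ^ k \<le> real (j k) / 2 ^ k" by (simp add: diff_divide_distrib power_one_over)
    qed
    show "eventually (\<lambda>k. real (j k) / 2 ^ k \<le> t) sequentially"
      using j_le by (intro always_eventually allI) (simp add: field_simps)
    have "(\<lambda>k. t - (1 / 2) ^ k) \<longlonglongrightarrow> t - 0" by (intro tendsto_intros LIMSEQ_realpow_zero) auto
    then show "(\<lambda>k. t - (1 / 2) ^ k) \<longlonglongrightarrow> t" by simp
  qed simp
  \<comment> \<open>The solution of \<open>j k * a' k + (2 ^ k - j k) * b = 0\<close>; it tends to
    \<open>a\<close>.\<close>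
  define a' where "a' k = - b * (1 - real (j k) / 2 ^ k) / (real (j k) / 2 ^ k)" for k
  have "a' \<longlonglongrightarrow> - b * (1 - t) / t"
    unfolding a'_def[abs_def] by (intro tendsto_intros jt) (use t in auto)
  also have "- b * (1 - t) / t = a"
  proof -
    have "1 - t = a / (a - b)" using a b by (simp add: t_def field_simps)
    then show ?thesis using a b by (simp add: t_def field_simps)
  qed
  finally have "(\<lambda>k. limit_density (a' k)) \<longlonglongrightarrow> limit_density a"
    by (rule isCont_tendsto_compose[OF isCont_limit_density])
  then have "eventually (\<lambda>k. 0 < limit_density (a' k)) sequentially" by (rule order_tendstoD) (rule a)
  moreover have "eventually (\<lambda>k. 0 < real (j k) / 2 ^ k) sequentially" using jt t(1) by (rule order_tendstoD)
  ultimately have "eventually (\<lambda>k. 0 < limit_density (a' k) \<and> 0 < real (j k)) sequentially"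
    by eventually_elim (simp add: zero_less_divide_iff)
  then obtain k where k: "0 < limit_density (a' k)" "0 < real (j k)" by (auto simp: eventually_sequentially)
  have "t * 2 ^ k \<le> 1 * 2 ^ k" using t by (intro mult_right_mono) auto
  from order_trans[OF j_le this] have "real (j k) \<le> real (2 ^ k)" by simp
  then have "j k \<le> 2 ^ k" by (simp only: of_nat_le_iff)
  from limit_density_dyadic[OF k(1) b(2) this]
  have "0 < limit_density ((2 powr (- 1 / \<alpha>)) ^ k * (real (j k) * a' k + (2 ^ k - real (j k)) * b))" .
  moreover have "real (j k) * a' k + (2 ^ k - real (j k)) * b = 0"
    using k(2) by (simp add: a'_def field_simps)
  ultimately show ?thesis by simp
qed

end

subsection \<open>Regularity of the height process\<close>

text \<open>A drop satisfies \<open>D \<le> K * (D + d) powr \<gamma>\<close> with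
  \<open>d = j - i\<close>. For \<open>D \<le> d\<close> this gives the first term; otherwise
  \<open>D\<close> bounds itself, \<open>D powr (1 - \<gamma>) \<le> 2 * K\<close>, whence the term
  without \<open>d\<close>.\<close>

lemma heights_increment:
  fixes f :: forest
  defines "t \<equiv> Tree f Void"
  assumes hold: "records_holder K \<gamma> (code t)" "records_holder K \<gamma> (code (mirror t))"
    and K: "K \<ge> 0" and \<gamma>: "0 < \<gamma>" "\<gamma> < 1" and ij: "i < j" "j \<le> size f"
  shows "\<bar>real (heights t ! i) - real (heights t ! j)\<bar> \<le>
    2 * K * real (j - i) powr \<gamma> + (2 * K) powr (1 / (1 - \<gamma>))"
proof -
  have rise: "real (heights g ! b) \<le> real (heights g ! a) + K * real (b - a) powr \<gamma>"
    if "a \<le> b" "b < size g" "records_holder K \<gamma> (code g)" for a b g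
  proof -
    have "real (records 0 (window a b (code g))) \<le> K * real (b - a) powr \<gamma>"
      using that unfolding records_holder_def by simp
    moreover have "heights g ! b \<le> heights g ! a + records 0 (window a b (code g))"
      using records_window[OF that(1,2)] by (simp add: window_def)
    ultimately show ?thesis by linarith
  qed
  have nn: "0 \<le> K * real (j - i) powr \<gamma>" "0 \<le> (2 * K) powr (1 / (1 - \<gamma>))" using K by auto
  have jt: "j < size t" using ij by (simp add: t_def)
  show ?thesis
  proof (cases "heights t ! i \<le> heights t ! j")
    case True
    then have "real (heights t ! i) \<le> real (heights t ! j)" by simp
    then show ?thesis using rise[OF less_imp_le[OF ij(1)] jt hold(1)] nn unfolding mult.assoc by linarith
  next
    case False
    define D where "D = heights t ! i - heights t ! j"
    have D: "heights t ! i = heights t ! j + D" "D > 0" using False by (auto simp: D_def)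
    obtain a b where ab: "a \<le> b" "b < size t" "heights (mirror t) ! b = heights (mirror t) ! a + D"
      "b + i \<le> a + D + j" using mirror_drop[OF ij(1) jt D(1)] by blast
    have gap: "real (b - a) \<le> real D + real (j - i)" using ab ij by linarith
    have "real D \<le> K * real (b - a) powr \<gamma>" using rise[OF ab(1) _ hold(2)] ab by simp
    also have "\<dots> \<le> K * (real D + real (j - i)) powr \<gamma>"
      using gap K \<gamma> by (intro mult_left_mono powr_mono2) auto
    finally have main: "real D \<le> K * (real D + real (j - i)) powr \<gamma>" .
    have two: "(2 :: real) powr \<gamma> \<le> 2" using \<gamma> powr_mono[of \<gamma> 1 2] by simp
    have "real D \<le> 2 * K * real (j - i) powr \<gamma> + (2 * K) powr (1 / (1 - \<gamma>))"
    proof (cases "D \<le> j - i")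
      case True
      have "real D \<le> K * (2 * real (j - i)) powr \<gamma>"
        using True K \<gamma> by (intro order_trans[OF main] mult_left_mono powr_mono2) auto
      also have "\<dots> = K * (2 powr \<gamma> * real (j - i) powr \<gamma>)" by (simp add: powr_mult)
      also have "\<dots> \<le> K * (2 * real (j - i) powr \<gamma>)"
        using two K by (intro mult_left_mono mult_right_mono) auto
      also have "\<dots> = 2 * K * real (j - i) powr \<gamma>" by simp
      finally show ?thesis using nn(2) by linarith
    next
      case False
      have "real D \<le> K * (2 * real D) powr \<gamma>"
        using False K \<gamma> by (intro order_trans[OF main] mult_left_mono powr_mono2) auto
      also have "\<dots> = K * (2 powr \<gamma> * real D powr \<gamma>)" by (simp add: powr_mult)
      also have "\<dots> \<le> K * (2 * real D powr \<gamma>)"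
        using two K by (intro mult_left_mono mult_right_mono) auto
      finally have "real D / real D powr \<gamma> \<le> 2 * K" using D(2) by (simp add: field_simps)
      then have "real D powr (1 - \<gamma>) \<le> 2 * K" using D(2) by (simp add: powr_diff)
      then have "(real D powr (1 - \<gamma>)) powr (1 / (1 - \<gamma>)) \<le> (2 * K) powr (1 / (1 - \<gamma>))"
        using \<gamma> by (intro powr_mono2) auto
      then have "real D \<le> (2 * K) powr (1 / (1 - \<gamma>))" using \<gamma> D(2) by (simp add: powr_powr)
      then show ?thesis using nn(1) by linarith
    qed
    then show ?thesis using D by simp
  qed
qed

text \<open>Two points are separated by at most a partial cell, a run of whole cells and another
  partial cell, hence the factor 3. Inside a cell, linear growth is turned into Hoelder growth by
  \<open>z \<le> z powr \<gamma>\<close> for \<open>0 \<le> z \<le> 1\<close>.\<close>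

lemma interpolation_holder:
  fixes h :: "nat \<Rightarrow> real" and A \<gamma> :: real
  defines "G \<equiv> \<lambda>x. h (nat \<lfloor>x\<rfloor>) + frac x * (h (Suc (nat \<lfloor>x\<rfloor>)) - h (nat \<lfloor>x\<rfloor>))"
  assumes h: "\<And>i j. i < j \<Longrightarrow> j \<le> n \<Longrightarrow> \<bar>h i - h j\<bar> \<le> A * real (j - i) powr \<gamma>"
    and A: "A \<ge> 0" and \<gamma>: "0 < \<gamma>" "\<gamma> \<le> 1" and xy: "0 \<le> x" "x < y" "y \<le> real n"
  shows "\<bar>G y - G x\<bar> \<le> 3 * A * (y - x) powr \<gamma>"
proof -
  have G_cell: "G z = h k + (z - real k) * (h (Suc k) - h k)" if "real k \<le> z" "z \<le> real k + 1" for z k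
  proof (cases "z = real k + 1")
    case True
    then have "z = real (Suc k)" by simp
    then show ?thesis by (simp add: G_def frac_def del: of_nat_Suc) (simp add: True)
  next
    case False
    then have "\<lfloor>z\<rfloor> = int k" using that by (intro floor_unique) auto
    then show ?thesis by (simp add: G_def frac_def)
  qed
  have cell: "\<bar>G z - G v\<bar> \<le> A * (z - v) powr \<gamma>"
    if "real k \<le> v" "v \<le> z" "z \<le> real k + 1" "k < n" for v z k
  proof -
    have "G z - G v = (z - v) * (h (Suc k) - h k)"
      using G_cell[of k z] G_cell[of k v] that by (simp add: algebra_simps)
    then have "\<bar>G z - G v\<bar> = (z - v) * \<bar>h k - h (Suc k)\<bar>" using that by (simp add: abs_mult abs_minus_commute)
    also have "\<dots> \<le> (z - v) * A" using h[of k "Suc k"] that by (intro mult_left_mono) auto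
    also have "\<dots> \<le> (z - v) powr \<gamma> * A"
    proof (intro mult_right_mono A)
      show "z - v \<le> (z - v) powr \<gamma>"
      proof (cases "z = v")
        case False
        then have "(z - v) powr 1 \<le> (z - v) powr \<gamma>" using that \<gamma> by (intro powr_mono') auto
        then show ?thesis using that by simp
      qed simp
    qed
    finally show ?thesis by (simp add: mult.commute)
  qed
  define i where "i = nat \<lfloor>x\<rfloor>"
  have i: "real i \<le> x" "x < real i + 1" using xy unfolding i_def by linarith+
  have "real i < real n" using i xy by linarith
  then have "i < n" by simp
  have nn: "0 \<le> A * (y - x) powr \<gamma>" using A by simp
  show ?thesis
  proof (cases "y \<le> real i + 1")
    case True
    then show ?thesis using cell[of i x y] i xy \<open>i < n\<close> nn by simp
  next
    case False
    define j where "j = nat \<lfloor>y\<rfloor>"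
    have j: "real j \<le> y" "y < real j + 1" using xy unfolding j_def by linarith+
    have "real i + 1 < real j + 1" using False j by linarith
    then have "Suc i \<le> j" by simp
    have "real j \<le> real n" using j xy by linarith
    then have "j \<le> n" by simp
    have Gi: "G (real k) = h k" for k using G_cell[of k "real k"] by simp
    have mono: "A * z powr \<gamma> \<le> A * (y - x) powr \<gamma>" if "0 \<le> z" "z \<le> y - x" for z
      using that A \<gamma> by (intro mult_left_mono powr_mono2) auto
    have 1: "\<bar>G (real (Suc i)) - G x\<bar> \<le> A * (y - x) powr \<gamma>"
    proof -
      have "\<bar>G (real (Suc i)) - G x\<bar> \<le> A * (real (Suc i) - x) powr \<gamma>"
        using cell[of i x "real (Suc i)"] i \<open>i < n\<close> by simp
      also have "\<dots> \<le> A * (y - x) powr \<gamma>" using i False by (intro mono) auto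
      finally show ?thesis .
    qed
    have 2: "\<bar>G (real j) - G (real (Suc i))\<bar> \<le> A * (y - x) powr \<gamma>"
    proof (cases "Suc i = j")
      case True
      then show ?thesis using nn by simp
    next
      case False
      then have "\<bar>h (Suc i) - h j\<bar> \<le> A * real (j - Suc i) powr \<gamma>"
        using \<open>Suc i \<le> j\<close> \<open>j \<le> n\<close> by (intro h) auto
      also have "\<dots> \<le> A * (y - x) powr \<gamma>" using i j \<open>Suc i \<le> j\<close> by (intro mono) (auto simp: of_nat_diff)
      finally show ?thesis by (simp add: Gi abs_minus_commute del: of_nat_Suc)
    qed
    have 3: "\<bar>G y - G (real j)\<bar> \<le> A * (y - x) powr \<gamma>"
    proof (cases "y = real j")
      case True
      then show ?thesis using nn by simp
    next
      case False
      then have "real j < real n" using j xy by linarith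
      then have "\<bar>G y - G (real j)\<bar> \<le> A * (y - real j) powr \<gamma>"
        using cell[of j "real j" y] j by simp
      also have "\<dots> \<le> A * (y - x) powr \<gamma>"
        using j \<open>Suc i \<le> j\<close> i by (intro mono) auto
      finally show ?thesis .
    qed
    show ?thesis using 1 2 3 by linarith
  qed
qed

section \<open>Scaling bounds valid at all lengths\<close>

context stable_domain
begin

lemma B_le: "1 \<le> m \<Longrightarrow> m \<le> n \<Longrightarrow> B m \<le> B n"
  using B_mono by (auto simp: mono_on_def)

text \<open>Multiplied by \<open>B l\<close>, the left-hand tent lies below \<open>l - s\<close>,
  and its expectation has a positive limit since the stable law charges the negative
  half-line.\<close>

lemma expectation_negative_part:
  "\<exists>c>0. eventually (\<lambda>l. c * B l \<le> measure_pmf.expectation (replicate_pmf l \<mu>) (\<lambda>xs. real (l - sum_list xs))) sequentially"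
proof -
  obtain b where b: "b > 0" "(\<integral>x. bump b (- 1 * x) \<partial>\<nu>) > 0" using ex_bump[of "- 1"] by blast
  define c where "c = (\<integral>x. bump b (- 1 * x) \<partial>\<nu>) / 2"
  have c: "0 < c" "c < (\<integral>x. bump b (- 1 * x) \<partial>\<nu>)" using b(2) by (auto simp: c_def)
  have "eventually (\<lambda>l. c * B l \<le> measure_pmf.expectation (replicate_pmf l \<mu>) (\<lambda>xs. real (l - sum_list xs))) sequentially"
    using order_tendstoD(1)[OF bump_limit[OF b(1)] c(2)] B_pos
  proof eventually_elim
    case (elim l)
    have "c * B l \<le> measure_pmf.expectation (sum_pmf \<mu> l) (\<lambda>s. bump b (- 1 * ((real s - real l) / B l))) * B l"
      using elim by (intro mult_right_mono) auto
    also have "\<dots> = measure_pmf.expectation (sum_pmf \<mu> l) (\<lambda>s. bump b (- 1 * ((real s - real l) / B l)) * B l)"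
      by simp
    also have "\<dots> \<le> measure_pmf.expectation (sum_pmf \<mu> l) (\<lambda>s. real (l - s))"
    proof (rule integral_mono)
      show "integrable (measure_pmf (sum_pmf \<mu> l)) (\<lambda>s. bump b (- 1 * ((real s - real l) / B l)) * B l)"
        using bump_bounds(1,2)[of b] b(1)
        by (intro integrable_mult_left measure_pmf.integrable_const_bound[where B = b]) auto
      show "integrable (measure_pmf (sum_pmf \<mu> l)) (\<lambda>s. real (l - s))"
        by (intro measure_pmf.integrable_const_bound[where B = "real l"]) auto
      fix s
      have "bump b (- 1 * ((real s - real l) / B l)) \<le> max 0 ((real l - real s) / B l)"
        unfolding bump_def by (auto simp: minus_divide_left)
      then have "bump b (- 1 * ((real s - real l) / B l)) * B l \<le> max 0 ((real l - real s) / B l) * B l"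
        using elim(2) by (intro mult_right_mono) auto
      also have "\<dots> = max 0 (real l - real s)" using elim(2) by (simp add: max_mult_distrib_right)
      also have "\<dots> \<le> real (l - s)" by auto
      finally show "bump b (- 1 * ((real s - real l) / B l)) * B l \<le> real (l - s)" .
    qed
    finally show ?case by (simp add: sum_pmf_def)
  qed
  with c(1) show ?thesis by blast
qed

lemma expectation_negative_part_pos:
  assumes "l > 0"
  shows "0 < measure_pmf.expectation (replicate_pmf l \<mu>) (\<lambda>xs. real (l - sum_list xs))"
proof -
  have "0 < pmf \<mu> 0 ^ l" using pmf_0 by simp
  also have "pmf \<mu> 0 ^ l = pmf (replicate_pmf l \<mu>) (replicate l 0)"
    by (simp add: pmf_replicate_pmf prod_list_replicate del: replicate_pmf.simps)
  finally have "0 < real l * pmf (replicate_pmf l \<mu>) (replicate l 0)" using assms by simp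
  also have "\<dots> = measure_pmf.expectation (replicate_pmf l \<mu>) (\<lambda>xs. real l * indicator {replicate l 0} xs)"
    by (simp add: measure_pmf_single)
  also have "\<dots> \<le> measure_pmf.expectation (replicate_pmf l \<mu>) (\<lambda>xs. real (l - sum_list xs))"
    by (intro integral_mono measure_pmf.integrable_const_bound[where B = "real l"])
      (auto simp: indicator_def sum_list_replicate)
  finally show ?thesis .
qed

text \<open>Asymptotic properties of \<open>B\<close> become bounds at all lengths for
  \<open>b n = B (max n k)\<close>, with constants that absorb the lengths below \<open>k\<close>.
  The exponent \<theta> limits the growth of \<open>b\<close> between two lengths, and \<theta>'
  bounds its size from below.\<close>

lemma regularised_scaling:
  assumes \<theta>: "1 / \<alpha> < \<theta>" and \<theta>': "0 \<le> \<theta>'" "\<theta>' < 1 / \<alpha>"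
  obtains b :: "nat \<Rightarrow> real" and c C1 C2 c3 c4 :: real where
    "\<And>n. b n > 0" "0 < c" "0 < C1" "0 < C2" "0 < c3" "0 < c4"
    "eventually (\<lambda>n. b n = B n) sequentially"
    "\<And>l. l > 0 \<Longrightarrow> c * b l \<le> measure_pmf.expectation (replicate_pmf l \<mu>) (\<lambda>xs. real (l - sum_list xs))"
    "\<And>l N. l > 0 \<Longrightarrow> l \<le> N \<Longrightarrow> b N \<le> C1 * (real N / real l) powr \<theta> * b l"
    "\<And>n z. pmf (sum_pmf \<mu> n) z \<le> C2 / b n"
    "eventually (\<lambda>n. c3 / b n \<le> pmf (sum_pmf \<mu> n) (n - 1)) sequentially"
    "eventually (\<lambda>n. c4 * real n powr \<theta>' \<le> b n) sequentially"
proof -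
  obtain c0 where c0: "c0 > 0" "eventually (\<lambda>l. c0 * B l \<le> measure_pmf.expectation (replicate_pmf l \<mu>)
      (\<lambda>xs. real (l - sum_list xs))) sequentially" using expectation_negative_part by blast
  have "eventually (\<lambda>n. local_error n < 1) sequentially"
    by (rule order_tendstoD(2)[OF local_error_tendsto_0]) simp
  with c0(2) B_pos B_double_le[OF \<theta>] B_double_ge[OF \<theta>'(2)] eventually_ge_at_top[of 1]
  have "eventually (\<lambda>n. n \<ge> 1 \<and> B n > 0 \<and> B (2 * n) \<le> 2 powr \<theta> * B n \<and> 2 powr \<theta>' * B n \<le> B (2 * n) \<and>
      c0 * B n \<le> measure_pmf.expectation (replicate_pmf n \<mu>) (\<lambda>xs. real (n - sum_list xs)) \<and> local_error n < 1) sequentially"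
    by eventually_elim simp
  then obtain k where k: "\<And>n. n \<ge> k \<Longrightarrow> n \<ge> 1 \<and> B n > 0 \<and> B (2 * n) \<le> 2 powr \<theta> * B n \<and> 2 powr \<theta>' * B n \<le> B (2 * n) \<and>
      c0 * B n \<le> measure_pmf.expectation (replicate_pmf n \<mu>) (\<lambda>xs. real (n - sum_list xs)) \<and> local_error n < 1"
    by (auto simp: eventually_sequentially)
  define b where "b n = B (max n k)" for n
  have b_pos: "b n > 0" for n using k[of "max n k"] by (simp add: b_def)
  have b_eq: "b n = B n" if "n \<ge> k" for n using that by (simp add: b_def max_absorb1)
  have b_mono: "b m \<le> b n" if "m \<le> n" for m n
    unfolding b_def using k[of k] that by (intro B_le) (auto simp: max_def)
  have b_ev: "eventually (\<lambda>n. b n = B n) sequentially"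
    using eventually_ge_at_top[of k] by eventually_elim (rule b_eq)
  let ?E = "\<lambda>l. measure_pmf.expectation (replicate_pmf l \<mu>) (\<lambda>xs. real (l - sum_list xs))"
  define c where "c = Min (insert c0 ((\<lambda>l. ?E l / b l) ` {1..<k}))"
  have c_pos: "c > 0" unfolding c_def
    using c0(1) b_pos expectation_negative_part_pos by (subst Min_gr_iff) auto
  have low: "c * b l \<le> ?E l" if "l > 0" for l
  proof (cases "l \<ge> k")
    case True
    have "c \<le> c0" unfolding c_def by (intro Min_le) auto
    then have "c * b l \<le> c0 * b l" using b_pos[of l] by (intro mult_right_mono) auto
    then show ?thesis using k[OF True] unfolding b_eq[OF True] by linarith
  next
    case False
    then have "c \<le> ?E l / b l" unfolding c_def using that by (intro Min_le) auto
    then show ?thesis using b_pos[of l] by (simp add: field_simps)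
  qed
  have potter: "b N \<le> 2 powr \<theta> * (real N / real l) powr \<theta> * b l" if "l > 0" "l \<le> N" for l N
  proof (rule doubling_growth[where st = 0])
    show "b (2 * n) \<le> 2 powr \<theta> * b n" for n
    proof -
      have "b (2 * n) \<le> B (2 * max n k)"
        unfolding b_def using k[of k] by (intro B_le) (auto simp: max_def)
      also have "\<dots> \<le> 2 powr \<theta> * B (max n k)" using k[of "max n k"] by simp
      finally show ?thesis by (simp add: b_def)
    qed
    have "0 < 1 / \<alpha>" using \<alpha> by simp
    then show "\<theta> \<ge> 0" using \<theta> by linarith
  qed (use that b_mono b_pos in \<open>auto simp: less_imp_le\<close>)
  define I where "I = (LINT s|lborel. norm (char \<nu> s)) / (2 * pi)"
  have I: "I \<ge> 0" unfolding I_def by (intro divide_nonneg_pos integral_nonneg_AE) auto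
  \<comment> \<open>\<open>I + 1\<close> is the bound on the limit density plus an error below 1.
    For \<open>n < k\<close> the value of \<open>b\<close> is \<open>B k\<close>, and the trivial
    bound 1 on probabilities suffices.\<close>
  define C2 where "C2 = max (I + 1) (B k)"
  have up: "pmf (sum_pmf \<mu> n) z \<le> C2 / b n" for n z
  proof (cases "n \<ge> k")
    case True
    have "B n * pmf (sum_pmf \<mu> n) z \<le> I + 1"
      using local_limit[of n z] limit_density_le[of "(real z - real n) / B n"] k[OF True] unfolding I_def by linarith
    also have "\<dots> \<le> C2" by (simp add: C2_def)
    finally show ?thesis using k[OF True] b_eq[OF True] by (simp add: field_simps)
  next
    case False
    then have "b n = B k" by (simp add: b_def)
    then have "1 \<le> C2 / b n" using k[of k] by (simp add: C2_def field_simps)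
    then show ?thesis using pmf_le_1[of "sum_pmf \<mu> n" z] by linarith
  qed
  have C2: "C2 > 0" using I by (simp add: C2_def less_max_iff_disj)
  \<comment> \<open>The bridge endpoint \<open>n - 1\<close> is at rescaled distance
    \<open>1 / B n\<close> from the centre, so half of the density at 0 is a lower bound in the
    limit.\<close>
  define c3 where "c3 = limit_density 0 / 2"
  have c3: "0 < c3" "c3 < limit_density 0" using limit_density_0_pos by (auto simp: c3_def)
  have "(\<lambda>n. (real (n - 1) - real n) / B n) \<longlonglongrightarrow> 0"
  proof -
    have "(\<lambda>n. - 1 / B n) \<longlonglongrightarrow> 0"
      by (rule tendsto_divide_0[OF tendsto_const filterlim_at_top_imp_at_infinity[OF B_at_top]])
    moreover have "eventually (\<lambda>n. - 1 / B n = (real (n - 1) - real n) / B n) sequentially"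
      using eventually_ge_at_top[of 1] by eventually_elim (simp add: of_nat_diff)
    ultimately show ?thesis by (rule Lim_transform_eventually)
  qed
  from order_tendstoD(1)[OF pmf_limit[OF this] c3(2)] b_ev
  have bridge: "eventually (\<lambda>n. c3 / b n \<le> pmf (sum_pmf \<mu> n) (n - 1)) sequentially"
  proof eventually_elim
    case (elim n)
    then show ?case using b_pos[of n] by (simp add: field_simps)
  qed
  define c4 where "c4 = B k / (2 * real k) powr \<theta>'"
  have k1: "k \<ge> 1" using k[of k] by simp
  have c4: "c4 > 0" using k[of k] by (simp add: c4_def)
  have growth: "eventually (\<lambda>n. c4 * real n powr \<theta>' \<le> b n) sequentially"
    using eventually_ge_at_top[of k]
  proof eventually_elim
    case (elim n)
    have iter: "(2 powr \<theta>') ^ q * B k \<le> B (2 ^ q * k)" for q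
    proof (induction q)
      case (Suc q)
      have "2 powr \<theta>' * ((2 powr \<theta>') ^ q * B k) \<le> 2 powr \<theta>' * B (2 ^ q * k)"
        using Suc by (intro mult_left_mono) auto
      also have "\<dots> \<le> B (2 * (2 ^ q * k))" using k[of "2 ^ q * k"] by simp
      finally show ?case by (simp add: mult.assoc)
    qed simp
    have "n div k > 0" using elim k1 by (simp add: div_greater_zero_iff)
    then obtain q where q: "2 ^ q \<le> n div k" "n div k < 2 ^ Suc q" using ex_power_ivl1[of 2 "n div k"] by auto
    have "n < 2 ^ Suc q * k" using q(2) k1 by (simp add: div_less_iff_less_mult del: power_Suc)
    then have "real n \<le> real (2 ^ Suc q * k)" by (simp only: of_nat_le_iff)
    then have "real n powr \<theta>' \<le> (2 ^ q * (2 * real k)) powr \<theta>'"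
      using \<theta>'(1) by (intro powr_mono2) (auto simp: mult_ac)
    also have "\<dots> = (2 powr \<theta>') ^ q * (2 * real k) powr \<theta>'"
      by (simp add: powr_mult powr_realpow[symmetric] powr_powr mult.commute)
    finally have "c4 * real n powr \<theta>' \<le> c4 * ((2 powr \<theta>') ^ q * (2 * real k) powr \<theta>')"
      using c4 by (intro mult_left_mono) auto
    also have "\<dots> = (2 powr \<theta>') ^ q * B k" using k1 by (simp add: c4_def)
    also have "\<dots> \<le> B (2 ^ q * k)" by (rule iter)
    also have "\<dots> \<le> b n"
    proof -
      have "2 ^ q * k \<le> n" using q(1) k1 by (simp add: less_eq_div_iff_mult_less_eq)
      moreover have "k \<le> 2 ^ q * k" by simp
      ultimately show ?thesis using b_mono[of "2 ^ q * k" n] b_eq[of "2 ^ q * k"] by simp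
    qed
    finally show ?case .
  qed
  show thesis
    by (rule that[of b c "2 powr \<theta>" C2 c3 c4])
      (use b_pos c_pos C2 c3 c4 b_ev low potter up bridge growth in auto)
qed

end

section \<open>From words back to conditioned trees\<close>

lemma conditioned_BGW_prob_le_1: "conditioned_BGW_prob \<mu> n Q \<le> 1"
proof -
  have "measure_pmf.prob (replicate_pmf (n + 1) \<mu>)
       {xs. \<exists>f. size f = n \<and> xs = code (Tree f Void) \<and> Q (tree_words f)} \<le>
     measure_pmf.prob (replicate_pmf (n + 1) \<mu>) {xs. records 0 xs = 0 \<and> deficit 0 xs = 1}"
  proof (rule measure_pmf.finite_measure_mono)
    have "records 0 (code (Tree f Void)) = 0 \<and> deficit 0 (code (Tree f Void)) = 1" for f
      by (simp only: records_code deficit_code) simp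
    then show "{xs. \<exists>f. size f = n \<and> xs = code (Tree f Void) \<and> Q (tree_words f)} \<subseteq>
      {xs. records 0 xs = 0 \<and> deficit 0 xs = 1}" by auto
  qed auto
  then show ?thesis unfolding conditioned_BGW_prob_words by (intro divide_le_eq_1[THEN iffD2]) (auto simp: less_le)
qed

text \<open>\<open>Q\<close> may use regularity of both the code and its mirror image; the two
  failures are equally likely, whence the factor 2.\<close>

lemma conditioned_BGW_prob_ge:
  fixes n :: nat and \<mu> :: "nat pmf" and R :: "nat list \<Rightarrow> bool"
  defines "W \<equiv> replicate_pmf (n + 1) \<mu>"
  assumes pos: "measure_pmf.prob W {xs. records 0 xs = 0 \<and> deficit 0 xs = 1} > 0"
    and Q: "\<And>f. size f = n \<Longrightarrow> R (code (Tree f Void)) \<Longrightarrow> R (code (mirror (Tree f Void))) \<Longrightarrow> Q (tree_words f)"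
  shows "1 - 2 * (measure_pmf.prob W {xs. records 0 xs = 0 \<and> deficit 0 xs = 1 \<and> \<not> R xs} /
    measure_pmf.prob W {xs. records 0 xs = 0 \<and> deficit 0 xs = 1}) \<le> conditioned_BGW_prob \<mu> n Q"
proof -
  define S where "S P = {xs. \<exists>f. size f = n \<and> xs = code (Tree f Void) \<and> P f}" for P
  let ?R = "\<lambda>f. \<not> R (code (Tree f Void))"
  have total: "measure_pmf.prob W {xs. records 0 xs = 0 \<and> deficit 0 xs = 1} = measure_pmf.prob W (S (\<lambda>_. True))"
    using excursion_eq_code[of n \<mu> "\<lambda>_. True"] by (simp only: W_def S_def simp_thms)
  have bad: "measure_pmf.prob W {xs. records 0 xs = 0 \<and> deficit 0 xs = 1 \<and> \<not> R xs} = measure_pmf.prob W (S ?R)"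
    using excursion_eq_code[of n \<mu> "\<lambda>xs. \<not> R xs"] by (simp only: W_def S_def)
  have mirror: "measure_pmf.prob W (S (\<lambda>f. ?R (mirror f))) = measure_pmf.prob W (S ?R)"
    unfolding W_def S_def by (rule prob_code_mirror)
  have "measure_pmf.prob W (S (\<lambda>_. True)) \<le>
      measure_pmf.prob W (S (\<lambda>f. Q (tree_words f)) \<union> (S ?R \<union> S (\<lambda>f. ?R (mirror f))))"
  proof (rule measure_pmf.finite_measure_mono)
    show "S (\<lambda>_. True) \<subseteq> S (\<lambda>f. Q (tree_words f)) \<union> (S ?R \<union> S (\<lambda>f. ?R (mirror f)))"
      using Q unfolding S_def by fastforce
  qed auto
  also have "\<dots> \<le> measure_pmf.prob W (S (\<lambda>f. Q (tree_words f))) + (measure_pmf.prob W (S ?R) + measure_pmf.prob W (S (\<lambda>f. ?R (mirror f))))"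
    by (intro order_trans[OF measure_Un_le] add_left_mono
        measure_Un_le) auto
  finally have le: "measure_pmf.prob W (S (\<lambda>_. True)) - 2 * measure_pmf.prob W (S ?R) \<le>
      measure_pmf.prob W (S (\<lambda>f. Q (tree_words f)))" using mirror by linarith
  have p: "measure_pmf.prob W (S (\<lambda>_. True)) > 0" using pos total by simp
  have "1 - 2 * (measure_pmf.prob W (S ?R) / measure_pmf.prob W (S (\<lambda>_. True))) =
     (measure_pmf.prob W (S (\<lambda>_. True)) - 2 * measure_pmf.prob W (S ?R)) / measure_pmf.prob W (S (\<lambda>_. True))"
    using p by (simp add: diff_divide_distrib)
  also have "\<dots> \<le> measure_pmf.prob W (S (\<lambda>f. Q (tree_words f))) / measure_pmf.prob W (S (\<lambda>_. True))"
    using le p by (intro divide_right_mono) auto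
  also have "\<dots> = conditioned_BGW_prob \<mu> n Q"
    unfolding conditioned_BGW_prob_words total[unfolded W_def] by (simp add: S_def W_def)
  finally show ?thesis unfolding total bad .
qed

abbreviation height_holder :: "real \<Rightarrow> nat \<Rightarrow> real \<Rightarrow> real \<Rightarrow> nat list set \<Rightarrow> bool" where
  "height_holder \<beta> n \<gamma> C T \<equiv> (SUP (s, t) \<in> {(s, t). 0 \<le> s \<and> s \<le> 1 \<and> 0 \<le> t \<and> t \<le> 1 \<and> s \<noteq> t}.
    ereal (\<beta> * (\<bar>height_process T (real n * t) - height_process T (real n * s)\<bar> / \<bar>t - s\<bar> powr \<gamma>))) \<le> ereal C"

lemma height_process_SUP_le:
  fixes f :: forest and \<beta> A \<gamma> C :: real
  defines "n \<equiv> size f"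
  assumes h: "\<And>i j. i < j \<Longrightarrow> j \<le> n \<Longrightarrow>
      \<bar>real (heights (Tree f Void) ! i) - real (heights (Tree f Void) ! j)\<bar> \<le> A * real (j - i) powr \<gamma>"
    and A: "A \<ge> 0" and \<gamma>: "0 < \<gamma>" "\<gamma> \<le> 1" and \<beta>: "0 \<le> \<beta>" and C: "\<beta> * (3 * A * real n powr \<gamma>) \<le> C" and n: "n > 0"
  shows "height_holder \<beta> n \<gamma> C (tree_words f)"
proof -
  define T where "T = tree_words f"
  have dfs: "\<bar>real (length (dfs_vertex T i)) - real (length (dfs_vertex T j))\<bar> \<le> A * real (j - i) powr \<gamma>"
    if "i < j" "j \<le> n" for i j
    using h[OF that] that by (simp add: T_def length_dfs_vertex n_def)
  have main: "\<bar>height_process T (real n * t) - height_process T (real n * s)\<bar> \<le> 3 * A * real n powr \<gamma> * \<bar>t - s\<bar> powr \<gamma>"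
    if "0 \<le> s" "s < t" "t \<le> 1" for s t
  proof -
    have "real n * t \<le> real n * 1" using that by (intro mult_left_mono) auto
    then have "\<bar>height_process T (real n * t) - height_process T (real n * s)\<bar> \<le> 3 * A * (real n * t - real n * s) powr \<gamma>"
      unfolding height_process_def Let_def using that n A \<gamma>
      by (intro interpolation_holder[where n = n] dfs) (auto intro: mult_strict_left_mono)
    also have "real n * t - real n * s = real n * \<bar>t - s\<bar>" using that by (simp add: right_diff_distrib)
    finally show ?thesis using n by (simp add: powr_mult mult.assoc)
  qed
  have "\<beta> * (\<bar>height_process T (real n * t) - height_process T (real n * s)\<bar> / \<bar>t - s\<bar> powr \<gamma>) \<le> C"
    if "0 \<le> s" "s \<le> 1" "0 \<le> t" "t \<le> 1" "s \<noteq> t" for s t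
  proof -
    have "\<bar>height_process T (real n * t) - height_process T (real n * s)\<bar> \<le> 3 * A * real n powr \<gamma> * \<bar>t - s\<bar> powr \<gamma>"
      using main[of s t] main[of t s] that by (cases "s < t") (auto simp: abs_minus_commute)
    then have "\<bar>height_process T (real n * t) - height_process T (real n * s)\<bar> / \<bar>t - s\<bar> powr \<gamma> \<le> 3 * A * real n powr \<gamma>"
      using that by (simp add: pos_divide_le_eq)
    then have "\<beta> * (\<bar>height_process T (real n * t) - height_process T (real n * s)\<bar> / \<bar>t - s\<bar> powr \<gamma>) \<le> \<beta> * (3 * A * real n powr \<gamma>)"
      using \<beta> by (rule mult_left_mono)
    with C show ?thesis by linarith
  qed
  then show ?thesis by (intro SUP_least) (auto simp: T_def)
qed

lemma eventually_const_le_powr: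
  assumes "\<epsilon> > 0"
  shows "eventually (\<lambda>n. D \<le> real n powr \<epsilon>) sequentially"
  using eventually_ge_at_top[of "nat \<lceil>max D 0 powr (1 / \<epsilon>)\<rceil>"]
proof eventually_elim
  case (elim n)
  then have "max D 0 powr (1 / \<epsilon>) \<le> real n" by linarith
  then have "(max D 0 powr (1 / \<epsilon>)) powr \<epsilon> \<le> real n powr \<epsilon>" using assms by (intro powr_mono2) auto
  then show ?case using assms by (simp add: powr_powr)
qed

context stable_domain
begin

text \<open>Records are controlled with an exponent \<gamma>' above \<gamma>. The additive term of
  \<open>heights_increment\<close> is then of order \<open>N / b N powr p\<close> with
  \<open>p = 1 / (1 - \<gamma>')\<close>, and it has to stay below
  \<open>(N / b N) * N powr - \<gamma>\<close>. So \<open>b N powr (p - 1)\<close> must exceed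
  \<open>N powr \<gamma>\<close> by a power of \<open>N\<close>, which a \<gamma>' close to
  \<open>1 - 1 / \<alpha>\<close> ensures.\<close>

lemma height_process_tight:
  assumes \<gamma>: "0 < \<gamma>" "\<gamma> < (\<alpha> - 1) / \<alpha>"
  shows "\<exists>G D. \<exists>m>0. 0 < D \<and> (\<forall>C>0. eventually (\<lambda>n. 1 - G / (D * C) ^ m \<le> conditioned_BGW_prob \<mu> n
    (height_holder (B n / real n) n \<gamma> C)) sequentially)"
proof -
  define \<gamma>0 where "\<gamma>0 = (\<alpha> - 1) / \<alpha>"
  have \<gamma>0: "1 / \<alpha> = 1 - \<gamma>0" "0 < \<gamma>0" "\<gamma>0 < 1" using \<alpha> by (auto simp: \<gamma>0_def field_simps)
  have g0: "\<gamma> < \<gamma>0" using \<gamma> by (simp add: \<gamma>0_def)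
  \<comment> \<open>This leaves room for a \<gamma>' below \<open>\<gamma>0\<close> with
    \<open>\<gamma> * (1 - \<gamma>') / \<gamma>' < 1 / \<alpha>\<close>, so that some \<theta>'
    fits in between.\<close>
  have "\<gamma> / (1 - \<gamma>0 + \<gamma>) < \<gamma>0"
  proof -
    have "\<gamma> * (1 - \<gamma>0) < \<gamma>0 * (1 - \<gamma>0)" using g0 \<gamma>0 by (intro mult_strict_right_mono) auto
    then have "\<gamma> < \<gamma>0 * (1 - \<gamma>0 + \<gamma>)" by (simp add: algebra_simps)
    then show ?thesis using \<gamma> \<gamma>0 by (simp add: pos_divide_less_eq)
  qed
  with g0 obtain \<gamma>' where g1: "max \<gamma> (\<gamma> / (1 - \<gamma>0 + \<gamma>)) < \<gamma>'" "\<gamma>' < \<gamma>0"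
    using dense[of "max \<gamma> (\<gamma> / (1 - \<gamma>0 + \<gamma>))" \<gamma>0] by auto
  have \<gamma>': "\<gamma> < \<gamma>'" "0 < \<gamma>'" "\<gamma>' < 1" using g1 \<gamma> \<gamma>0 by auto
  have "\<gamma> / (1 - \<gamma>0 + \<gamma>) < \<gamma>'" using g1 by simp
  then have "\<gamma> < \<gamma>' * (1 - \<gamma>0 + \<gamma>)" using \<gamma> \<gamma>0 by (simp add: pos_divide_less_eq)
  then have "\<gamma> * (1 - \<gamma>') < (1 - \<gamma>0) * \<gamma>'" by (simp add: algebra_simps)
  then have "\<gamma> * (1 - \<gamma>') / \<gamma>' < 1 - \<gamma>0" using \<gamma>' by (simp add: pos_divide_less_eq)
  then obtain \<theta>' where th': "\<gamma> * (1 - \<gamma>') / \<gamma>' < \<theta>'" "\<theta>' < 1 / \<alpha>" using dense \<gamma>0(1) by metis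
  have \<theta>'0: "0 \<le> \<theta>'"
  proof -
    have "0 \<le> \<gamma> * (1 - \<gamma>') / \<gamma>'" using \<gamma> \<gamma>' by simp
    with th' show ?thesis by linarith
  qed
  have "1 / \<alpha> < 1 - \<gamma>'" using \<gamma>0 g1 by simp
  then obtain \<theta> where th: "1 / \<alpha> < \<theta>" "\<theta> < 1 - \<gamma>'" using dense by blast
  define \<delta> where "\<delta> = 1 - \<gamma>' - \<theta>"
  have \<delta>: "\<delta> > 0" "\<theta> = 1 - \<gamma>' - \<delta>" using th by (auto simp: \<delta>_def)
  define m where "m = nat \<lceil>2 / \<delta>\<rceil>"
  have "2 / \<delta> > 0" using \<delta> by simp
  then have m: "m > 0" "2 / \<delta> \<le> real m" unfolding m_def by linarith+
  then have m\<delta>: "2 \<le> real m * \<delta>" using \<delta> by (simp add: pos_divide_le_eq)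
  obtain b c C1 C2 c3 c4 where b: "\<And>n. b n > 0"
    and cs: "0 < c" "0 < C1" "0 < C2" "0 < c3" "0 < c4"
    and b_eq: "eventually (\<lambda>n. b n = B n) sequentially"
    and low: "\<And>l. l > 0 \<Longrightarrow> c * b l \<le> measure_pmf.expectation (replicate_pmf l \<mu>) (\<lambda>xs. real (l - sum_list xs))"
    and potter: "\<And>l N. l > 0 \<Longrightarrow> l \<le> N \<Longrightarrow> b N \<le> C1 * (real N / real l) powr \<theta> * b l"
    and up: "\<And>n z. pmf (sum_pmf \<mu> n) z \<le> C2 / b n"
    and bridge: "eventually (\<lambda>n. c3 / b n \<le> pmf (sum_pmf \<mu> n) (n - 1)) sequentially"
    and growth: "eventually (\<lambda>n. c4 * real n powr \<theta>' \<le> b n) sequentially"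
  proof (rule regularised_scaling[OF th(1) \<theta>'0 th'(2)], goal_cases)
    case (1 b c C1 C2 c3 c4)
    show ?case by (rule that[OF 1(2-)])
  qed
  have \<theta>0: "0 \<le> \<theta>" using th(1) \<gamma>0 by linarith
  define \<kappa> where "\<kappa> = chaining_const \<gamma>'"
  have \<kappa>: "\<kappa> > 0" unfolding \<kappa>_def by (rule chaining_const_pos[OF \<gamma>'(2)])
  define D where "D = c / (36 * \<kappa> * C1)"
  have D: "D > 0" using cs \<kappa> by (simp add: D_def)
  define G where "G = 2 * (C2 * C1 * 2 powr \<theta> * fact m / c3)"
  define p where "p = 1 / (1 - \<gamma>')"
  have p: "p - 1 = \<gamma>' / (1 - \<gamma>')" "p > 1" using \<gamma>' by (auto simp: p_def field_simps)
  \<comment> \<open>The surplus exponent of \<open>b N powr (p - 1)\<close> over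
    \<open>N powr \<gamma>\<close>, given that \<open>b N\<close> is at least of order
    \<open>N powr \<theta>'\<close>.\<close>
  define \<epsilon> where "\<epsilon> = \<theta>' * (p - 1) - \<gamma>"
  have \<epsilon>: "\<epsilon> > 0"
  proof -
    have "\<gamma> * (1 - \<gamma>') < \<theta>' * \<gamma>'" using th'(1) \<gamma>' by (simp add: pos_divide_less_eq)
    then have "\<gamma> < \<theta>' * \<gamma>' / (1 - \<gamma>')" using \<gamma>' by (simp add: pos_less_divide_eq)
    then show ?thesis by (simp add: \<epsilon>_def p)
  qed
  have tight: "eventually (\<lambda>n. 1 - G / (D * C) ^ m \<le> conditioned_BGW_prob \<mu> n
    (height_holder (B n / real n) n \<gamma> C)) sequentially" if "C > 0" for C
  proof -
    \<comment> \<open>With \<open>a = 2 * \<kappa> * C'\<close>, the final bound is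
      \<open>18 * a\<close>: a factor 3 in \<open>A\<close>, a factor 3 from interpolation and a
      factor 2 from \<open>N / n \<le> 2\<close>.\<close>
    define C' where "C' = C / (36 * \<kappa>)"
    have C': "C' > 0" using that \<kappa> by (simp add: C'_def)
    define a where "a = 2 * \<kappa> * C'"
    have a: "a > 0" "18 * a = C" using that \<kappa> by (auto simp: a_def C'_def)
    define P where "P N \<longleftrightarrow> N \<ge> 2 \<and> b N = B N \<and> c3 / b N \<le> pmf (sum_pmf \<mu> N) (N - 1) \<and>
        c4 * real N powr \<theta>' \<le> b N \<and> (2 * a) powr p / (a * c4 powr (p - 1)) \<le> real N powr \<epsilon>" for N
    have "eventually P sequentially"
      using eventually_ge_at_top[of 2] b_eq bridge growth
        eventually_const_le_powr[OF \<epsilon>, of "(2 * a) powr p / (a * c4 powr (p - 1))"]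
      by eventually_elim (simp add: P_def)
    then have "eventually (\<lambda>n. P (Suc n)) sequentially" by (simp only: eventually_sequentially_Suc)
    with B_pos show ?thesis
    proof eventually_elim
      case (elim n)
      define N where "N = Suc n"
      have N: "N \<ge> 2" "b N = B N" "c3 / b N \<le> pmf (sum_pmf \<mu> N) (N - 1)" "c4 * real N powr \<theta>' \<le> b N"
        "(2 * a) powr p / (a * c4 powr (p - 1)) \<le> real N powr \<epsilon>" using elim(2) by (auto simp only: N_def P_def)
      have n: "n \<ge> 1" "real N = real n + 1" using N(1) by (auto simp: N_def)
      have N0: "real N > 0" using n by simp
      let ?W = "replicate_pmf (n + 1) \<mu>"
      define K where "K = 2 * chaining_const \<gamma>' * C' * (real N / b N) * real N powr - \<gamma>'"
      have K_eq: "K = a * (real N / b N) * real N powr - \<gamma>'" by (simp add: K_def a_def \<kappa>_def)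
      have K: "K \<ge> 0" using a less_imp_le[OF b[of N]] by (simp add: K_eq)
      let ?exc = "measure_pmf.prob ?W {xs. records 0 xs = 0 \<and> deficit 0 xs = 1}"
      let ?bad = "measure_pmf.prob ?W {xs. records 0 xs = 0 \<and> deficit 0 xs = 1 \<and> \<not> records_holder K \<gamma>' xs}"
      \<comment> \<open>A bound on point masses for sums of at least \<open>N / 2\<close> letters;
        between these lengths \<open>b\<close> varies by a factor of at most
        \<open>C1 * 2 powr \<theta>\<close>.\<close>
      define M where "M = C2 * C1 * 2 powr \<theta> / b N"
      have prob_sum: "measure_pmf.prob (replicate_pmf k \<mu>) {xs. sum_list xs = z} = pmf (sum_pmf \<mu> k) z" for k z
        by (simp add: sum_pmf_def pmf_map vimage_def)
      have bad: "real N * ?bad \<le> M * fact m / (C' * c / C1) ^ m"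
      proof -
        have "real N * measure_pmf.prob (replicate_pmf N \<mu>)
          {xs. records 0 xs = 0 \<and> deficit 0 xs = 1 \<and>
            \<not> records_holder (2 * chaining_const \<gamma>' * C' * (real N / b N) * real N powr - \<gamma>') \<gamma>' xs} \<le>
          M * fact m / (C' * c / C1) ^ m"
        proof (rule prob_excursion_not_holder[OF N(1) b cs(1,2) \<gamma>'(2) \<delta>(1) m\<delta> \<delta>(2) C' low])
          fix k z assume k: "N \<le> 2 * k" "k \<le> N"
          then have k0: "k > 0" using N(1) by simp
          have "real N / real k \<le> 2" using k k0 by (simp add: pos_divide_le_eq)
          then have "(real N / real k) powr \<theta> \<le> 2 powr \<theta>" using \<theta>0 by (intro powr_mono2) auto
          then have "C1 * (real N / real k) powr \<theta> * b k \<le> C1 * 2 powr \<theta> * b k"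
            using cs b[of k] by (intro mult_right_mono mult_left_mono) auto
          then have "b N \<le> C1 * 2 powr \<theta> * b k" using potter[OF k0 k(2)] by linarith
          then have "C2 / b k \<le> M" using b[of k] b[of N] cs unfolding M_def
            by (simp add: divide_le_eq pos_le_divide_eq mult_left_mono mult.assoc)
          then show "measure_pmf.prob (replicate_pmf k \<mu>) {xs. sum_list xs = z} \<le> M"
            using up[of k z] unfolding prob_sum by linarith
        qed (assumption, rule potter)
        then show ?thesis by (simp add: K_def N_def)
      qed
      have exc: "c3 / b N \<le> real N * ?exc"
        using prob_bridge_eq(1)[of N \<mu>] N(1,3) by (simp add: prob_sum N_def del: replicate_pmf.simps)
      have c3b: "0 < c3 / b N" using cs b[of N] by simp
      have exc0: "0 < ?exc"
      proof -
        have "0 < real N * ?exc" using exc c3b by linarith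
        then show ?thesis using N0 by (simp only: zero_less_mult_pos)
      qed
      have "?bad / ?exc = (real N * ?bad) / (real N * ?exc)" using N0 by simp
      also have "\<dots> \<le> (M * fact m / (C' * c / C1) ^ m) / (c3 / b N)"
      proof (rule frac_le)
        show "0 \<le> M * fact m / (C' * c / C1) ^ m"
          using order_trans[OF _ bad, of 0] by simp
      qed (use bad exc c3b in auto)
      also have "\<dots> = C2 * C1 * 2 powr \<theta> * fact m / c3 / (C' * c / C1) ^ m"
        using b[of N] by (simp add: M_def)
      also have "C' * c / C1 = D * C" by (simp add: C'_def D_def)
      finally have ratio: "2 * (?bad / ?exc) \<le> G / (D * C) ^ m" by (simp add: G_def)
      \<comment> \<open>The additive term does not depend on the distance, so it is compared with
        the Hoelder bound at distance 1, the worst case.\<close>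
      have incr2: "(2 * K) powr p \<le> a * (real N / b N) * real N powr - \<gamma>"
      proof -
        define X where "X = real N powr (1 - \<gamma>') / b N"
        have X: "0 \<le> X" using less_imp_le[OF b[of N]] by (simp add: X_def)
        have "2 * K = (2 * a) * X"
          using N0 by (simp add: K_eq X_def powr_diff powr_minus field_simps)
        then have "(2 * K) powr p = (2 * a) powr p * X powr p" using X a by (simp only: powr_mult)
        also have "X powr p = real N / b N powr p"
          using N0 b[of N] \<gamma>' by (simp add: X_def powr_divide powr_powr p_def)
        finally have 1: "(2 * K) powr p = (2 * a) powr p * (real N / b N powr p)" .
        have "(2 * a) powr p / a \<le> real N powr \<epsilon> * c4 powr (p - 1)"
        proof -
          have "(2 * a) powr p / (a * c4 powr (p - 1)) * c4 powr (p - 1) \<le> real N powr \<epsilon> * c4 powr (p - 1)"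
            using N(5) by (intro mult_right_mono) auto
          then show ?thesis using cs by simp
        qed
        also have "\<dots> = (c4 * real N powr \<theta>') powr (p - 1) * real N powr - \<gamma>"
        proof -
          have "real N powr (\<theta>' * (p - 1)) * real N powr - \<gamma> = real N powr \<epsilon>"
            by (simp add: \<epsilon>_def flip: powr_add)
          moreover have "(c4 * real N powr \<theta>') powr (p - 1) = c4 powr (p - 1) * real N powr (\<theta>' * (p - 1))"
            using cs by (simp add: powr_mult powr_powr)
          ultimately show ?thesis by (simp add: mult_ac)
        qed
        also have "\<dots> \<le> b N powr (p - 1) * real N powr - \<gamma>"
          using N(4) p cs by (intro mult_right_mono powr_mono2) auto
        finally have "(2 * a) powr p \<le> a * (b N powr (p - 1) * real N powr - \<gamma>)"
          using a by (simp add: pos_divide_le_eq mult.commute)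
        then have "(2 * a) powr p * (real N / b N powr p) \<le> a * (b N powr (p - 1) * real N powr - \<gamma>) * (real N / b N powr p)"
          using N0 by (intro mult_right_mono) auto
        also have "\<dots> = a * (real N / b N) * real N powr - \<gamma>"
          using b[of N] by (simp add: powr_diff)
        finally show ?thesis by (simp add: 1)
      qed
      \<comment> \<open>Two units pay for the term with exponent \<gamma>', the third for the
        additive term.\<close>
      define A where "A = 3 * (a * (real N / b N) * real N powr - \<gamma>)"
      have A: "A \<ge> 0" using a less_imp_le[OF b[of N]] by (simp add: A_def)
      have incr: "2 * K * real d powr \<gamma>' + (2 * K) powr p \<le> A * real d powr \<gamma>" if d: "1 \<le> d" "d \<le> n" for d
      proof -
        have d1: "1 \<le> real d powr \<gamma>" using d \<gamma> by (intro ge_one_powr_ge_zero) auto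
        have "real N powr - \<gamma>' * real d powr \<gamma>' = (real d / real N) powr \<gamma>'"
          using N0 by (simp add: powr_divide powr_minus field_simps)
        also have "\<dots> \<le> (real d / real N) powr \<gamma>"
          using d n N0 \<gamma>' by (intro powr_mono') auto
        also have "\<dots> = real N powr - \<gamma> * real d powr \<gamma>"
          using N0 by (simp add: powr_divide powr_minus field_simps)
        finally have "2 * (a * (real N / b N)) * (real N powr - \<gamma>' * real d powr \<gamma>') \<le>
            2 * (a * (real N / b N)) * (real N powr - \<gamma> * real d powr \<gamma>)"
          using a less_imp_le[OF b[of N]] by (intro mult_left_mono) auto
        moreover have "2 * K * real d powr \<gamma>' = 2 * (a * (real N / b N)) * (real N powr - \<gamma>' * real d powr \<gamma>')"
          by (simp add: K_eq)
        moreover have "(2 * K) powr p \<le> a * (real N / b N) * real N powr - \<gamma> * real d powr \<gamma>"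
        proof -
          have "a * (real N / b N) * real N powr - \<gamma> * 1 \<le> a * (real N / b N) * real N powr - \<gamma> * real d powr \<gamma>"
            using d1 a less_imp_le[OF b[of N]] by (intro mult_left_mono) auto
          with incr2 show ?thesis by simp
        qed
        moreover have "A * real d powr \<gamma> = 2 * (a * (real N / b N)) * (real N powr - \<gamma> * real d powr \<gamma>) +
            a * (real N / b N) * real N powr - \<gamma> * real d powr \<gamma>" by (simp add: A_def)
        ultimately show ?thesis by linarith
      qed
      have C_bound: "B n / real n * (3 * A * real n powr \<gamma>) \<le> C"
      proof -
        have "B n \<le> b N" using B_le[of n N] n N(2) by (simp add: N_def)
        then have q1: "B n / b N \<le> 1" using b[of N] by simp
        have q2: "real N / real n \<le> 2" using n by (simp add: pos_divide_le_eq)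
        have q3: "(real n / real N) powr \<gamma> \<le> 1" using n \<gamma> by (intro powr_le1) auto
        have "B n / real n * (3 * A * real n powr \<gamma>) = 9 * a * ((B n / b N) * (real N / real n)) * (real n / real N) powr \<gamma>"
          using N0 n by (simp add: A_def powr_divide powr_minus field_simps)
        also have "\<dots> \<le> 9 * a * (1 * 2) * 1"
          using a q1 q2 q3 less_imp_le[OF b[of N]] elim(1)
          by (intro mult_mono) auto
        also have "\<dots> = C" using a by simp
        finally show ?thesis .
      qed
      have "1 - 2 * (?bad / ?exc) \<le> conditioned_BGW_prob \<mu> n
        (height_holder (B n / real n) n \<gamma> C)"
      proof (rule conditioned_BGW_prob_ge[OF exc0])
        fix f :: forest
        assume f: "size f = n" "records_holder K \<gamma>' (code (Tree f Void))"
          "records_holder K \<gamma>' (code (mirror (Tree f Void)))"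
        show "height_holder (B n / real n) n \<gamma> C (tree_words f)"
          unfolding f(1)[symmetric]
        proof (rule height_process_SUP_le[OF _ A \<gamma>(1)])
          fix i j assume ij: "i < j" "j \<le> size f"
          show "\<bar>real (heights (Tree f Void) ! i) - real (heights (Tree f Void) ! j)\<bar> \<le> A * real (j - i) powr \<gamma>"
            by (rule order_trans[OF heights_increment[OF f(2,3) K \<gamma>'(2,3) ij] incr[unfolded p_def]])
              (use ij f(1) in auto)
        qed (use \<gamma>' elim(1) C_bound n f(1) in auto)
      qed
      with ratio show ?case by linarith
    qed
  qed
  show ?thesis using m(1) D tight by blast
qed

end

theorem lemma1:
  fixes \<mu> :: "nat pmf" and \<alpha> \<gamma> :: real and B :: "nat \<Rightarrow> real" and \<nu> :: "real measure"
  assumes "pmf \<mu> 0 > 0"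
    and "(\<lambda>k. real k * pmf \<mu> k) sums 1"
    and "group_closure (int ` set_pmf \<mu>) = UNIV"
    and "1 < \<alpha>" and "\<alpha> \<le> 2"
    and "mono_on {1..} B"
    and "stable_law \<alpha> \<nu>"
    and "weak_conv_m (rescaled_sum_law \<mu> B) \<nu>"
    and "0 < \<gamma>" and "\<gamma> < (\<alpha> - 1) / \<alpha>"
  shows "((\<lambda>C :: real. liminf (\<lambda>n. ereal (conditioned_BGW_prob \<mu> n
             (\<lambda>T. (SUP (s, t) \<in> {(s, t). 0 \<le> s \<and> s \<le> 1 \<and> 0 \<le> t \<and> t \<le> 1 \<and> s \<noteq> t}.
                ereal (B n / real n *
                  (\<bar>height_process T (real n * t) - height_process T (real n * s)\<bar>
                    / \<bar>t - s\<bar> powr \<gamma>))) \<le> ereal C))))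
          \<longlongrightarrow> 1) at_top"
proof -
  interpret stable_domain \<mu> \<alpha> B \<nu> by standard (use assms in auto)
  obtain G D m where m: "m > (0 :: nat)" "0 < D" and tight: "\<And>C. C > 0 \<Longrightarrow>
    eventually (\<lambda>n. 1 - G / (D * C) ^ m \<le> conditioned_BGW_prob \<mu> n
    (height_holder (B n / real n) n \<gamma> C)) sequentially"
    using height_process_tight[OF assms(9,10)] by blast
  show ?thesis
  \<comment> \<open>The lower bound \<open>1 - G / (D * C) ^ m\<close> on the liminf has constants
    that do not depend on \<open>C\<close>, and it tends to 1.\<close>
  proof (rule tendsto_sandwich)
    show "eventually (\<lambda>C. ereal (1 - G / (D * C) ^ m) \<le> liminf (\<lambda>n. ereal (conditioned_BGW_prob \<mu> n
             (height_holder (B n / real n) n \<gamma> C)))) at_top"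
      using eventually_gt_at_top[of 0]
    proof eventually_elim
      case (elim C)
      show ?case by (intro Liminf_bounded) (use tight[OF elim] in simp)
    qed
    show "eventually (\<lambda>C. liminf (\<lambda>n. ereal (conditioned_BGW_prob \<mu> n
             (height_holder (B n / real n) n \<gamma> C))) \<le> 1) at_top"
      by (intro always_eventually allI Liminf_le) (auto simp: conditioned_BGW_prob_le_1 one_ereal_def)
    have "filterlim (\<lambda>C. (D * C) ^ m) at_top at_top"
      using m by (intro filterlim_pow_at_top filterlim_tendsto_pos_mult_at_top[OF tendsto_const] filterlim_ident) auto
    then have "((\<lambda>C. 1 - G / (D * C) ^ m) \<longlongrightarrow> 1 - 0) at_top"
      by (intro tendsto_diff tendsto_const tendsto_divide_0[OF tendsto_const]
          filterlim_at_top_imp_at_infinity)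
    then show "((\<lambda>C. ereal (1 - G / (D * C) ^ m)) \<longlongrightarrow> 1) at_top"
      by (simp add: one_ereal_def)
  qed simp
qed

end
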